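(* Let $A=(A_1,\dots,A_g)\in M_d(\mathbb C)^g$ and suppose $L_A$ is a minimal defining pencil for the free spectrahedron $\mathcal D_A$. (1) Assume $A$ has no reducing subspace. The free spectrahedron $\mathcal D_A$ is circular if and only if there is an orthogonal decomposition of $\mathbb C^d$ such that, with respect to this decomposition, the $A_s$ ($1\le s\le g$) have the block decomposition $$A_s=\begin{pmatrix} 0 & A_s(1) & 0 & \cdots & 0\\ 0&0&A_s(2)&\ddots&0\\ \vdots&\vdots&\ddots&\ddots&\vdots\\ 0&0&\ddots&\ddots&A_s(k)\\ 0&0&0&\cdots&0\end{pmatrix},\qquad (\ast)$$ where the $A_s(j)$ are matrices of appropriate sizes and for each $j$ there exists at least one $s_j$ such that $A_{s_j}(j)\ne 0$. In any case (whether or not $A$ has a reducing subspace), $\mathcal D_A$ is circular if and only if the $A_s$ can be written (with respect to an orthogonal decomposition of $\mathbb C^d$ common to all $s$) as a direct sum of block superdiagonal matrices of the form $(\ast)$. (2) The free spectrahedron $\mathcal D_A$ is free circular if and only if there exist $s,t\in\mathbb N$ with $s+t=d$ and a $g$-tuple $F=(F_1,\dots,F_g)$ of $s\times t$ matrices such that $A$ is unitarily equivalent to $$E=\begin{pmatrix}0&F\\0&0\end{pmatrix},$$ i.e., there is a single unitary $U\in M_d(\mathbb C)$ with $U^*A_jU=\begin{pmatrix}0&F_j\\0&0\end{pmatrix}$ for all $j$.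
   Context: $\mathbb N$ denotes the positive integers. For $A\in M_d(\mathbb C)^g$ and $X\in M_n(\mathbb C)^g$ put $L_A(X)=I_d\otimes I_n-\sum_{j=1}^g A_j\otimes X_j-\sum_{j=1}^g A_j^*\otimes X_j^*$. The free spectrahedron $\mathcal D_A$ is the sequence $(\mathcal D_A(n))_{n\in\mathbb N}$ with $\mathcal D_A(n)=\{X\in M_n(\mathbb C)^g: L_A(X)\succeq 0\}$. A sequence $\mathcal D=(\mathcal D(n))_n$ with $\mathcal D(n)\subseteq M_n(\mathbb C)^g$ is circular if $Z\in\mathcal D$ implies $e^{it}Z\in\mathcal D$ for all $t\in\mathbb R$; it is free circular if $UZ=(UZ_1,\dots,UZ_g)\in\mathcal D$ for every $n$, every $Z\in\mathcal D(n)$ and every $n\times n$ unitary matrix $U$. If there is an orthogonal decomposition of $\mathbb C^d$ with respect to which $A=A^1\oplus A^2$ (all $A_s$ simultaneously), then each $L_{A^i}$ is a subpencil of $L_A$; it is a defining subpencil for $\mathcal D_A$ if $\mathcal D_{A^i}=\mathcal D_A$. The pencil $L_A$ is a minimal defining pencil for $\mathcal D_A$ if no proper subpencil of $L_A$ is a defining subpencil for $\mathcal D_A$. $A$ has no reducing subspace means that there is no nonzero proper subspace $M\subseteq\mathbb C^d$ with $A_sM\subseteq M$ and $A_s^*M\subseteq M$ for each $1\le s\le g$. *)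

theory Defs
  imports "Jordan_Normal_Form.Schur_Decomposition" "Jordan_Normal_Form.VS_Connect"
begin

text \<open>
  A \<open>g\<close>-tuple of matrices is a function \<open>'g \<Rightarrow> complex mat\<close> on a finite
  index type with \<open>CARD('g) = g\<close>. Since types are non-empty, \<open>g \<ge> 1\<close>. Matrix sizes are
  carried explicitly, as they vary inside the definitions.
\<close>

type_synonym 'g mat_tuple = "'g \<Rightarrow> complex mat"

definition tuples :: "nat \<Rightarrow> ('g :: finite) mat_tuple set" where
  "tuples n = {X. \<forall>s. X s \<in> carrier_mat n n}"

definition kronecker :: "'a :: semiring_0 mat \<Rightarrow> 'a mat \<Rightarrow> 'a mat" where
  "kronecker A B = mat (dim_row A * dim_row B) (dim_col A * dim_col B)
     (\<lambda>(i, j). A $$ (i div dim_row B, j div dim_col B) * B $$ (i mod dim_row B, j mod dim_col B))"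

text \<open>The type of matrices is not an additive monoid, so \<^const>\<open>sum\<close> does not apply to it.\<close>

definition sum_of_mats :: "nat \<Rightarrow> ('g :: finite \<Rightarrow> 'a :: comm_monoid_add mat) \<Rightarrow> 'a mat" where
  "sum_of_mats m F = mat m m (\<lambda>ij. \<Sum>s\<in>UNIV. F s $$ ij)"

definition pencil :: "nat \<Rightarrow> nat \<Rightarrow> ('g :: finite) mat_tuple \<Rightarrow> 'g mat_tuple \<Rightarrow> complex mat" where
  "pencil d n A X = kronecker (1\<^sub>m d) (1\<^sub>m n)
     - sum_of_mats (d * n) (\<lambda>s. kronecker (A s) (X s))
     - sum_of_mats (d * n) (\<lambda>s. kronecker (mat_adjoint (A s)) (mat_adjoint (X s)))"

definition pos_semidef :: "complex mat \<Rightarrow> bool" where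
  "pos_semidef M \<longleftrightarrow> mat_adjoint M = M \<and>
     (\<forall>v \<in> carrier_vec (dim_row M). 0 \<le> Re ((M *\<^sub>v v) \<bullet>c v))"

definition unitary_mat :: "nat \<Rightarrow> complex mat \<Rightarrow> bool" where
  "unitary_mat n U \<longleftrightarrow> U \<in> carrier_mat n n \<and>
     mat_adjoint U * U = 1\<^sub>m n \<and> U * mat_adjoint U = 1\<^sub>m n"

definition free_spectrahedron :: "nat \<Rightarrow> ('g :: finite) mat_tuple \<Rightarrow> nat \<Rightarrow> 'g mat_tuple set" where
  "free_spectrahedron d A n = {X \<in> tuples n. pos_semidef (pencil d n A X)}"

text \<open>
  Levels of a sequence \<open>\<D> = (\<D>(n))\<close> are indexed by the positive integers; the value at
  \<open>0\<close> is never looked at.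
\<close>

definition circular :: "(nat \<Rightarrow> ('g :: finite) mat_tuple set) \<Rightarrow> bool" where
  "circular D \<longleftrightarrow>
     (\<forall>n\<ge>1. \<forall>Z\<in>D n. \<forall>t::real. (\<lambda>s. exp (\<i> * complex_of_real t) \<cdot>\<^sub>m Z s) \<in> D n)"

definition free_circular :: "(nat \<Rightarrow> ('g :: finite) mat_tuple set) \<Rightarrow> bool" where
  "free_circular D \<longleftrightarrow>
     (\<forall>n\<ge>1. \<forall>Z\<in>D n. \<forall>U. unitary_mat n U \<longrightarrow> (\<lambda>s. U * Z s) \<in> D n)"

text \<open>
  An orthogonal decomposition of \<open>\<complex>\<^sup>d\<close> with respect to which all \<open>A\<^sub>s\<close> have a given block form
  amounts to an adapted orthonormal basis, i.e. to a single unitary \<open>U\<close> such that every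
  \<open>U\<^sup>* A\<^sub>s U\<close> has that form.
\<close>

definition unitarily_equivalent ::
    "nat \<Rightarrow> ('g :: finite) mat_tuple \<Rightarrow> 'g mat_tuple \<Rightarrow> bool" where
  "unitarily_equivalent d A B \<longleftrightarrow>
     (\<exists>U. unitary_mat d U \<and> (\<forall>s. mat_adjoint U * A s * U = B s))"

definition orthogonal_sum ::
    "nat \<Rightarrow> ('g :: finite) mat_tuple \<Rightarrow> nat \<Rightarrow> 'g mat_tuple \<Rightarrow> nat \<Rightarrow> 'g mat_tuple \<Rightarrow> bool" where
  "orthogonal_sum d A d1 A1 d2 A2 \<longleftrightarrow>
     d1 + d2 = d \<and> A1 \<in> tuples d1 \<and> A2 \<in> tuples d2 \<and>
     unitarily_equivalent d A
       (\<lambda>s. four_block_mat (A1 s) (0\<^sub>m d1 d2) (0\<^sub>m d2 d1) (A2 s))"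

text \<open>
  The trivial decompositions \<open>\<complex>\<^sup>d = \<complex>\<^sup>d \<oplus> {0} = {0} \<oplus> \<complex>\<^sup>d\<close> are allowed: they make
  \<open>L\<^sub>A\<close> an (improper) subpencil of itself and the pencil of size \<open>0\<close>, which is
  vacuously positive semidefinite everywhere, a proper subpencil when \<open>d \<ge> 1\<close>. Hence
  \<open>A = 0\<close> (\<open>d \<ge> 1\<close>) is never minimal.
\<close>

definition subpencil ::
    "nat \<Rightarrow> ('g :: finite) mat_tuple \<Rightarrow> nat \<Rightarrow> 'g mat_tuple \<Rightarrow> bool" where
  "subpencil e B d A \<longleftrightarrow>
     (\<exists>e' B'. orthogonal_sum d A e B e' B' \<or> orthogonal_sum d A e' B' e B)"

definition defining_subpencil ::
    "nat \<Rightarrow> ('g :: finite) mat_tuple \<Rightarrow> nat \<Rightarrow> 'g mat_tuple \<Rightarrow> bool" where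
  "defining_subpencil e B d A \<longleftrightarrow> subpencil e B d A \<and>
     (\<forall>n\<ge>1. free_spectrahedron e B n = free_spectrahedron d A n)"

definition minimal_defining_pencil :: "nat \<Rightarrow> ('g :: finite) mat_tuple \<Rightarrow> bool" where
  "minimal_defining_pencil d A \<longleftrightarrow> \<not> (\<exists>e B. e < d \<and> defining_subpencil e B d A)"

definition reducing_subspace :: "nat \<Rightarrow> ('g :: finite) mat_tuple \<Rightarrow> complex vec set \<Rightarrow> bool" where
  "reducing_subspace d A M \<longleftrightarrow>
     VectorSpace.subspace class_ring M (module_vec TYPE(complex) d) \<and>
     M \<noteq> {0\<^sub>v d} \<and> M \<noteq> carrier_vec d \<and>
     (\<forall>s. \<forall>v\<in>M. A s *\<^sub>v v \<in> M \<and> mat_adjoint (A s) *\<^sub>v v \<in> M)"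

text \<open>\<open>block_pos ms i = (b, r)\<close> says that row (or column) \<open>i\<close> is row \<open>r\<close> of block \<open>b\<close>, for
  consecutive blocks of sizes \<open>ms\<close>; blocks, rows and columns are counted from \<open>0\<close>.\<close>

fun block_pos :: "nat list \<Rightarrow> nat \<Rightarrow> nat \<times> nat" where
  "block_pos [] i = (0, i)"
| "block_pos (m # ms) i =
     (if i < m then (0, i) else (case block_pos ms (i - m) of (b, r) \<Rightarrow> (Suc b, r)))"

definition block_mat :: "nat list \<Rightarrow> (nat \<Rightarrow> nat \<Rightarrow> 'a mat) \<Rightarrow> 'a mat" where
  "block_mat ms F = mat (sum_list ms) (sum_list ms)
     (\<lambda>(i, j). case block_pos ms i of (b, r) \<Rightarrow> case block_pos ms j of (c, q) \<Rightarrow> F b c $$ (r, q))"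

text \<open>There are \<open>k + 1\<close> diagonal blocks, and \<open>C s j\<close> is the superdiagonal block in block row
  \<open>j\<close>, i.e. \<open>A\<^sub>s(j + 1)\<close>. The nonvanishing condition forces all block sizes to be positive.\<close>

definition block_superdiagonal :: "('g :: finite) mat_tuple \<Rightarrow> bool" where
  "block_superdiagonal A \<longleftrightarrow>
     (\<exists>k ms C. k \<ge> 1 \<and> length ms = k + 1 \<and>
        (\<forall>s. \<forall>j<k. C s j \<in> carrier_mat (ms ! j) (ms ! (j + 1))) \<and>
        (\<forall>j<k. \<exists>s. C s j \<noteq> 0\<^sub>m (ms ! j) (ms ! (j + 1))) \<and>
        (\<forall>s. A s = block_mat ms
                (\<lambda>b c. if c = b + 1 then C s b else 0\<^sub>m (ms ! b) (ms ! c))))"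

end

theory Submission
  imports Defs "Jordan_Normal_Form.Spectral_Radius" "HOL-Analysis.Function_Topology"
    "HOL-Analysis.L2_Norm"
begin

text \<open>
  The free spectrahedron of a tuple \<open>A\<close> is described, independently of all matrix sizes, by the
  inequality \<open>2 Re \<Sum>\<^sub>s tr (V\<^sup>* A\<^sub>s V Y\<^sub>s) \<le> tr (V\<^sup>* V)\<close> for all \<open>V\<close>, where \<open>Y\<^sub>s\<close> is the transpose
  of the evaluation point. A separation argument shows that an inclusion
  \<open>\<D>\<^sub>C \<subseteq> \<D>\<^sub>A\<close> yields \<open>A\<^sub>s = \<Sum>\<^sub>k W\<^sub>k\<^sup>* C\<^sub>s W\<^sub>k\<close> with \<open>\<Sum>\<^sub>k W\<^sub>k\<^sup>* W\<^sub>k \<le> 1\<close>.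
  Call \<open>A\<close> tight if no proper compression \<open>p A p\<close> has the same domain.
  If \<open>A\<close> is tight and \<open>A\<^sub>s = \<Sum>\<^sub>k T\<^sub>k\<^sup>* A\<^sub>s T\<^sub>k\<close> with \<open>\<Sum>\<^sub>k T\<^sub>k\<^sup>* T\<^sub>k \<le> 1\<close>, then all \<open>T\<^sub>k\<close> commute
  with all \<open>A\<^sub>s\<close> and \<open>A\<^sub>s\<^sup>*\<close>: for \<open>\<Phi> X = \<Sum>\<^sub>k T\<^sub>k\<^sup>* X T\<^sub>k\<close> the Kadison--Schwarz defect
  \<open>\<Phi> (A\<^sub>s\<^sup>* A\<^sub>s) - A\<^sub>s\<^sup>* A\<^sub>s\<close> is summable along the powers of \<open>\<Phi>\<close>, so that a vector on which it
  is positive could be compressed away. It follows that a compression of minimal rank with the same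
  domain is a direct summand, hence minimal pencils are tight, and that tuples with the same domain as
  a tight \<open>A\<close> are intertwined with \<open>A\<close>.

  If \<open>\<D>\<^sub>A\<close> is circular, this applies to \<open>A\<close> and \<open>w A\<close> with \<open>\<bar>w\<bar> = 1\<close> and gives a unitary \<open>U\<close>
  with \<open>U A = w A U\<close>; the eigenspaces of \<open>U\<close> grade \<open>A\<close>. If \<open>\<D>\<^sub>A\<close> is free circular, it is also
  the domain of \<open>((0, A), (0, 0))\<close>, a tuple whose products vanish, so all products \<open>A\<^sub>i A\<^sub>j\<close> vanish.
\<close>


section \<open>Finitely supported matrices\<close>

text \<open>One argument mixes many sizes (compressions of A, a tuple of twice the size, evaluation
  points of every level), so all matrices live in one ring and a size is only a bound on the
  support; this also replaces the sequence of levels by a single set \<open>dset A\<close>. The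
  obstacle is that minimality speaks only of direct summands, whereas rigidity needs information
  about arbitrary compressions: the vector to be cut off need not belong to a reducing subspace. So
  tightness is the working notion, and it is derived from minimality by applying rigidity to a
  compression that is already tight. The domain is not assumed bounded. Inclusion therefore yields
  coefficients with sum of adj W * W at most 1; equality is recovered afterwards from rigidity.
  Iterating \<Phi> needs no invariant state or ergodic limit. It is enough that nonnegative numbers
  with bounded partial sums contain arbitrarily small ones.\<close>

typedef fmat = "{f :: nat \<Rightarrow> nat \<Rightarrow> complex. \<exists>n. \<forall>i j. n \<le> i \<or> n \<le> j \<longrightarrow> f i j = 0}"
  morphisms ent Fmat
  by (rule exI[of _ "\<lambda>_ _. 0"]) simp

definition sz :: "fmat \<Rightarrow> nat \<Rightarrow> bool" where
  "sz M n \<longleftrightarrow> (\<forall>i j. n \<le> i \<or> n \<le> j \<longrightarrow> ent M i j = 0)"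

lemma fmat_eqI: "(\<And>i j. ent M i j = ent N i j) \<Longrightarrow> M = N"
  by (metis ent_inject ext)

lemma sz_ex: "\<exists>n. sz M n"
  using ent[of M] by (auto simp: sz_def)

lemma sz_mono: "sz M n \<Longrightarrow> n \<le> m \<Longrightarrow> sz M m"
  by (auto simp: sz_def)

lemma sz_common:
  assumes "finite I" shows "\<exists>n. \<forall>i\<in>I. sz (F i) n"
  using assms
proof (induction I rule: finite_induct)
  case (insert i I)
  then obtain n where "\<forall>i\<in>I. sz (F i) n" by blast
  moreover obtain m where "sz (F i) m" using sz_ex by blast
  ultimately have "\<forall>j\<in>insert i I. sz (F j) (max n m)"
    by (metis insert_iff max.cobounded1 max.cobounded2 sz_mono)
  then show ?case ..
qed simp

lemma ent_Fmat:
  assumes "\<And>i j. n \<le> i \<or> n \<le> j \<Longrightarrow> f i j = 0"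
  shows "ent (Fmat f) = f"
  by (rule Fmat_inverse) (use assms in blast)

text \<open>The ring has no unit, since the infinite identity is not finitely supported. The
  truncated identities \<open>un n\<close> act as local units; by \<open>sz_iff\<close>, having size
  n means being fixed by \<open>un n\<close> on both sides.\<close>

instantiation fmat :: ring
begin

definition zero_fmat :: fmat where "0 = Fmat (\<lambda>_ _. 0)"
definition plus_fmat :: "fmat \<Rightarrow> fmat \<Rightarrow> fmat" where
  "M + N = Fmat (\<lambda>i j. ent M i j + ent N i j)"
definition minus_fmat :: "fmat \<Rightarrow> fmat \<Rightarrow> fmat" where
  "M - N = Fmat (\<lambda>i j. ent M i j - ent N i j)"
definition uminus_fmat :: "fmat \<Rightarrow> fmat" where
  "- M = Fmat (\<lambda>i j. - ent M i j)"
text \<open>The summation runs over the support of a row, which is finite whatever the sizes are.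
  \<open>ent_times\<close> trades it for any initial segment that covers all nonzero
  products.\<close>

definition times_fmat :: "fmat \<Rightarrow> fmat \<Rightarrow> fmat" where
  "M * N = Fmat (\<lambda>i k. \<Sum>j | ent M i j \<noteq> 0. ent M i j * ent N j k)"

lemma ent_zero: "ent 0 i j = 0"
  unfolding zero_fmat_def by (subst ent_Fmat[of 0]) auto

lemma ent_plus: "ent (M + N) i j = ent M i j + ent N i j"
proof -
  obtain n where "\<forall>X\<in>{M, N}. sz X n" using sz_common[of "{M, N}" id] by auto
  then show ?thesis unfolding plus_fmat_def by (subst ent_Fmat[of n]) (auto simp: sz_def)
qed

lemma ent_minus: "ent (M - N) i j = ent M i j - ent N i j"
proof -
  obtain n where "\<forall>X\<in>{M, N}. sz X n" using sz_common[of "{M, N}" id] by auto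
  then show ?thesis unfolding minus_fmat_def by (subst ent_Fmat[of n]) (auto simp: sz_def)
qed

lemma ent_uminus: "ent (- M) i j = - ent M i j"
proof -
  obtain n where "sz M n" using sz_ex by blast
  then show ?thesis unfolding uminus_fmat_def by (subst ent_Fmat[of n]) (auto simp: sz_def)
qed

lemma ent_times:
  assumes "\<And>j. n \<le> j \<Longrightarrow> ent M i j * ent N j k = 0"
  shows "ent (M * N) i k = (\<Sum>j<n. ent M i j * ent N j k)"
proof -
  obtain m where m: "\<forall>X\<in>{M, N}. sz X m" using sz_common[of "{M, N}" id] by auto
  then have "ent (M * N) i k = (\<Sum>j | ent M i j \<noteq> 0. ent M i j * ent N j k)"
    unfolding times_fmat_def by (subst ent_Fmat[of m]) (auto simp: sz_def)
  also have "\<dots> = (\<Sum>j<m + n. ent M i j * ent N j k)"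
    by (rule sum.mono_neutral_left) (use m in \<open>auto simp: sz_def intro: leI trans_less_add1\<close>)
  also have "\<dots> = (\<Sum>j<n. ent M i j * ent N j k)"
    by (rule sum.mono_neutral_right) (use assms in \<open>auto simp: not_less\<close>)
  finally show ?thesis .
qed

instance
proof
  fix M N K :: fmat
  show "M * N * K = M * (N * K)"
  proof (rule fmat_eqI)
    fix i l
    obtain n where n: "\<forall>X\<in>{M, N, K}. sz X n" using sz_common[of "{M, N, K}" id] by auto
    have "ent (M * N * K) i l = (\<Sum>k<n. ent (M * N) i k * ent K k l)"
      by (rule ent_times) (use n in \<open>auto simp: sz_def\<close>)
    also have "\<dots> = (\<Sum>k<n. (\<Sum>j<n. ent M i j * ent N j k) * ent K k l)"
      by (intro sum.cong refl arg_cong2[where f = "(*)"] ent_times) (use n in \<open>auto simp: sz_def\<close>)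
    also have "\<dots> = (\<Sum>j<n. ent M i j * (\<Sum>k<n. ent N j k * ent K k l))"
      by (subst sum_distrib_right, subst sum.swap) (simp add: sum_distrib_left mult.assoc)
    also have "\<dots> = (\<Sum>j<n. ent M i j * ent (N * K) j l)"
      by (intro sum.cong refl arg_cong2[where f = "(*)"] ent_times[symmetric])
        (use n in \<open>auto simp: sz_def\<close>)
    also have "\<dots> = ent (M * (N * K)) i l"
      by (rule ent_times[symmetric]) (use n in \<open>auto simp: sz_def\<close>)
    finally show "ent (M * N * K) i l = ent (M * (N * K)) i l" .
  qed
  show "(M + N) * K = M * K + N * K" "K * (M + N) = K * M + K * N"
  proof -
    obtain n where n: "\<forall>X\<in>{M, N, K, M + N}. sz X n"
      using sz_common[of "{M, N, K, M + N}" id] by auto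
    have e: "ent (X * Y) i j = (\<Sum>k<n. ent X i k * ent Y k j)"
      if "X \<in> {M, N, K, M + N}" "Y \<in> {M, N, K, M + N}" for X Y i j
      using that n unfolding sz_def by (intro ent_times) force
    show "(M + N) * K = M * K + N * K" "K * (M + N) = K * M + K * N"
      by (rule fmat_eqI; simp add: e ent_plus distrib_left distrib_right sum.distrib)+
  qed
qed (auto intro!: fmat_eqI simp: ent_zero ent_plus ent_minus ent_uminus)

end

lemmas ent_simps [simp] = ent_zero ent_plus ent_minus ent_uminus

lemma ent_sum [simp]: "ent (sum F I) i j = (\<Sum>k\<in>I. ent (F k) i j)"
  by (induction I rule: infinite_finite_induct) auto

lemma ent_times_sz: "sz M n \<or> sz N n \<Longrightarrow> ent (M * N) i k = (\<Sum>j<n. ent M i j * ent N j k)"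
  by (rule ent_times) (auto simp: sz_def)

definition smul :: "complex \<Rightarrow> fmat \<Rightarrow> fmat" where
  "smul c M = Fmat (\<lambda>i j. c * ent M i j)"

definition adj :: "fmat \<Rightarrow> fmat" where
  "adj M = Fmat (\<lambda>i j. cnj (ent M j i))"

definition un :: "nat \<Rightarrow> fmat" where
  "un n = Fmat (\<lambda>i j. if i = j \<and> i < n then 1 else 0)"

definition tr :: "fmat \<Rightarrow> complex" where
  "tr M = (\<Sum>i | ent M i i \<noteq> 0. ent M i i)"

text \<open>The square of the Frobenius norm; keeping the square makes Pythagoras and all expansions
  free of roots.\<close>

definition nrm :: "fmat \<Rightarrow> real" where
  "nrm M = Re (tr (adj M * M))"

lemma ent_smul [simp]: "ent (smul c M) i j = c * ent M i j"
proof -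
  obtain n where "sz M n" using sz_ex by blast
  then show ?thesis unfolding smul_def by (subst ent_Fmat[of n]) (auto simp: sz_def)
qed

lemma ent_adj [simp]: "ent (adj M) i j = cnj (ent M j i)"
proof -
  obtain n where "sz M n" using sz_ex by blast
  then show ?thesis unfolding adj_def by (subst ent_Fmat[of n]) (auto simp: sz_def)
qed

lemma ent_un [simp]: "ent (un n) i j = (if i = j \<and> i < n then 1 else 0)"
  unfolding un_def by (subst ent_Fmat[of n]) auto

lemma tr_sz: "sz M n \<Longrightarrow> tr M = (\<Sum>i<n. ent M i i)"
  unfolding tr_def by (rule sum.mono_neutral_left) (auto simp: sz_def not_less[symmetric])

lemma sz_0 [simp]: "sz 0 n" by (simp add: sz_def)
lemma sz_un [simp]: "sz (un n) n" by (auto simp: sz_def)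
lemma sz_un_mono: "m \<le> n \<Longrightarrow> sz (un m) n" by (auto simp: sz_def)
lemma sz_add: "sz M n \<Longrightarrow> sz N n \<Longrightarrow> sz (M + N) n" by (simp add: sz_def)
lemma sz_diff: "sz M n \<Longrightarrow> sz N n \<Longrightarrow> sz (M - N) n" by (simp add: sz_def)
lemma sz_adj: "sz M n \<Longrightarrow> sz (adj M) n" by (simp add: sz_def)
lemma sz_smul: "sz M n \<Longrightarrow> sz (smul c M) n" by (simp add: sz_def)
lemma sz_sum: "(\<And>i. i \<in> I \<Longrightarrow> sz (F i) n) \<Longrightarrow> sz (sum F I) n" by (simp add: sz_def)
lemma sz_mult: "sz M n \<Longrightarrow> sz N n \<Longrightarrow> sz (M * N) n"
  by (simp add: sz_def ent_times_sz[of M n])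

lemma ent_un_mult: "ent (un n * M) i j = (if i < n then ent M i j else 0)"
proof -
  have "ent (un n * M) i j = (\<Sum>k<n. if k = i then ent M i j else 0)"
    unfolding ent_times_sz[OF disjI1[OF sz_un]] by (rule sum.cong) auto
  then show ?thesis by simp
qed

lemma ent_mult_un: "ent (M * un n) i j = (if j < n then ent M i j else 0)"
proof -
  have "ent (M * un n) i j = (\<Sum>k<n. if k = j then ent M i j else 0)"
    unfolding ent_times_sz[OF disjI2[OF sz_un]] by (rule sum.cong) auto
  then show ?thesis by simp
qed

lemma un_mult_sz: "sz M n \<Longrightarrow> un n * M = M"
  by (rule fmat_eqI) (auto simp: ent_un_mult sz_def)

lemma mult_un_sz: "sz M n \<Longrightarrow> M * un n = M"
  by (rule fmat_eqI) (auto simp: ent_mult_un sz_def)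

lemma sz_iff: "sz M n \<longleftrightarrow> un n * M = M \<and> M * un n = M"
proof
  assume *: "un n * M = M \<and> M * un n = M"
  show "sz M n" unfolding sz_def
    by (metis * ent_un_mult ent_mult_un not_less)
qed (simp add: un_mult_sz mult_un_sz)

lemma un_mult_un: "un n * un m = un (min n m)"
  by (rule fmat_eqI) (simp add: ent_un_mult)

lemma un_idem [simp]: "un n * un n = un n"
  by (simp add: un_mult_un)

lemma un_idem_assoc [simp]: "un n * (un n * M) = un n * M"
  by (simp add: mult.assoc[symmetric])

lemma adj_simps [simp]:
  "adj (adj M) = M" "adj 0 = 0" "adj (un n) = un n"
  "adj (M + N) = adj M + adj N" "adj (M - N) = adj M - adj N" "adj (- M) = - adj M"
  "adj (smul c M) = smul (cnj c) (adj M)" "adj (sum F I) = (\<Sum>i\<in>I. adj (F i))"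
  by (auto intro!: fmat_eqI)

lemma adj_mult [simp]: "adj (M * N) = adj N * adj M"
proof (rule fmat_eqI)
  fix i k
  obtain n where n: "\<forall>X\<in>{M, N}. sz X n" using sz_common[of "{M, N}" id] by auto
  then show "ent (adj (M * N)) i k = ent (adj N * adj M) i k"
    by (subst ent_times_sz[of _ n]) (auto simp: sz_adj ent_times_sz[of M n] mult.commute)
qed

lemma smul_simps [simp]:
  "smul c 0 = 0" "smul 0 M = 0" "smul 1 M = M" "smul a (smul b M) = smul (a * b) M"
  by (auto intro!: fmat_eqI)

lemma smul_distribs:
  "smul c (M + N) = smul c M + smul c N" "smul c (M - N) = smul c M - smul c N"
  "smul (a + b) M = smul a M + smul b M" "smul (a - b) M = smul a M - smul b M"
  "smul c (sum F I) = (\<Sum>i\<in>I. smul c (F i))"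
  "smul c (- M) = - smul c M" "smul (- c) M = - smul c M"
  by (auto intro!: fmat_eqI simp: algebra_simps sum_distrib_left)

lemma smul_mult_left [simp]: "smul c M * N = smul c (M * N)"
proof (rule fmat_eqI)
  fix i k
  obtain n where "sz N n" using sz_ex by blast
  then show "ent (smul c M * N) i k = ent (smul c (M * N)) i k"
    by (simp add: ent_times_sz[of _ n] sum_distrib_left mult.assoc)
qed

lemma smul_mult_right [simp]: "M * smul c N = smul c (M * N)"
proof (rule fmat_eqI)
  fix i k
  obtain n where "sz M n" using sz_ex by blast
  then show "ent (M * smul c N) i k = ent (smul c (M * N)) i k"
    by (simp add: ent_times_sz[of _ n] sum_distrib_left mult_ac)
qed

lemma smul_cancel: "c \<noteq> 0 \<Longrightarrow> smul c M = smul c N \<Longrightarrow> M = N"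
  by (metis smul_simps(3,4) left_inverse)

lemma tr_linear [simp]:
  "tr 0 = 0" "tr (M + N) = tr M + tr N" "tr (M - N) = tr M - tr N" "tr (- M) = - tr M"
  "tr (smul c M) = c * tr M" "tr (adj M) = cnj (tr M)"
proof -
  obtain n where n: "\<forall>X\<in>{M, N}. sz X n" using sz_common[of "{M, N}" id] by auto
  then have "sz (M + N) n" "sz (M - N) n" "sz (- M) n" "sz (smul c M) n" "sz (adj M) n"
    by (auto simp: sz_def)
  then show "tr 0 = 0" "tr (M + N) = tr M + tr N" "tr (M - N) = tr M - tr N" "tr (- M) = - tr M"
  "tr (smul c M) = c * tr M" "tr (adj M) = cnj (tr M)"
    using n by (auto simp: tr_sz[of _ n] sum.distrib sum_subtractf sum_negf sum_distrib_left
       tr_sz[OF sz_0, of 0])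
qed

lemma tr_sum [simp]: "tr (sum F I) = (\<Sum>i\<in>I. tr (F i))"
  by (induction I rule: infinite_finite_induct) auto

lemma tr_un: "tr (un n) = of_nat n"
  by (simp add: tr_sz[of _ n])

lemma tr_commute: "tr (M * N) = tr (N * M)"
proof -
  obtain n where n: "\<forall>X\<in>{M, N}. sz X n" using sz_common[of "{M, N}" id] by auto
  then have "tr (M * N) = (\<Sum>i<n. \<Sum>j<n. ent M i j * ent N j i)"
    by (simp add: tr_sz[of _ n] sz_mult ent_times_sz[of _ n])
  also have "\<dots> = (\<Sum>i<n. \<Sum>j<n. ent N i j * ent M j i)"
    by (subst sum.swap) (simp add: mult.commute)
  also have "\<dots> = tr (N * M)"
    using n by (simp add: tr_sz[of _ n] sz_mult ent_times_sz[of _ n])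
  finally show ?thesis .
qed

lemma nrm_sz:
  assumes "sz M n" shows "nrm M = (\<Sum>i<n. \<Sum>j<n. (cmod (ent M i j))\<^sup>2)"
proof -
  have "tr (adj M * M) = (\<Sum>j<n. \<Sum>i<n. cnj (ent M i j) * ent M i j)"
    using assms by (simp add: tr_sz[of _ n] sz_mult sz_adj ent_times_sz[of _ n])
  then have "tr (adj M * M) = (\<Sum>i<n. \<Sum>j<n. of_real ((cmod (ent M i j))\<^sup>2))"
    by (subst sum.swap) (simp add: complex_norm_square[symmetric] mult.commute)
  then show ?thesis by (simp add: nrm_def flip: of_real_sum)
qed

lemma nrm_ge_0 [simp]: "0 \<le> nrm M"
proof -
  obtain n where "sz M n" using sz_ex by blast
  then show ?thesis by (auto simp: nrm_sz intro!: sum_nonneg)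
qed

lemma ent_le_nrm: "(cmod (ent M i j))\<^sup>2 \<le> nrm M"
proof -
  obtain n where n: "sz M n" using sz_ex by blast
  show ?thesis
  proof (cases "i < n \<and> j < n")
    case True
    have "(cmod (ent M i j))\<^sup>2 \<le> (\<Sum>j<n. (cmod (ent M i j))\<^sup>2)"
      using True by (intro member_le_sum) auto
    also have "\<dots> \<le> (\<Sum>i<n. \<Sum>j<n. (cmod (ent M i j))\<^sup>2)"
      using True by (intro member_le_sum[where f = "\<lambda>i. \<Sum>j<n. (cmod (ent M i j))\<^sup>2"])
        (auto intro: sum_nonneg)
    finally show ?thesis by (simp add: nrm_sz[OF n])
  next
    case False
    then have "ent M i j = 0" using n by (auto simp: sz_def)
    then show ?thesis by simp
  qed
qed

lemma nrm_eq_0_iff [simp]: "nrm M = 0 \<longleftrightarrow> M = 0"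
proof
  assume "nrm M = 0"
  then have "ent M i j = 0" for i j using ent_le_nrm[of M i j] by simp
  then show "M = 0" by (intro fmat_eqI) simp
qed (simp add: nrm_def)

lemma nrm_pos: "M \<noteq> 0 \<Longrightarrow> 0 < nrm M"
  using nrm_ge_0[of M] nrm_eq_0_iff[of M] by linarith

lemma nrm_0 [simp]: "nrm 0 = 0" by simp

lemma nrm_adj [simp]: "nrm (adj M) = nrm M"
  unfolding nrm_def by (subst tr_commute) simp

lemma nrm_smul [simp]: "nrm (smul c M) = (cmod c)\<^sup>2 * nrm M"
proof -
  have c: "cnj c * c = of_real ((cmod c)\<^sup>2)" by (simp only: complex_norm_square mult.commute)
  have "tr (adj (smul c M) * smul c M) = (cnj c * c) * tr (adj M * M)" by simp
  then have eq: "tr (adj (smul c M) * smul c M) = of_real ((cmod c)\<^sup>2) * tr (adj M * M)"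
    by (simp only: c)
  show ?thesis unfolding nrm_def eq by simp
qed

lemma Re_tr_adj_swap: "Re (tr (adj N * M)) = Re (tr (adj M * N))"
proof -
  have "tr (adj N * M) = cnj (tr (adj M * N))" by (simp flip: tr_linear(6))
  then show ?thesis by simp
qed

lemma nrm_add: "nrm (M + N) = nrm M + nrm N + 2 * Re (tr (adj M * N))"
  using Re_tr_adj_swap[of N M] by (simp add: nrm_def algebra_simps)

lemma nrm_diff: "nrm (M - N) = nrm M + nrm N - 2 * Re (tr (adj M * N))"
  using Re_tr_adj_swap[of N M] by (simp add: nrm_def algebra_simps)

text \<open>Young's inequality, from the square of sqrt e * M - N / sqrt e. The free parameter later
  makes mixed terms small against \<open>nrm M\<close>.\<close>

lemma two_Re_tr_le:
  assumes "0 < e" shows "2 * Re (tr (adj M * N)) \<le> e * nrm M + nrm N / e"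
proof -
  define r where "r = complex_of_real (sqrt e)"
  have r: "r * r = of_real e" "cnj r = r" "r \<noteq> 0"
    using assms by (auto simp: r_def simp flip: of_real_mult)
  have c: "(cmod r)\<^sup>2 = e" "(cmod (1 / r))\<^sup>2 = 1 / e"
    using assms by (auto simp: r_def norm_divide power_divide)
  have "0 \<le> nrm (smul r M - smul (1 / r) N)" by simp
  also have "\<dots> = e * nrm M + nrm N / e - 2 * Re (tr (adj M * N))"
    unfolding nrm_diff nrm_smul c using r by simp
  finally show ?thesis by simp
qed

text \<open>Cauchy-Schwarz in every entry of the product.\<close>

lemma nrm_mult_le: "nrm (M * N) \<le> nrm M * nrm N"
proof -
  obtain n where n: "\<forall>X\<in>{M, N}. sz X n" using sz_common[of "{M, N}" id] by auto
  then have s: "sz M n" "sz N n" by auto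
  have "nrm (M * N) = (\<Sum>i<n. \<Sum>k<n. (cmod (\<Sum>j<n. ent M i j * ent N j k))\<^sup>2)"
    using s by (simp add: nrm_sz[of _ n] sz_mult ent_times_sz[of _ n])
  also have "\<dots> \<le> (\<Sum>i<n. \<Sum>k<n. (\<Sum>j<n. (cmod (ent M i j))\<^sup>2) * (\<Sum>j<n. (cmod (ent N j k))\<^sup>2))"
  proof (intro sum_mono)
    fix i k
    have "cmod (\<Sum>j<n. ent M i j * ent N j k) \<le> (\<Sum>j<n. cmod (ent M i j) * cmod (ent N j k))"
      by (rule order_trans[OF norm_sum]) (simp add: norm_mult)
    then have "(cmod (\<Sum>j<n. ent M i j * ent N j k))\<^sup>2
        \<le> (\<Sum>j<n. cmod (ent M i j) * cmod (ent N j k))\<^sup>2"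
      by (simp add: power_mono)
    also have "\<dots> \<le> (\<Sum>j<n. (cmod (ent M i j))\<^sup>2) * (\<Sum>j<n. (cmod (ent N j k))\<^sup>2)"
    proof -
      have "(\<Sum>j<n. cmod (ent M i j) * cmod (ent N j k))
          \<le> L2_set (\<lambda>j. cmod (ent M i j)) {..<n} * L2_set (\<lambda>j. cmod (ent N j k)) {..<n}"
        using L2_set_mult_ineq[of "\<lambda>j. cmod (ent M i j)" "\<lambda>j. cmod (ent N j k)" "{..<n}"] by simp
      from power_mono[OF this, of 2] show ?thesis
        by (simp add: L2_set_def power_mult_distrib sum_nonneg)
    qed
    finally show "(cmod (\<Sum>j<n. ent M i j * ent N j k))\<^sup>2
        \<le> (\<Sum>j<n. (cmod (ent M i j))\<^sup>2) * (\<Sum>j<n. (cmod (ent N j k))\<^sup>2)" .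
  qed
  also have "\<dots> = nrm M * (\<Sum>k<n. \<Sum>j<n. (cmod (ent N j k))\<^sup>2)"
    by (simp only: nrm_sz[OF s(1)] sum_distrib_left[symmetric] sum_distrib_right[symmetric])
  also have "\<dots> = nrm M * nrm N"
    by (subst sum.swap) (simp add: nrm_sz[OF s(2)])
  finally show ?thesis .
qed

section \<open>Orthogonal projections and their ranks\<close>

definition proj :: "fmat \<Rightarrow> bool" where
  "proj p \<longleftrightarrow> adj p = p \<and> p * p = p"

lemma proj_un [simp]: "proj (un n)" by (simp add: proj_def)

lemma proj_pythagoras: "proj p \<Longrightarrow> nrm V = nrm (p * V) + nrm (V - p * V)"
proof -
  assume p: "proj p"
  have "adj (p * V) * (V - p * V) = 0"
    using p by (simp add: proj_def algebra_simps) (metis mult.assoc)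
  then show ?thesis using nrm_add[of "p * V" "V - p * V"] by simp
qed

lemma nrm_proj_mult_le: "proj p \<Longrightarrow> nrm (p * V) \<le> nrm V"
  using proj_pythagoras[of p V] nrm_ge_0[of "V - p * V"] by linarith

lemma nrm_mult_proj_le: "proj p \<Longrightarrow> nrm (V * p) \<le> nrm V"
  using nrm_proj_mult_le[of p "adj V"] nrm_adj[of "V * p"] by (simp add: proj_def)

text \<open>Hence traces of projections can serve as ranks.\<close>

lemma one_le_nrm_proj:
  assumes "proj p" "p \<noteq> 0" shows "1 \<le> nrm p"
proof -
  have "nrm p \<le> nrm p * nrm p" using nrm_mult_le[of p p] assms by (simp add: proj_def)
  then show ?thesis using nrm_pos[OF assms(2)] by simp
qed

lemma nrm_proj_diff:
  assumes "proj p" "proj q" "p * q = q"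
  shows "proj (p - q)" "nrm (p - q) = nrm p - nrm q" "q * p = q"
proof -
  show qp: "q * p = q" using assms by (metis adj_mult proj_def)
  show "proj (p - q)" using assms qp by (simp add: proj_def algebra_simps)
  show "nrm (p - q) = nrm p - nrm q"
    using assms qp by (simp add: nrm_def proj_def algebra_simps)
qed

section \<open>Diagonalization of normal matrices\<close>

definition fm :: "complex mat \<Rightarrow> fmat" where
  "fm M = Fmat (\<lambda>i j. if i < dim_row M \<and> j < dim_col M then M $$ (i, j) else 0)"

definition mt :: "nat \<Rightarrow> fmat \<Rightarrow> complex mat" where
  "mt n M = mat n n (\<lambda>(i, j). ent M i j)"

lemma ent_fm [simp]:
  "ent (fm M) i j = (if i < dim_row M \<and> j < dim_col M then M $$ (i, j) else 0)"
  unfolding fm_def by (subst ent_Fmat[of "max (dim_row M) (dim_col M)"]) auto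

lemma mt_carrier [simp]: "mt n M \<in> carrier_mat n n" "dim_row (mt n M) = n" "dim_col (mt n M) = n"
  by (simp_all add: mt_def)

lemma fm_mt: "sz M n \<Longrightarrow> fm (mt n M) = M"
  by (rule fmat_eqI) (auto simp: mt_def sz_def not_less)

lemma mt_fm: "M \<in> carrier_mat n n \<Longrightarrow> mt n (fm M) = M"
  by (rule eq_matI) (auto simp: mt_def)

lemma sz_fm: "M \<in> carrier_mat n n \<Longrightarrow> sz (fm M) n"
  by (auto simp: sz_def)

lemma fm_inj: "fm M = fm N \<Longrightarrow> M \<in> carrier_mat n n \<Longrightarrow> N \<in> carrier_mat n n \<Longrightarrow> M = N"
  by (metis mt_fm)

lemma fm_mult: "dim_col M = dim_row N \<Longrightarrow> fm (M * N) = fm M * fm N"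
proof (rule fmat_eqI)
  fix i k assume d: "dim_col M = dim_row N"
  have "ent (fm M * fm N) i k = (\<Sum>j<dim_col M. ent (fm M) i j * ent (fm N) j k)"
    by (rule ent_times) simp
  also have "\<dots> = ent (fm (M * N)) i k"
    using d by (auto simp: scalar_prod_def atLeast0LessThan intro: sum.cong)
  finally show "ent (fm (M * N)) i k = ent (fm M * fm N) i k" ..
qed

lemma mat_adjoint_index:
  fixes M :: "complex mat"
  shows "dim_row (mat_adjoint M) = dim_col M" "dim_col (mat_adjoint M) = dim_row M"
    "i < dim_col M \<Longrightarrow> j < dim_row M \<Longrightarrow> mat_adjoint M $$ (i, j) = conjugate (M $$ (j, i))"
  by (simp_all add: mat_adjoint_def mat_of_rows_def)

lemma mat_adjoint_carrier: "(M :: complex mat) \<in> carrier_mat m n \<Longrightarrow> mat_adjoint M \<in> carrier_mat n m"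
  using mat_adjoint_index(1,2)[where M = M] by auto

lemma fm_adjoint: "fm (mat_adjoint M) = adj (fm M)"
  by (rule fmat_eqI) (auto simp: mat_adjoint_index)

lemma fm_one: "fm (1\<^sub>m n) = un n"
  by (rule fmat_eqI) auto

lemma unitary_mat_iff:
  assumes "U \<in> carrier_mat n n"
  shows "unitary_mat n U \<longleftrightarrow> adj (fm U) * fm U = un n \<and> fm U * adj (fm U) = un n"
proof -
  note c = mat_adjoint_carrier[OF assms]
  have "fm (mat_adjoint U * U) = adj (fm U) * fm U" "fm (U * mat_adjoint U) = fm U * adj (fm U)"
    using assms c by (simp_all add: fm_mult fm_adjoint)
  moreover have "M = 1\<^sub>m n \<longleftrightarrow> fm M = un n" if "M \<in> carrier_mat n n" for M
    using fm_inj[of M "1\<^sub>m n" n] that by (auto simp: fm_one)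
  ultimately show ?thesis
    unfolding unitary_mat_def using assms c by (simp add: mult_carrier_mat[of _ n n])
qed

section \<open>Matrix units and diagonal matrices\<close>

definition E :: "nat \<Rightarrow> nat \<Rightarrow> fmat" where
  "E a b = Fmat (\<lambda>i j. if i = a \<and> j = b then 1 else 0)"

definition dg :: "nat \<Rightarrow> (nat \<Rightarrow> complex) \<Rightarrow> fmat" where
  "dg d l = Fmat (\<lambda>i j. if i = j \<and> i < d then l i else 0)"

lemma ent_E [simp]: "ent (E a b) i j = (if i = a \<and> j = b then 1 else 0)"
  unfolding E_def by (subst ent_Fmat[of "Suc (max a b)"]) auto

lemma ent_dg [simp]: "ent (dg d l) i j = (if i = j \<and> i < d then l i else 0)"
  unfolding dg_def by (subst ent_Fmat[of d]) auto

lemma sz_dg [simp]: "sz (dg d l) d"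
  by (auto simp: sz_def)

lemma sz_E: "sz (E a b) (Suc (max a b))"
  by (auto simp: sz_def)

lemma ent_E_mult: "ent (E a b * M) i j = (if i = a then ent M b j else 0)"
proof -
  have "ent (E a b * M) i j = 
      (\<Sum>k<Suc (max a b). if k = b then (if i = a then ent M b j else 0) else 0)"
    unfolding ent_times_sz[OF disjI1[OF sz_E]] by (rule sum.cong) auto
  then show ?thesis by (simp add: less_Suc_eq_le del: sum.lessThan_Suc)
qed

lemma ent_mult_E: "ent (M * E a b) i j = (if j = b then ent M i a else 0)"
proof -
  have "ent (M * E a b) i j = 
      (\<Sum>k<Suc (max a b). if k = a then (if j = b then ent M i a else 0) else 0)"
    unfolding ent_times_sz[OF disjI2[OF sz_E]] by (rule sum.cong) auto
  then show ?thesis by (simp add: less_Suc_eq_le del: sum.lessThan_Suc)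
qed

lemma ent_dg_mult: "ent (dg d l * M) i j = (if i < d then l i * ent M i j else 0)"
proof -
  have "ent (dg d l * M) i j = (\<Sum>k<d. if k = i then l i * ent M i j else 0)"
    unfolding ent_times_sz[OF disjI1[OF sz_dg]] by (rule sum.cong) auto
  then show ?thesis by simp
qed

lemma ent_mult_dg: "ent (M * dg d l) i j = (if j < d then ent M i j * l j else 0)"
proof -
  have "ent (M * dg d l) i j = (\<Sum>k<d. if k = j then ent M i j * l j else 0)"
    unfolding ent_times_sz[OF disjI2[OF sz_dg]] by (rule sum.cong) auto
  then show ?thesis by simp
qed

lemma dg_mult: "dg d l * dg d k = dg d (\<lambda>i. l i * k i)"
  by (rule fmat_eqI) (simp add: ent_dg_mult)

lemma adj_dg [simp]: "adj (dg d l) = dg d (\<lambda>i. cnj (l i))"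
  by (rule fmat_eqI) auto

lemma adj_E [simp]: "adj (E a b) = E b a"
  by (rule fmat_eqI) auto

lemma E_mult: "E a b * E c e = (if b = c then E a e else 0)"
  by (rule fmat_eqI) (auto simp: ent_E_mult)

lemma un_1: "un (Suc 0) = E 0 0"
  by (rule fmat_eqI) auto

lemma tr_E: "tr (E a b) = (if a = b then 1 else 0)"
  by (subst tr_sz[of _ "Suc (max a b)"]) (auto simp: sz_def)

lemma tr_E_mult: "tr (E a b * M) = ent M b a"
proof -
  obtain n where n: "sz M n" using sz_ex by blast
  have "tr (E a b * M) = (\<Sum>i<Suc (max n a). ent (E a b * M) i i)"
    by (rule tr_sz) (use n in \<open>auto simp: sz_def ent_E_mult\<close>)
  also have "\<dots> = ent M b a"
    by (simp only: ent_E_mult) (simp add: less_Suc_eq_le del: sum.lessThan_Suc)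
  finally show ?thesis .
qed

text \<open>Row vectors are matrices supported in row 0, column vectors are matrices supported in
  column 0. A row times a column then sits in the corner (0, 0), and this lemma reads it as a
  scalar.\<close>

lemma one_by_one:
  assumes "un 1 * X = X" "X * un 1 = X" shows "X = smul (tr X) (un 1)"
proof (rule fmat_eqI)
  fix i j
  have "sz X 1" using assms by (simp add: sz_iff)
  then show "ent X i j = ent (smul (tr X) (un 1)) i j"
    by (cases "i = 0 \<and> j = 0") (auto simp: tr_sz[of X 1] sz_def)
qed

section \<open>Unitaries and the spectral theorem\<close>

definition unitary :: "nat \<Rightarrow> fmat \<Rightarrow> bool" where
  "unitary n U \<longleftrightarrow> sz U n \<and> adj U * U = un n \<and> U * adj U = un n"

lemma unitaryD:
  assumes "unitary n U"
  shows "sz U n" "adj U * U = un n" "U * adj U = un n" "un n * U = U" "U * un n = U"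
    "adj U * un n = adj U" "un n * adj U = adj U"
    "adj U * (U * M) = un n * M" "U * (adj U * M) = un n * M"
  using assms un_mult_sz[of U n] mult_un_sz[of U n] un_mult_sz[OF sz_adj, of U n]
    mult_un_sz[OF sz_adj, of U n]
  by (auto simp: unitary_def mult.assoc[symmetric])

lemma unitary_mult: "unitary n U \<Longrightarrow> unitary n V \<Longrightarrow> unitary n (U * V)"
  unfolding unitary_def
  by (auto simp: sz_mult un_mult_sz mult_un_sz sz_adj)
    (metis mult.assoc sz_adj un_mult_sz)+

lemma unitary_adj: "unitary n U \<Longrightarrow> unitary n (adj U)"
  by (auto simp: unitary_def sz_adj)

lemma unitary_fm: "unitary_mat n U \<Longrightarrow> unitary n (fm U)"
  using unitary_mat_iff[of U n] sz_fm by (auto simp: unitary_def unitary_mat_def)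

lemma unitary_mt: "unitary n U \<Longrightarrow> unitary_mat n (mt n U)"
  using unitary_mat_iff[of "mt n U" n] by (auto simp: unitary_def fm_mt)

text \<open>A Householder reflection, after a phase correction of the target vector.\<close>

lemma unitary_with_first_column:
  assumes d: "0 < d" and v: "un d * v = v" "v * un 1 = v" "nrm v = 1"
  shows "\<exists>H c. unitary d H \<and> cmod c = 1 \<and> H * un 1 = smul c v"
proof -
  define a where "a = ent v 0 0"
  \<comment> \<open>A reflection can exchange two unit vectors only if their inner product is real;
    the phase c makes the entry (0, 0) of c v real.\<close>
  obtain c r where c: "cmod c = 1" "c * a = complex_of_real r"
  proof (cases "a = 0")
    case True
    then show ?thesis using that[of 1 0] by simp
  next
    case False
    have "cnj a * a = of_real ((cmod a)\<^sup>2)" by (simp only: complex_norm_square mult.commute)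
    then have "cnj a / of_real (cmod a) * a = complex_of_real (cmod a)"
      using False by (simp add: power2_eq_square)
    then show ?thesis using that[of "cnj a / of_real (cmod a)" "cmod a"] False
      by (simp add: norm_divide)
  qed
  define x where "x = smul c v"
  have un1d: "un d * un 1 = un 1" "un 1 * un d = un 1"
    using d by (auto simp: un_mult_un min_absorb1 min_absorb2)
  have x: "un d * x = x" "x * un 1 = x" "nrm x = 1"
    using v c by (simp_all add: x_def)
  have x00: "tr (un 1 * x) = of_real r" using c
    by (simp add: x_def a_def un_1 tr_E_mult)
  have adjx: "un 1 * adj x = adj x" "adj x * un d = adj x"
    using x by (metis adj_mult adj_simps(3))+
  define w where "w = un 1 - x"
  have w: "un d * w = w" "adj w * un d = adj w" "un 1 * adj w = adj w" "w * un 1 = w"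
    using x adjx un1d by (simp_all add: w_def algebra_simps)
  have nw: "nrm w = 2 * (1 - r)"
    unfolding w_def nrm_diff using x00 x by (simp add: nrm_def tr_un)
  have ww: "adj w * w = smul (nrm w) (un 1)"
  proof -
    have "adj w * w = smul (tr (adj w * w)) (un 1)"
      by (rule one_by_one) (use w in \<open>simp_all add: mult.assoc[symmetric]\<close>, simp add: mult.assoc)
    moreover have "tr (adj w * w) = of_real (nrm w)"
    proof -
      have "cnj (tr (adj w * w)) = tr (adj w * w)" by (simp flip: tr_linear(6))
      then show ?thesis by (simp add: nrm_def complex_eq_iff)
    qed
    ultimately show ?thesis by simp
  qed
  have we: "adj w * un 1 = smul (1 - r) (un 1)"
  proof -
    have "adj x * un 1 = smul (tr (adj x * un 1)) (un 1)"
      by (rule one_by_one) (use adjx in \<open>simp_all add: mult.assoc[symmetric]\<close>, simp add: mult.assoc)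
    moreover have "tr (adj x * un 1) = of_real r"
      using x00 tr_linear(6)[of "un 1 * x"] by simp
    ultimately show ?thesis by (simp add: w_def left_diff_distrib smul_distribs)
  qed
  show ?thesis
  proof (cases "w = 0")
    case True
    have "unitary d (un d)" by (simp add: unitary_def)
    moreover have "un d * un 1 = smul c v" using True un1d by (simp add: w_def x_def)
    ultimately show ?thesis using c by blast
  next
    case False
    then have nz: "nrm w \<noteq> 0" by simp
    define t where "t = complex_of_real (2 / nrm w)"
    define H where "H = un d - smul t (w * adj w)"
    have sw: "sz (w * adj w) d"
      using w by (simp add: sz_iff mult.assoc[symmetric]) (simp add: mult.assoc w)
    have adjH: "adj H = H" by (simp add: H_def t_def)
    have "w * adj w * (w * adj w) = smul (nrm w) (w * adj w)"
      using ww w by (metis (no_types) mult.assoc smul_mult_left smul_mult_right)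
    moreover have "smul (2 * t - t * t * nrm w) (w * adj w)
        = smul t (w * adj w) + smul t (w * adj w) - smul (t * t * nrm w) (w * adj w)"
      by (rule fmat_eqI) (simp add: algebra_simps)
    ultimately have "H * H = un d - smul (2 * t - t * t * nrm w) (w * adj w)"
      using sw un_mult_sz[OF sw] mult_un_sz[OF sw]
      by (simp add: H_def left_diff_distrib right_diff_distrib mult.assoc smul_distribs)
    moreover have "2 * t - t * t * nrm w = 0"
      using nz by (simp add: t_def)
    ultimately have HH: "H * H = un d" by simp
    have "sz H d" using sw by (simp add: H_def sz_diff sz_smul)
    then have "unitary d H" using HH adjH by (simp add: unitary_def)
    moreover have "H * un 1 = smul c v"
    proof -
      have "t * (1 - r) = of_real (2 / nrm w * (1 - r))" by (simp add: t_def)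
      also have "2 / nrm w * (1 - r) = 1" using nz by (simp add: nw)
      finally have "t * (1 - r) = 1" by simp
      have "H * un 1 = un 1 - smul (t * (1 - r)) (w * un 1)"
        using we un1d by (simp add: H_def left_diff_distrib mult.assoc)
      also have "\<dots> = x" using \<open>t * (1 - r) = 1\<close> w by (simp add: w_def)
      finally show ?thesis by (simp add: x_def)
    qed
    ultimately show ?thesis using c by blast
  qed
qed

definition eig :: "nat \<Rightarrow> fmat \<Rightarrow> complex \<Rightarrow> bool" where
  "eig d M c \<longleftrightarrow> (\<exists>v. v \<noteq> 0 \<and> un d * v = v \<and> v * un 1 = v \<and> M * v = smul c v)"

lemma eig_ex:
  assumes "0 < d" "sz M d" shows "\<exists>c. eig d M c"
proof -
  have "spectrum (mt d M) \<noteq> {}" using assms by (intro spectrum_non_empty[of _ d]) auto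
  then obtain c v where v: "v \<in> carrier_vec d" "v \<noteq> 0\<^sub>v d" "mt d M *\<^sub>v v = c \<cdot>\<^sub>v v"
    by (auto simp: spectrum_def eigenvalue_def eigenvector_def)
  define u where "u = fm (mat d 1 (\<lambda>(i, j). v $ i))"
  have "u \<noteq> 0"
  proof
    assume "u = 0"
    then have "ent u i 0 = 0" for i by simp
    then have "v $ i = 0" if "i < d" for i
      using that \<open>ent u i 0 = 0\<close> by (simp add: u_def)
    then show False using v(1,2) by (auto intro: eq_vecI)
  qed
  moreover have "un d * u = u" "u * un 1 = u"
    by (rule fmat_eqI; auto simp: u_def ent_un_mult ent_mult_un)+
  moreover have "M * u = smul c u"
  proof (rule fmat_eqI)
    fix i j
    have "(mt d M *\<^sub>v v) $ i = c * v $ i" if "i < d" using v that by simp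
    then show "ent (M * u) i j = ent (smul c u) i j"
      using v(1) assms(2)
      by (cases "i < d") (auto simp: ent_times_sz[of M d] u_def scalar_prod_def mt_def sz_def
        atLeast0LessThan)
  qed
  ultimately show ?thesis unfolding eig_def by blast
qed


text \<open>The shift \<open>K\<close> identifies the orthogonal complement of an eigenvector, moved to the first
  unit vector, with a space of smaller dimension.\<close>

lemma normal_diagonalization:
  fixes key :: "complex \<Rightarrow> nat"
  assumes "sz M d" "adj M * M = M * adj M"
  shows "\<exists>Q l. unitary d Q \<and> adj Q * M * Q = dg d l \<and> (\<forall>i<d. eig d M (l i)) \<and>
    (\<forall>i k. i \<le> k \<longrightarrow> k < d \<longrightarrow> key (l i) \<le> key (l k))"
  using assms
proof (induction d arbitrary: M)
  case 0
  then have "M = 0" by (intro fmat_eqI) (simp add: sz_def)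
  then show ?case
    by (intro exI[of _ 0] exI[of _ undefined]) (auto simp: unitary_def intro!: fmat_eqI)
next
  case (Suc d)
  define D where "D = Suc d"
  have M: "sz M D" "adj M * M = M * adj M" "0 < D" using Suc.prems by (simp_all add: D_def)
  \<comment> \<open>An eigenvalue of least key is split off first. Every eigenvalue of the remaining
    block \<open>M2\<close> is one of M (fact \<open>eigl\<close>), so its key is at least that of c
    and the diagonal comes out sorted.\<close>
  obtain c where c: "eig D M c" "\<And>c'. eig D M c' \<Longrightarrow> key c \<le> key c'"
    using ex_has_least_nat[of "eig D M" _ key] eig_ex[OF M(3,1)] by metis
  from c(1) obtain v where v: "v \<noteq> 0" "un D * v = v" "v * un 1 = v" "M * v = smul c v"
    unfolding eig_def by (elim exE conjE)
  define v1 where "v1 = smul (1 / sqrt (nrm v)) v"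
  have "nrm v1 = 1" using nrm_pos[OF v(1)] v(1)
    by (simp add: v1_def norm_divide power_divide)
  then obtain H b where H: "unitary D H" "cmod b = 1" "H * un 1 = smul b v1"
    using unitary_with_first_column[of D v1] M(3) v by (auto simp: v1_def)
  note HD = unitaryD[OF H(1)]
  define e where "e = un 1"
  have e: "e * e = e" "adj e = e" "un D * e = e" "e * un D = e" "e * (e * X) = e * X" for X
    using M(3) by (simp_all add: e_def un_mult_un min_absorb1 min_absorb2)
  define M' where "M' = adj H * M * H"
  have szM': "sz M' D" by (simp add: M'_def sz_mult sz_adj M HD)
  have nM': "adj M' * M' = M' * adj M'"
  proof -
    have "adj M' * M' = adj H * (adj M * M) * H"
      by (simp add: M'_def mult.assoc HD un_mult_sz[OF M(1)])
        (metis mult.assoc un_mult_sz[OF M(1)])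
    also have "\<dots> = M' * adj M'"
      unfolding M(2) by (simp add: M'_def mult.assoc HD)
        (metis mult.assoc un_mult_sz[OF sz_adj[OF M(1)]])
    finally show ?thesis .
  qed
  \<comment> \<open>After subtracting c the first unit vector lies in the kernel of N. Normality
    gives N e and adj N e the same norm, so the first row vanishes together with the first
    column.\<close>
  define N where "N = M' - smul c (un D)"
  have szN: "sz N D" using szM' by (simp add: N_def sz_diff sz_smul)
  have nN: "adj N * N = N * adj N"
    using nM' szM' un_mult_sz[OF szM'] mult_un_sz[OF szM'] un_mult_sz[OF sz_adj, OF szM']
      mult_un_sz[OF sz_adj, OF szM']
    by (simp add: N_def algebra_simps smul_distribs)
  have He: "H * e = smul (b / sqrt (nrm v)) v" using H(3) by (simp add: e_def v1_def)
  have "M * (H * e) = smul c (H * e)" unfolding He using v(4) by (simp add: mult.commute)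
  then have "M' * e = smul c e" by (simp add: M'_def mult.assoc HD e)
  then have Ne: "N * e = 0" by (simp add: N_def left_diff_distrib e)
  have "nrm (adj N * e) = nrm (N * e)"
    using nN unfolding nrm_def by simp (metis mult.assoc)
  then have "adj N * e = 0" using Ne by simp
  then have eN: "e * N = 0" using adj_mult[of e N] e(2) by (metis adj_simps(1,2) adj_mult)
  define K where "K = Fmat (\<lambda>i j. if i = Suc j \<and> j < d then 1 else 0)"
  have entK: "ent K i j = (if i = Suc j \<and> j < d then 1 else 0)" for i j
    unfolding K_def by (subst ent_Fmat[of D]) (auto simp: D_def)
  have szK: "sz K D" by (auto simp: sz_def entK D_def)
  have entK'X: "ent (adj K * X) i j = (if i < d then ent X (Suc i) j else 0)" for X i j
  proof -
    have "ent (adj K * X) i j = (\<Sum>k<D. if k = Suc i then (if i < d then ent X (Suc i) j else 0) else 0)"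
      unfolding ent_times_sz[OF disjI1[OF sz_adj[OF szK]]]
      by (rule sum.cong) (auto simp: entK D_def)
    then show ?thesis by (auto simp: D_def)
  qed
  have KK: "adj K * K = un d"
    by (rule fmat_eqI) (auto simp: entK'X entK)
  have entKX: "ent (K * X) i j = (if 0 < i \<and> i < D then ent X (i - 1) j else 0)" for X i j
  proof -
    have "ent (K * X) i j = (\<Sum>k<D. if k = i - 1 then (if 0 < i \<and> i < D then ent X k j else 0) else 0)"
      unfolding ent_times_sz[OF disjI1[OF szK]]
      by (rule sum.cong) (auto simp: entK D_def)
    then show ?thesis by (auto simp: D_def)
  qed
  have KK': "K * adj K = un D - e"
    by (rule fmat_eqI) (auto simp: entKX entK D_def e_def)
  have eK: "e * K = 0" by (rule fmat_eqI) (simp add: e_def ent_un_mult entK)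
  have K'e: "adj K * e = 0" using eK e(2) by (metis adj_simps(2) adj_mult)
  have Kun: "K * un d = K" by (rule fmat_eqI) (auto simp: ent_mult_un entK)
  have unK: "un d * adj K = adj K" "un D * K = K" "adj K * un D = adj K"
    using Kun un_mult_sz[OF szK] mult_un_sz[OF sz_adj[OF szK]] by (metis adj_mult adj_simps(3), auto)
  define M2 where "M2 = adj K * M' * K"
  define N2 where "N2 = adj K * N * K"
  have szN2: "sz N2 d" using Kun unK
    by (simp add: sz_iff N2_def mult.assoc) (simp add: mult.assoc[symmetric])
  have M2N2: "M2 = N2 + smul c (un d)"
    by (simp add: M2_def N2_def N_def algebra_simps KK unK)
  have szM2: "sz M2 d" using szN2 by (simp add: M2N2 sz_add sz_smul)
  have NKK: "N * K * adj K = N" "K * adj K * N = N"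
    using Ne eN un_mult_sz[OF szN] mult_un_sz[OF szN]
    by (simp_all add: KK' left_diff_distrib) (simp add: mult.assoc KK' right_diff_distrib)
  have nN2: "adj N2 * N2 = N2 * adj N2"
  proof -
    have "adj N2 * N2 = adj K * adj N * (K * adj K * N) * K" by (simp add: N2_def mult.assoc)
    also have "\<dots> = adj K * (adj N * N) * K" by (simp only: NKK) (simp only: mult.assoc)
    also have "\<dots> = adj K * (N * adj N) * K" by (simp only: nN)
    also have "\<dots> = adj K * (N * K * adj K) * adj N * K" by (simp only: NKK) (simp only: mult.assoc)
    finally show ?thesis by (simp add: N2_def mult.assoc)
  qed
  have nM2: "adj M2 * M2 = M2 * adj M2"
    using nN2 szN2 un_mult_sz[OF szN2] mult_un_sz[OF szN2] un_mult_sz[OF sz_adj, OF szN2]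
      mult_un_sz[OF sz_adj, OF szN2]
    by (simp add: M2N2 algebra_simps smul_distribs)
  from Suc.IH[OF szM2 nM2] obtain Q l where Q: "unitary d Q" "adj Q * M2 * Q = dg d l"
    "\<forall>i<d. eig d M2 (l i)" "\<forall>i k. i \<le> k \<longrightarrow> k < d \<longrightarrow> key (l i) \<le> key (l k)"
    by (elim exE conjE)
  note QD = unitaryD[OF Q(1)]
  \<comment> \<open>The direct sum of 1 and Q: the identity on the eigenvector, and Q carried by K
    to its complement.\<close>
  define R where "R = e + K * Q * adj K"
  have eKX: "e * (K * X) = 0" "adj K * (e * X) = 0" for X
    using eK K'e by (simp_all add: mult.assoc[symmetric])
  have KKX: "adj K * (K * X) = un d * X" for X using KK by (simp add: mult.assoc[symmetric])
  have unX: "un d * (adj K * X) = adj K * X" "un D * (K * X) = K * X" "un d * (Q * X) = Q * X"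
    "un d * (adj Q * X) = adj Q * X" for X
    using unK QD by (simp_all add: mult.assoc[symmetric])
  have "sz R D" using szK QD(1)
    by (simp add: R_def sz_iff algebra_simps e unX) (simp add: unK)
  have RR: "adj R * R = un D" "R * adj R = un D"
    using KK' by (simp_all add: R_def algebra_simps e eK K'e eKX KKX unX QD unK)
  have uR: "unitary D R" using \<open>sz R D\<close> RR by (simp add: unitary_def)
  have Rdg: "adj R * M' * R = dg D (case_nat c l)"
  proof -
    have M'e: "M' = N + smul c (un D)" by (simp add: N_def)
    have eNX: "e * (N * X) = 0" "N * (e * X) = 0" for X
      using Ne eN by (simp_all add: mult.assoc[symmetric])
    have "adj R * N * R = K * (adj Q * N2 * Q) * adj K"
      by (simp add: R_def N2_def algebra_simps eNX Ne eN e)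
    also have "adj Q * N2 * Q = dg d l - smul c (un d)"
      using Q(2) by (simp add: M2N2 algebra_simps QD)
    finally have "adj R * N * R = K * dg d l * adj K - smul c (un D - e)"
      by (simp add: algebra_simps unX unK KK' smul_distribs)
    then have "adj R * M' * R = smul c e + K * dg d l * adj K"
      using RR \<open>sz R D\<close> by (simp add: M'e algebra_simps smul_distribs un_mult_sz)
    also have "\<dots> = dg D (case_nat c l)"
    proof (rule fmat_eqI)
      fix i j
      show "ent (smul c e + K * dg d l * adj K) i j = ent (dg D (case_nat c l)) i j"
        by (simp only: mult.assoc ent_plus entKX ent_dg_mult ent_adj entK ent_smul)
          (auto simp: e_def D_def split: nat.splits)
    qed
    finally show ?thesis .
  qed
  have "unitary D (H * R)" using unitary_mult[OF H(1) uR] .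
  moreover have "adj (H * R) * M * (H * R) = dg D (case_nat c l)"
    using Rdg by (simp add: M'_def mult.assoc)
  moreover have eigl: "eig D M (l i)" if "i < d" for i
  proof -
    from Q(3)[rule_format, OF that]
    obtain u where u: "u \<noteq> 0" "un d * u = u" "u * un 1 = u" "M2 * u = smul (l i) u"
      unfolding eig_def by (elim exE conjE)
    define w where "w = H * (K * u)"
    have "adj K * (adj H * w) = u" by (simp add: w_def HD unX KKX u mult.assoc[symmetric])
      (simp add: mult.assoc KKX unX u)
    then have "w \<noteq> 0" using u(1) by auto
    moreover have "un D * w = w" "w * un 1 = w"
      using u by (simp_all add: w_def mult.assoc[symmetric] HD) (simp add: mult.assoc)
    moreover have "M * w = smul (l i) w"
    proof -
      have "N * (K * u) = K * adj K * N * (K * u)" by (simp add: NKK)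
      also have "\<dots> = K * (N2 * u)" by (simp add: N2_def mult.assoc)
      also have "N2 * u = smul (l i - c) u"
        using u(4) by (simp add: M2N2 distrib_right u(2) smul_distribs)
          (metis add_diff_cancel_right')
      finally have nk: "N * (K * u) = smul (l i - c) (K * u)" by simp
      have "M' * (K * u) = N * (K * u) + smul c (K * u)"
        by (simp add: N_def left_diff_distrib unX)
      then have "M' * (K * u) = smul (l i) (K * u)"
        unfolding nk by (simp flip: smul_distribs(3))
      then have "H * (M' * (K * u)) = smul (l i) w" by (simp add: w_def)
      moreover have "H * (M' * (K * u)) = M * w"
        using un_mult_sz[OF M(1)] by (simp add: M'_def w_def mult.assoc HD)
          (metis mult.assoc)
      ultimately show ?thesis by simp
    qed
    ultimately show ?thesis unfolding eig_def by (intro exI[of _ w] conjI)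
  qed
  moreover have "eig D M (case_nat c l i)" if "i < D" for i
    using that c(1) eigl by (cases i) (auto simp: D_def)
  moreover have "key (case_nat c l i) \<le> key (case_nat c l k)" if "i \<le> k" "k < D" for i k
    using that c(2) eigl Q(4) by (cases i; cases k) (auto simp: D_def)
  ultimately show ?case unfolding D_def[symmetric]
    by (intro exI[of _ "H * R"] exI[of _ "case_nat c l"]) simp
qed

lemma unitary_conj_inverse:
  assumes "unitary d Q" "sz M d" "adj Q * M * Q = N"
  shows "M = Q * N * adj Q"
  using assms(3) un_mult_sz[OF assms(2)] mult_un_sz[OF assms(2)] unitaryD[OF assms(1)]
  by (auto simp: mult.assoc)

text \<open>Besides the real diagonal, each r i is exposed as the value of the form of S at a unit
  vector, namely column i of Q. A lower bound on the form thus becomes a lower bound on every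
  eigenvalue.\<close>

lemma hermitian_diagonalization:
  assumes "sz S d" "adj S = S"
  obtains Q r where "unitary d Q" "S = Q * dg d (\<lambda>i. complex_of_real (r i)) * adj Q"
    "\<And>i. i < d \<Longrightarrow> r i = Re (tr (adj (Q * E i 0) * S * (Q * E i 0)))"
    "\<And>i. i < d \<Longrightarrow> nrm (Q * E i 0) = 1 \<and> un d * (Q * E i 0) = Q * E i 0"
proof -
  obtain Q l where Q: "unitary d Q" "adj Q * S * Q = dg d l"
    using normal_diagonalization[OF assms(1), of "\<lambda>_. 0"] assms(2) by auto
  note QD = unitaryD[OF Q(1)]
  define r where "r i = Re (l i)" for i
  have "adj (dg d l) = dg d l" unfolding Q(2)[symmetric] by (simp add: assms(2) mult.assoc)
  have "cnj (l i) = l i" if "i < d" for i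
    using arg_cong[OF \<open>adj (dg d l) = dg d l\<close>, of "\<lambda>M. ent M i i"] that by simp
  then have l: "dg d l = dg d (\<lambda>i. complex_of_real (r i))"
    by (intro fmat_eqI) (auto simp: r_def complex_eq_iff)
  have "r i = Re (tr (adj (Q * E i 0) * S * (Q * E i 0)))" if "i < d" for i
  proof -
    have "adj (Q * E i 0) * S * (Q * E i 0) = E 0 i * (adj Q * S * Q) * E i 0"
      by (simp add: mult.assoc)
    also have "tr \<dots> = l i" unfolding Q(2)
      using that by (subst tr_commute) (simp add: mult.assoc[symmetric] E_mult tr_E_mult)
    finally show ?thesis by (simp add: r_def)
  qed
  moreover have "nrm (Q * E i 0) = 1 \<and> un d * (Q * E i 0) = Q * E i 0" if "i < d" for i
  proof
    have "adj (Q * E i 0) * (Q * E i 0) = E 0 i * un d * E i 0"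
      by (simp add: mult.assoc QD)
    also have "\<dots> = E 0 0"
      by (rule fmat_eqI) (use that in \<open>auto simp: ent_mult_E ent_mult_un\<close>)
    finally show "nrm (Q * E i 0) = 1" by (simp add: nrm_def tr_E)
    show "un d * (Q * E i 0) = Q * E i 0" by (simp add: mult.assoc[symmetric] QD)
  qed
  moreover have "S = Q * dg d (\<lambda>i. complex_of_real (r i)) * adj Q"
    using unitary_conj_inverse[OF Q(1) assms(1) Q(2)] by (simp add: l)
  ultimately show ?thesis using that Q(1) by blast
qed

lemma pos_factorization:
  assumes "sz S d" "adj S = S" "\<And>V. 0 \<le> Re (tr (adj V * S * V))"
  obtains K where "sz K d" "S = adj K * K"
proof -
  obtain Q r where Q: "unitary d Q" "S = Q * dg d (\<lambda>i. complex_of_real (r i)) * adj Q"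
    "\<And>i. i < d \<Longrightarrow> r i = Re (tr (adj (Q * E i 0) * S * (Q * E i 0)))"
    using hermitian_diagonalization[OF assms(1,2)] by metis
  have r: "i < d \<Longrightarrow> 0 \<le> r i" for i by (subst Q(3)) (auto intro: assms(3) simp del: adj_mult)
  define K where "K = dg d (\<lambda>i. complex_of_real (sqrt (r i))) * adj Q"
  have "dg d (\<lambda>i. complex_of_real (sqrt (r i))) * dg d (\<lambda>i. complex_of_real (sqrt (r i)))
      = dg d (\<lambda>i. complex_of_real (r i))"
    unfolding dg_mult by (rule fmat_eqI) (auto simp: r simp flip: of_real_mult)
  moreover have "adj K * K = Q * (dg d (\<lambda>i. complex_of_real (sqrt (r i))) *
      dg d (\<lambda>i. complex_of_real (sqrt (r i)))) * adj Q"
    by (simp add: K_def mult.assoc)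
  ultimately have "S = adj K * K" by (simp add: Q(2))
  moreover have "sz K d" using unitaryD(1)[OF Q(1)] by (simp add: K_def sz_mult sz_adj)
  ultimately show ?thesis using that by blast
qed

text \<open>The bound e keeps the square root invertible, and L is its inverse within size d. This
  change of variables is what makes a strictly positive functional unital.\<close>

lemma posdef_factorization:
  assumes "sz S d" "adj S = S" "0 < e"
    "\<And>V. un d * V = V \<Longrightarrow> e * nrm V \<le> Re (tr (adj V * S * V))"
  obtains K L where "sz K d" "sz L d" "S = K * adj K" "K * L = un d" "L * K = un d"
proof -
  obtain Q r where Q: "unitary d Q" "S = Q * dg d (\<lambda>i. complex_of_real (r i)) * adj Q"
    "\<And>i. i < d \<Longrightarrow> r i = Re (tr (adj (Q * E i 0) * S * (Q * E i 0)))"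
    "\<And>i. i < d \<Longrightarrow> nrm (Q * E i 0) = 1 \<and> un d * (Q * E i 0) = Q * E i 0"
    using hermitian_diagonalization[OF assms(1,2)] by metis
  note QD = unitaryD[OF Q(1)]
  have r: "0 < r i" if "i < d" for i
    using Q(3)[OF that] assms(4)[of "Q * E i 0"] Q(4)[OF that] assms(3) by simp
  define k where "k = dg d (\<lambda>i. complex_of_real (sqrt (r i)))"
  define l where "l = dg d (\<lambda>i. complex_of_real (1 / sqrt (r i)))"
  have kk: "k * adj k = dg d (\<lambda>i. complex_of_real (r i))" "k * l = un d" "l * k = un d"
    unfolding k_def l_def adj_dg dg_mult
    by (rule fmat_eqI; use r in \<open>force simp flip: of_real_mult\<close>)+
  have "Q * k * adj (Q * k) = S" using kk(1) by (simp add: Q(2) mult.assoc flip: kk(1))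
  moreover have "Q * k * (l * adj Q) = un d"
    using arg_cong[OF kk(2), of "\<lambda>x. Q * x * adj Q"] by (simp add: mult.assoc QD)
  moreover have "l * adj Q * (Q * k) = un d"
    using kk(3) by (simp add: mult.assoc QD k_def un_mult_sz)
  ultimately show ?thesis
    using that[of "Q * k" "l * adj Q"] QD(1) by (simp add: k_def l_def sz_mult sz_adj)
qed

text \<open>P is the eigenprojection for one nonzero eigenvalue. It commutes with the commutant of S
  because, in an eigenbasis of S, a commuting matrix has no entries between different
  eigenvalues.\<close>

lemma spectral_projection:
  assumes "sz S d" "adj S = S" "S \<noteq> 0"
  obtains r P where "r \<noteq> 0" "sz P d" "proj P" "P \<noteq> 0" "S * P = smul (complex_of_real r) P"
    "\<And>M. sz M d \<Longrightarrow> M * S = S * M \<Longrightarrow> M * P = P * M"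
proof -
  obtain Q r where Q: "unitary d Q" "S = Q * dg d (\<lambda>i. complex_of_real (r i)) * adj Q"
    using hermitian_diagonalization[OF assms(1,2)] by metis
  note QD = unitaryD[OF Q(1)]
  obtain k where k: "k < d" "r k \<noteq> 0"
  proof (rule ccontr)
    assume "\<not> thesis"
    with that have "dg d (\<lambda>i. complex_of_real (r i)) = 0" by (intro fmat_eqI) auto
    then show False using assms(3) Q(2) by simp
  qed
  define f where "f = dg d (\<lambda>i. if r i = r k then 1 else 0)"
  define P where "P = Q * f * adj Q"
  have f: "adj f = f" "f * f = f" "un d * f = f"
    unfolding f_def adj_dg dg_mult by (rule fmat_eqI; simp add: ent_un_mult)+
  have ff: "f * (f * X) = f * X" "un d * (f * X) = f * X" for X
    by (simp_all add: mult.assoc[symmetric] f)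
  have "sz P d" using QD(1) by (simp add: P_def f_def sz_mult sz_adj)
  moreover have "proj P" by (simp add: proj_def P_def mult.assoc QD f ff)
  moreover have "P \<noteq> 0"
  proof
    assume "P = 0"
    then have "adj Q * P * Q = 0" by simp
    then have "f = 0" by (simp add: P_def mult.assoc QD f) (simp add: f_def un_mult_sz mult_un_sz)
    then have "ent f k k = 0" by simp
    then show False using k by (simp add: f_def)
  qed
  moreover have "S * P = smul (complex_of_real (r k)) P"
  proof -
    have "dg d (\<lambda>i. complex_of_real (r i)) * f = smul (complex_of_real (r k)) f"
      unfolding f_def by (rule fmat_eqI) (auto simp: ent_dg_mult)
    then show ?thesis using f(3)
      by (simp add: P_def Q(2) mult.assoc QD) (simp add: mult.assoc[symmetric] f_def un_mult_sz)
  qed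
  moreover have "M * P = P * M" if M: "sz M d" "M * S = S * M" for M
  proof -
    define m where "m = adj Q * M * Q"
    have szm: "sz m d" using M(1) QD(1) by (simp add: m_def sz_mult sz_adj)
    have Mm: "M = Q * m * adj Q"
      by (rule unitary_conj_inverse[OF Q(1) M(1)]) (simp add: m_def)
    define R where "R = dg d (\<lambda>i. complex_of_real (r i))"
    have szR: "sz R d" by (simp add: R_def)
    have S: "S = Q * R * adj Q" by (simp add: Q(2) R_def)
    have "Q * (m * R) * adj Q = Q * (R * m) * adj Q"
      using M(2) un_mult_sz[OF szm] un_mult_sz[OF szR]
      by (simp add: Mm S mult.assoc QD) (metis mult.assoc)
    then have "adj Q * (Q * (m * R) * adj Q) * Q = adj Q * (Q * (R * m) * adj Q) * Q" by simp
    then have "m * R = R * m" using szm szR mult_un_sz[OF szm] mult_un_sz[OF szR]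
      un_mult_sz[OF szm] un_mult_sz[OF szR]
      by (simp add: mult.assoc QD) (metis mult.assoc)
    then have e: "ent m i j * r j = r i * ent m i j" if "i < d" "j < d" for i j
      using arg_cong[of _ _ "\<lambda>M. ent M i j"] that unfolding R_def
      by (metis (no_types, lifting) ent_dg_mult ent_mult_dg)
    have "m * f = f * m"
    proof (rule fmat_eqI)
      fix i j
      show "ent (m * f) i j = ent (f * m) i j"
        using e[of i j] szm by (auto simp: f_def ent_dg_mult ent_mult_dg sz_def not_less)
    qed
    then show ?thesis
      using un_mult_sz[OF szm] f(3) by (simp add: Mm P_def mult.assoc QD) (metis mult.assoc)
  qed
  ultimately show ?thesis using that[of "r k" P] k(2) by blast
qed

text \<open>Cholesky elimination by induction on S: the pivot x0 yields one rank-one term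
  \<open>w0\<close>, and the Schur complement \<open>G'\<close> on the remaining indices is again
  positive. A zero pivot forces its whole row to vanish, and then \<open>w0\<close> = 0.\<close>

lemma psd_rank_one:
  fixes G :: "'a \<Rightarrow> 'a \<Rightarrow> complex"
  assumes "finite S" "\<And>x y. x \<in> S \<Longrightarrow> y \<in> S \<Longrightarrow> G y x = cnj (G x y)"
    "\<And>w. 0 \<le> Re (\<Sum>x\<in>S. \<Sum>y\<in>S. cnj (w x) * G x y * w y)"
  shows "\<exists>N w. \<forall>x\<in>S. \<forall>y\<in>S. G x y = (\<Sum>k<(N::nat). w k x * cnj (w k y))"
  using assms
proof (induction S arbitrary: G rule: finite_induct)
  case (insert x0 S)
  define g where "g = Re (G x0 x0)"
  have herm: "G y x = cnj (G x y)" if "x \<in> insert x0 S" "y \<in> insert x0 S" for x y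
    using insert.prems(1) that by blast
  have Gx0: "G x0 x0 = of_real g"
    using herm[of x0 x0] by (simp add: g_def complex_eq_iff)
  have split: "(\<Sum>x\<in>insert x0 S. \<Sum>y\<in>insert x0 S. cnj (w x) * G x y * w y)
     = cnj (w x0) * of_real g * w x0 + cnj (w x0) * (\<Sum>y\<in>S. G x0 y * w y)
      + cnj (\<Sum>y\<in>S. G x0 y * w y) * w x0 + (\<Sum>x\<in>S. \<Sum>y\<in>S. cnj (w x) * G x y * w y)" for w
  proof -
    have "(\<Sum>x\<in>S. cnj (w x) * G x x0 * w x0) = cnj (\<Sum>y\<in>S. G x0 y * w y) * w x0"
      unfolding cnj_sum sum_distrib_right by (rule sum.cong) (auto simp: herm[of x0])
    then show ?thesis using insert.hyps
      by (simp add: sum.distrib Gx0 sum_distrib_left mult.assoc)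
  qed
  have pos: "0 \<le> Re (cnj a * of_real g * a + cnj a * (\<Sum>y\<in>S. G x0 y * w y)
      + cnj (\<Sum>y\<in>S. G x0 y * w y) * a + (\<Sum>x\<in>S. \<Sum>y\<in>S. cnj (w x) * G x y * w y))" for a w
  proof -
    have "(\<Sum>y\<in>S. G x0 y * (if y = x0 then a else w y)) = (\<Sum>y\<in>S. G x0 y * w y)"
      using insert.hyps by (intro sum.cong) auto
    moreover have "(\<Sum>x\<in>S. \<Sum>y\<in>S. cnj (if x = x0 then a else w x) * G x y * (if y = x0 then a else w y))
       = (\<Sum>x\<in>S. \<Sum>y\<in>S. cnj (w x) * G x y * w y)"
      using insert.hyps by (intro sum.cong) auto
    ultimately show ?thesis
      using insert.prems(2)[of "\<lambda>x. if x = x0 then a else w x"] unfolding split by simp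
  qed
  have g0: "0 \<le> g" using pos[of 1 "\<lambda>_. 0"] by simp
  define w0 where "w0 y = (if g = 0 then 0 else cnj (G x0 y) / sqrt g)" for y
  have zero: "G x0 y = 0" if y: "y \<in> S" "g = 0" for y
  proof (rule ccontr)
    assume nz: "G x0 y \<noteq> 0"
    \<comment> \<open>The test vector has entry - t * G x0 y at x0 and 1 at y. With a zero pivot its
      form is Re (G y y) - 2 t |G x0 y|^2, and t is chosen to make this equal to -1.\<close>
    define t where "t = (Re (G y y) + 1) / (2 * (cmod (G x0 y))\<^sup>2)"
    have d: "(\<Sum>z\<in>S. f z * (if z = y then 1 else 0)) = f y" for f :: "'a \<Rightarrow> complex"
      using y insert.hyps by (simp add: if_distrib cong: if_cong)
    have "(\<Sum>x\<in>S. \<Sum>z\<in>S. cnj (if x = y then 1 else 0) * G x z * (if z = y then 1 else 0)) = G y y"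
    proof -
      have "(\<Sum>x\<in>S. cnj (if x = y then 1 else 0) * G x y) = (\<Sum>x\<in>S. G x y * (if x = y then 1 else 0))"
        by (rule sum.cong) auto
      then show ?thesis unfolding d by (simp only: d)
    qed
    then have "0 \<le> Re (- of_real t * cnj (G x0 y) * G x0 y + cnj (G x0 y) * (- of_real t * G x0 y) + G y y)"
      using pos[of "- of_real t * G x0 y" "\<lambda>z. if z = y then 1 else 0"] y(2) unfolding d by simp
    also have "\<dots> = - 2 * t * (cmod (G x0 y))\<^sup>2 + Re (G y y)"
      by (simp add: cmod_power2) (simp add: power2_eq_square algebra_simps)
    also have "\<dots> = - 1" using nz by (simp add: t_def field_simps)
    finally show False by simp
  qed
  have w0: "w0 x * cnj (w0 y) = (if g = 0 then 0 else cnj (G x0 x) * G x0 y / g)" for x y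
  proof -
    have "complex_of_real (sqrt g) * complex_of_real (sqrt g) = g"
      using g0 by (simp flip: of_real_mult)
    then show ?thesis by (simp add: w0_def)
  qed
  have w0x0: "w0 x0 * cnj (w0 y) = G x0 y" if "y \<in> insert x0 S" for y
    using that zero[of y] by (cases "y = x0") (auto simp: w0 Gx0)
  define G' where "G' x y = G x y - w0 x * cnj (w0 y)" for x y
  have "\<exists>N w. \<forall>x\<in>S. \<forall>y\<in>S. G' x y = (\<Sum>k<(N::nat). w k x * cnj (w k y))"
  proof (rule insert.IH)
    show "G' y x = cnj (G' x y)" if "x \<in> S" "y \<in> S" for x y
      using herm[of x y] that by (simp add: G'_def mult.commute)
    fix w :: "'a \<Rightarrow> complex"
    define b where "b = (\<Sum>y\<in>S. G x0 y * w y)"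
    \<comment> \<open>The minimiser of the form over the entry at x0; completing the square leaves
      exactly the Schur complement. For g = 0 division by zero gives a = 0.\<close>
    define a where "a = - b / g"
    have "(\<Sum>x\<in>S. \<Sum>y\<in>S. cnj (w x) * (w0 x * cnj (w0 y)) * w y)
        = (if g = 0 then 0 else cnj b * b / g)"
    proof (cases "g = 0")
      case False
      then have "(\<Sum>x\<in>S. \<Sum>y\<in>S. cnj (w x) * (w0 x * cnj (w0 y)) * w y)
          = (\<Sum>x\<in>S. \<Sum>y\<in>S. cnj (G x0 x * w x) * (G x0 y * w y) / g)"
        by (simp add: w0 mult_ac)
      then show ?thesis using False
        by (simp add: b_def sum_product cnj_sum sum_divide_distrib)
    qed (simp add: w0)
    moreover have "cnj a * of_real g * a + cnj a * b + cnj b * a = - (if g = 0 then 0 else cnj b * b / g)"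
      by (simp add: a_def)
    ultimately show "0 \<le> Re (\<Sum>x\<in>S. \<Sum>y\<in>S. cnj (w x) * G' x y * w y)"
      using pos[of a w] unfolding b_def[symmetric]
      by (simp add: G'_def algebra_simps sum_subtractf)
  qed
  then obtain N w where w: "\<And>x y. x \<in> S \<Longrightarrow> y \<in> S \<Longrightarrow> G' x y = (\<Sum>k<(N::nat). w k x * cnj (w k y))"
    by blast
  define u where "u k x = (case k of 0 \<Rightarrow> w0 x | Suc k \<Rightarrow> if x = x0 then 0 else w k x)" for k x
  have "G x y = (\<Sum>k<Suc N. u k x * cnj (u k y))" if xy: "x \<in> insert x0 S" "y \<in> insert x0 S" for x y
  proof -
    have "(\<Sum>k<Suc N. u k x * cnj (u k y)) = w0 x * cnj (w0 y)
        + (if x = x0 \<or> y = x0 then 0 else \<Sum>k<N. w k x * cnj (w k y))"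
      unfolding sum.lessThan_Suc_shift by (auto simp: u_def)
    moreover have "w0 x * cnj (w0 x0) = G x x0"
    proof -
      have "w0 x * cnj (w0 x0) = cnj (w0 x0 * cnj (w0 x))" by simp
      then show ?thesis using w0x0[OF xy(1)] herm[of x0 x] xy(1) by simp
    qed
    moreover have "w0 x * cnj (w0 y) + (\<Sum>k<N. w k x * cnj (w k y)) = G x y" if "x \<in> S" "y \<in> S"
      unfolding w[OF that, symmetric] G'_def by (simp only: add_diff_eq add_diff_cancel_left')
    ultimately show ?thesis using xy w0x0[of y] by auto
  qed
  then show ?case by blast
qed simp

section \<open>Separation from a cone of Gram type\<close>

lemma compact_complex_box: "compact {z. \<bar>Re z\<bar> \<le> R \<and> \<bar>Im z\<bar> \<le> R}"
proof -
  have "{z. \<bar>Re z\<bar> \<le> R \<and> \<bar>Im z\<bar> \<le> R} = (\<lambda>p. Complex (fst p) (snd p)) ` ({-R..R} \<times> {-R..R})"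
  proof (intro subset_antisym subsetI)
    fix z assume "z \<in> {z. \<bar>Re z\<bar> \<le> R \<and> \<bar>Im z\<bar> \<le> R}"
    then show "z \<in> (\<lambda>p. Complex (fst p) (snd p)) ` ({-R..R} \<times> {-R..R})"
      by (intro image_eqI[of _ _ "(Re z, Im z)"]) auto
  qed auto
  moreover have "compact ((\<lambda>p. Complex (fst p) (snd p)) ` ({-R..R} \<times> {-R..R}))"
    unfolding Complex_eq
    by (intro compact_continuous_image compact_Times compact_Icc continuous_intros)
  ultimately show ?thesis by simp
qed

lemma compact_function_box:
  fixes B :: "'a \<Rightarrow> 'b::topological_space set"
  assumes "\<And>p. compact (B p)" shows "compact {f. \<forall>p. f p \<in> B p}"
proof -
  have "compactin (product_topology (\<lambda>_. euclidean) UNIV) (PiE UNIV B)"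
    using assms by (simp add: compactin_PiE)
  then show ?thesis by (simp add: euclidean_product_topology PiE_def Pi_def)
qed

text \<open>The one-sided derivative test at a minimum, with an explicit t instead of a limit; the 1
  added to b keeps the denominator positive.\<close>

lemma first_variation:
  fixes a b :: real
  assumes "0 \<le> b" "\<And>t. 0 < t \<Longrightarrow> t \<le> 1 \<Longrightarrow> 0 \<le> 2 * t * a + t\<^sup>2 * b"
  shows "0 \<le> a"
proof (rule ccontr)
  assume "\<not> 0 \<le> a"
  then have a: "a < 0" by simp
  define t where "t = min 1 (- a / (b + 1))"
  have t: "0 < t" "t \<le> 1" using a assms(1) by (simp_all add: t_def divide_neg_pos)
  have "t \<le> - a / (b + 1)" by (simp add: t_def)
  then have tb: "t * (b + 1) \<le> - a" using assms(1) by (subst (asm) pos_le_divide_eq) auto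
  have "0 \<le> t * (2 * a + t * b)" using assms(2)[OF t(1,2)] by (simp add: power2_eq_square algebra_simps)
  then have "0 \<le> 2 * a + t * b" using t(1) by (simp add: zero_le_mult_iff)
  moreover have "t * b < - a" using t tb by (simp add: algebra_simps)
  ultimately show False using a by simp
qed

text \<open>Kernels are functions on all pairs, forced to vanish off S x S, so that compactness can
  be taken in the product topology over the whole index type.\<close>

definition psd_on :: "'a set \<Rightarrow> ('a \<times> 'a \<Rightarrow> complex) \<Rightarrow> bool" where
  "psd_on S G \<longleftrightarrow> (\<forall>p. p \<notin> S \<times> S \<longrightarrow> G p = 0) \<and> (\<forall>x\<in>S. \<forall>y\<in>S. G (y, x) = cnj (G (x, y))) \<and>
    (\<forall>w. 0 \<le> Re (\<Sum>x\<in>S. \<Sum>y\<in>S. cnj (w x) * G (x, y) * w y))"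

lemma psd_on_rank_one:
  assumes "finite S" "psd_on S G"
  shows "\<exists>N w. \<forall>x\<in>S. \<forall>y\<in>S. G (x, y) = (\<Sum>k<(N::nat). w k x * cnj (w k y))"
proof (rule psd_rank_one[OF assms(1)])
  show "G (y, x) = cnj (G (x, y))" if "x \<in> S" "y \<in> S" for x y
    using assms(2) that unfolding psd_on_def by blast
  show "0 \<le> Re (\<Sum>x\<in>S. \<Sum>y\<in>S. cnj (w x) * G (x, y) * w y)" for w
    using assms(2) unfolding psd_on_def by blast
qed

text \<open>In a Gram representation the product of two coordinates is at most the sum of all
  squares, and these sums add up to the trace. A bound on the trace thus bounds the whole
  kernel.\<close>

lemma psd_on_bound:
  assumes "finite S" "psd_on S G" "x \<in> S" "y \<in> S"
  shows "cmod (G (x, y)) \<le> Re (\<Sum>z\<in>S. G (z, z))"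
proof -
  from psd_on_rank_one[OF assms(1,2)] obtain N w
    where w: "\<forall>x\<in>S. \<forall>y\<in>S. G (x, y) = (\<Sum>k<(N::nat). w k x * cnj (w k y))"
    by (elim exE)
  have "cmod (G (x, y)) \<le> (\<Sum>k<N. cmod (w k x) * cmod (w k y))"
    unfolding w[rule_format, OF assms(3,4)] by (rule order_trans[OF norm_sum]) (simp add: norm_mult)
  also have "\<dots> \<le> (\<Sum>k<N. \<Sum>z\<in>S. (cmod (w k z))\<^sup>2)"
  proof (rule sum_mono)
    fix k
    have le: "(cmod (w k z))\<^sup>2 \<le> (\<Sum>z\<in>S. (cmod (w k z))\<^sup>2)" if "z \<in> S" for z
      using assms(1) that by (intro member_le_sum) auto
    have "2 * (cmod (w k x) * cmod (w k y)) \<le> (cmod (w k x))\<^sup>2 + (cmod (w k y))\<^sup>2"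
      using sum_squares_bound[of "cmod (w k x)" "cmod (w k y)"] by simp
    then show "cmod (w k x) * cmod (w k y) \<le> (\<Sum>z\<in>S. (cmod (w k z))\<^sup>2)"
      using le[OF assms(3)] le[OF assms(4)] by linarith
  qed
  also have "\<dots> = Re (\<Sum>z\<in>S. G (z, z))"
    by (subst sum.swap) (simp add: w complex_mult_cnj cmod_power2)
  finally show ?thesis .
qed

lemma psd_on_rank1I:
  assumes "finite S" shows "psd_on S (\<lambda>(x, y). if x \<in> S \<and> y \<in> S then w x * cnj (w y) else 0)"
proof -
  have sq: "(\<Sum>x\<in>S. \<Sum>y\<in>S. cnj (v x) * (w x * cnj (w y)) * v y)
      = cnj (\<Sum>x\<in>S. cnj (w x) * v x) * (\<Sum>x\<in>S. cnj (w x) * v x)" for v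
    unfolding cnj_sum sum_product by (intro sum.cong refl) simp
  have sq_ge_0: "0 \<le> Re (cnj z * z)" for z :: complex by simp
  have eq: "(\<Sum>x\<in>S. \<Sum>y\<in>S. cnj (v x) * (if x \<in> S \<and> y \<in> S then w x * cnj (w y) else 0) * v y)
      = (\<Sum>x\<in>S. \<Sum>y\<in>S. cnj (v x) * (w x * cnj (w y)) * v y)" for v
    by (intro sum.cong refl) simp
  have pos: "0 \<le> Re (\<Sum>x\<in>S. \<Sum>y\<in>S.
      cnj (v x) * (if x \<in> S \<and> y \<in> S then w x * cnj (w y) else 0) * v y)" for v
    unfolding eq sq by (rule sq_ge_0)
  show ?thesis unfolding psd_on_def
  proof (intro conjI allI ballI impI)
    fix v
    show "0 \<le> Re (\<Sum>x\<in>S. \<Sum>y\<in>S. cnj (v x) *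
        (case (x, y) of (x, y) \<Rightarrow> if x \<in> S \<and> y \<in> S then w x * cnj (w y) else 0) * v y)"
      unfolding prod.case by (rule pos)
  qed (auto split: if_splits)
qed

lemma psd_on_combine:
  assumes "psd_on S G" "psd_on S H" "0 \<le> a" "0 \<le> b"
  shows "psd_on S (\<lambda>p. of_real a * G p + of_real b * H p)"
proof -
  have eq: "(\<Sum>x\<in>S. \<Sum>y\<in>S. cnj (w x) * (of_real a * G (x, y) + of_real b * H (x, y)) * w y)
      = of_real a * (\<Sum>x\<in>S. \<Sum>y\<in>S. cnj (w x) * G (x, y) * w y)
      + of_real b * (\<Sum>x\<in>S. \<Sum>y\<in>S. cnj (w x) * H (x, y) * w y)" for w
    by (simp add: sum_distrib_left sum.distrib algebra_simps)
  have pos: "0 \<le> Re (of_real a * X + of_real b * Y)" if "0 \<le> Re X" "0 \<le> Re Y" for X Y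
    using assms(3,4) that by simp
  show ?thesis unfolding psd_on_def eq
  proof (intro conjI allI ballI impI)
    show "of_real a * G p + of_real b * H p = 0" if "p \<notin> S \<times> S" for p
      using assms(1,2) that unfolding psd_on_def by (metis add.right_neutral mult_zero_right)
    show "of_real a * G (y, x) + of_real b * H (y, x) = cnj (of_real a * G (x, y) + of_real b * H (x, y))"
      if "x \<in> S" "y \<in> S" for x y
    proof -
      have "G (y, x) = cnj (G (x, y))" "H (y, x) = cnj (H (x, y))"
        using assms(1,2) that unfolding psd_on_def by blast+
      then show ?thesis by simp
    qed
  qed (rule pos; use assms(1,2) in \<open>simp only: psd_on_def\<close>)
qed

lemma compact_psd_on:
  assumes "finite S" shows "compact {G. psd_on S G \<and> Re (\<Sum>z\<in>S. G (z, z)) \<le> R}"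
proof -
  have c: "continuous_on UNIV (\<lambda>G :: 'a \<times> 'a \<Rightarrow> complex. G p)" for p
    by simp
  have cl: "closed {G. psd_on S G \<and> Re (\<Sum>z\<in>S. G (z, z)) \<le> R}"
    unfolding psd_on_def Ball_def
    by (intro closed_Collect_conj closed_Collect_all closed_Collect_imp closed_Collect_eq
        closed_Collect_le open_Collect_const continuous_intros c)
  have co: "compact {G :: 'a \<times> 'a \<Rightarrow> complex. \<forall>p. G p \<in> {z. \<bar>Re z\<bar> \<le> max R 0 \<and> \<bar>Im z\<bar> \<le> max R 0}}"
    by (intro compact_function_box compact_complex_box)
  have sub: "{G. psd_on S G \<and> Re (\<Sum>z\<in>S. G (z, z)) \<le> R}
      \<subseteq> {G. \<forall>p. G p \<in> {z. \<bar>Re z\<bar> \<le> max R 0 \<and> \<bar>Im z\<bar> \<le> max R 0}}"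
  proof
    fix G assume G: "G \<in> {G. psd_on S G \<and> Re (\<Sum>z\<in>S. G (z, z)) \<le> R}"
    have "cmod (G p) \<le> max R 0" for p
    proof (cases "p \<in> S \<times> S")
      case True
      then obtain x y where p: "p = (x, y)" "x \<in> S" "y \<in> S" by blast
      have GS: "psd_on S G" "Re (\<Sum>z\<in>S. G (z, z)) \<le> R" using G by blast+
      show ?thesis using psd_on_bound[OF assms GS(1) p(2,3)] GS(2) unfolding p(1) by linarith
    next
      case False
      then have "G p = 0" using G unfolding psd_on_def by blast
      then show ?thesis by simp
    qed
    then show "G \<in> {G. \<forall>p. G p \<in> {z. \<bar>Re z\<bar> \<le> max R 0 \<and> \<bar>Im z\<bar> \<le> max R 0}}"
      by (auto intro: order_trans[OF abs_Re_le_cmod] order_trans[OF abs_Im_le_cmod])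
  qed
  show ?thesis using compact_Int_closed[OF co cl] unfolding inf.absorb2[OF sub] .
qed

text \<open>The cone is the image of the positive kernels under the linear map Q, with the forms of
  rank-one kernels as generators. Coercivity makes the trace a linear function of the image, so the
  distance to x is minimised over a compact set of kernels. If the residual r at the minimiser is
  not zero, it is the separating functional: its two properties are first variations, in the
  direction of a rank-one kernel and of the minimiser itself.\<close>

lemma cone_separation:
  fixes M :: "'i \<Rightarrow> 'a \<Rightarrow> 'a \<Rightarrow> complex"
  assumes S: "finite S" and I: "finite I"
    and coercive: "\<And>y z. y \<in> S \<Longrightarrow> z \<in> S \<Longrightarrow> (\<Sum>i\<in>I. c i * M i y z) = (if y = z then 1 else 0)"
  obtains (cone) N w where "\<And>i. i \<in> I \<Longrightarrow>
      (\<Sum>k<(N::nat). \<Sum>y\<in>S. \<Sum>z\<in>S. M i y z * (cnj (w k y) * w k z)) = x i"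
  | (separated) r where
      "\<And>w. 0 \<le> Re (\<Sum>i\<in>I. cnj (r i) * (\<Sum>y\<in>S. \<Sum>z\<in>S. M i y z * (cnj (w y) * w z)))"
      "Re (\<Sum>i\<in>I. cnj (r i) * x i) < 0"
proof -
  define Q where "Q i G = (\<Sum>y\<in>S. \<Sum>z\<in>S. M i y z * G (z, y))" for i and G :: "'a \<times> 'a \<Rightarrow> complex"
  define T where "T G = Re (\<Sum>z\<in>S. G (z, z))" for G :: "'a \<times> 'a \<Rightarrow> complex"
  define F where "F G = (\<Sum>i\<in>I. (cmod (Q i G - x i))\<^sup>2)" for G
  have Q_lin: "Q i (\<lambda>p. a * G p + b * H p) = a * Q i G + b * Q i H" for i a b G H
    by (simp add: Q_def sum_distrib_left sum.distrib algebra_simps)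
  have TQ: "T G = Re (\<Sum>i\<in>I. c i * Q i G)" for G
  proof -
    have "(\<Sum>i\<in>I. c i * Q i G) = (\<Sum>i\<in>I. \<Sum>y\<in>S. \<Sum>z\<in>S. c i * M i y z * G (z, y))"
      by (simp add: Q_def sum_distrib_left mult.assoc)
    also have "\<dots> = (\<Sum>y\<in>S. \<Sum>z\<in>S. (\<Sum>i\<in>I. c i * M i y z) * G (z, y))"
      by (subst sum.swap, rule sum.cong[OF refl], subst sum.swap) (simp add: sum_distrib_right)
    also have "\<dots> = (\<Sum>y\<in>S. \<Sum>z\<in>S. (if y = z then 1 else 0) * G (z, y))"
      by (intro sum.cong refl) (simp add: coercive)
    also have "\<dots> = (\<Sum>z\<in>S. G (z, z))"
      using S by (simp add: if_distrib[of "\<lambda>u. u * _"] cong: if_cong)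
    finally show ?thesis by (simp add: T_def)
  qed
  \<comment> \<open>For kernels whose image is no farther from x than 0 is, all \<open>Q i G\<close>
    are bounded, and by \<open>TQ\<close> so is the trace.\<close>
  define R where "R = (\<Sum>i\<in>I. cmod (c i) * (sqrt (F (\<lambda>_. 0)) + cmod (x i)))"
  have bound: "T G \<le> R" if "F G \<le> F (\<lambda>_. 0)" for G
  proof -
    have "T G \<le> (\<Sum>i\<in>I. cmod (c i * Q i G))"
      unfolding TQ by (rule order_trans[OF complex_Re_le_cmod norm_sum])
    also have "\<dots> \<le> R" unfolding R_def
    proof (rule sum_mono)
      fix i assume i: "i \<in> I"
      have "(cmod (Q i G - x i))\<^sup>2 \<le> F G"
        unfolding F_def using I i by (intro member_le_sum) auto
      then have "cmod (Q i G - x i) \<le> sqrt (F (\<lambda>_. 0))"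
        using that by (intro real_le_rsqrt) simp
      moreover have "cmod (Q i G) \<le> cmod (Q i G - x i) + cmod (x i)"
        using norm_triangle_ineq[of "Q i G - x i" "x i"] by simp
      ultimately show "cmod (c i * Q i G) \<le> cmod (c i) * (sqrt (F (\<lambda>_. 0)) + cmod (x i))"
        by (simp add: norm_mult mult_left_mono)
    qed
    finally show ?thesis .
  qed
  have zero: "psd_on S (\<lambda>_. 0)" by (simp add: psd_on_def)
  obtain G0 where G0: "psd_on S G0" "\<And>G. psd_on S G \<Longrightarrow> F G0 \<le> F G"
  proof -
    have "continuous_on {G. psd_on S G \<and> T G \<le> R} F"
      unfolding F_def Q_def by (intro continuous_intros continuous_on_subset[OF continuous_on_product_coordinates]) auto
    moreover have ne: "(\<lambda>_. 0) \<in> {G. psd_on S G \<and> T G \<le> R}"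
      using zero bound by simp
    ultimately obtain G0 where G0: "psd_on S G0" "\<And>G. psd_on S G \<Longrightarrow> T G \<le> R \<Longrightarrow> F G0 \<le> F G"
      using continuous_attains_inf[of "{G. psd_on S G \<and> T G \<le> R}" F]
        compact_psd_on[OF S, of R] unfolding T_def by blast
    have "F G0 \<le> F G" if "psd_on S G" for G
    proof (cases "F G \<le> F (\<lambda>_. 0)")
      case True
      then show ?thesis using G0(2) that bound by blast
    next
      case False
      moreover have "F G0 \<le> F (\<lambda>_. 0)" using G0(2) ne by blast
      ultimately show ?thesis by simp
    qed
    then show ?thesis using that G0(1) by blast
  qed
  define r where "r i = Q i G0 - x i" for i
  have vary: "0 \<le> Re (\<Sum>i\<in>I. cnj (r i) * Q i H)"
    if H: "\<And>t. 0 < t \<Longrightarrow> t \<le> 1 \<Longrightarrow> psd_on S (\<lambda>p. 1 * G0 p + of_real t * H p)" for H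
  proof (rule first_variation)
    show "0 \<le> (\<Sum>i\<in>I. (cmod (Q i H))\<^sup>2)" by (simp add: sum_nonneg)
    fix t :: real assume t: "0 < t" "t \<le> 1"
    have "(cmod (r i + of_real t * Q i H))\<^sup>2
        = (cmod (r i))\<^sup>2 + 2 * t * Re (cnj (r i) * Q i H) + t\<^sup>2 * (cmod (Q i H))\<^sup>2" for i
      by (simp add: cmod_power2) (simp add: power2_eq_square algebra_simps)
    moreover have "F (\<lambda>p. 1 * G0 p + of_real t * H p) = (\<Sum>i\<in>I. (cmod (r i + of_real t * Q i H))\<^sup>2)"
      unfolding F_def Q_lin by (simp add: r_def algebra_simps)
    ultimately have "F (\<lambda>p. 1 * G0 p + of_real t * H p)
        = F G0 + 2 * t * Re (\<Sum>i\<in>I. cnj (r i) * Q i H) + t\<^sup>2 * (\<Sum>i\<in>I. (cmod (Q i H))\<^sup>2)"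
      by (simp add: F_def r_def sum.distrib sum_distrib_left)
    then show "0 \<le> 2 * t * Re (\<Sum>i\<in>I. cnj (r i) * Q i H) + t\<^sup>2 * (\<Sum>i\<in>I. (cmod (Q i H))\<^sup>2)"
      using G0(2)[OF H[OF t]] by simp
  qed
  show ?thesis
  proof (cases "\<forall>i\<in>I. r i = 0")
    case True
    from psd_on_rank_one[OF S G0(1)] obtain N w
      where w: "\<forall>x\<in>S. \<forall>y\<in>S. G0 (x, y) = (\<Sum>k<(N::nat). w k x * cnj (w k y))"
      by (elim exE)
    have "(\<Sum>k<N. \<Sum>y\<in>S. \<Sum>z\<in>S. M i y z * (cnj (w k y) * w k z)) = x i" if "i \<in> I" for i
    proof -
      have "(\<Sum>k<N. \<Sum>y\<in>S. \<Sum>z\<in>S. M i y z * (cnj (w k y) * w k z)) = Q i G0"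
        unfolding Q_def
        by (subst sum.swap, rule sum.cong[OF refl], subst sum.swap)
          (auto simp: w sum_distrib_left mult.commute intro!: sum.cong)
      then show ?thesis using True that by (simp add: r_def)
    qed
    then show ?thesis using that(1) by blast
  next
    case False
    have "0 \<le> Re (\<Sum>i\<in>I. cnj (r i) * (\<Sum>y\<in>S. \<Sum>z\<in>S. M i y z * (cnj (w y) * w z)))" for w
    proof -
      let ?H = "\<lambda>(x, y). if x \<in> S \<and> y \<in> S then w x * cnj (w y) else 0"
      have "0 \<le> Re (\<Sum>i\<in>I. cnj (r i) * Q i ?H)"
        using psd_on_combine[OF G0(1) psd_on_rank1I[OF S], of 1] by (intro vary) simp
      then show ?thesis by (simp add: Q_def mult.commute)
    qed
    moreover have "Re (\<Sum>i\<in>I. cnj (r i) * x i) < 0"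
    proof -
      \<comment> \<open>Shrinking \<open>G0\<close> stays inside the cone, so the nearest point has
        nonpositive product with its residual. Subtracting the positive square of r puts x strictly
        on the negative side.\<close>
      have "0 \<le> Re (\<Sum>i\<in>I. cnj (r i) * Q i (\<lambda>p. - G0 p))"
      proof (rule vary)
        fix t :: real assume "0 < t" "t \<le> 1"
        then show "psd_on S (\<lambda>p. 1 * G0 p + of_real t * - G0 p)"
          using psd_on_combine[OF G0(1) zero, of "1 - t" 0] by (simp add: algebra_simps)
      qed
      moreover have "Q i (\<lambda>p. - G0 p) = - Q i G0" for i
        using Q_lin[of i "-1" G0 0 G0] by simp
      ultimately have "Re (\<Sum>i\<in>I. cnj (r i) * Q i G0) \<le> 0" by (simp add: sum_negf)
      moreover have "(\<Sum>i\<in>I. cnj (r i) * x i)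
          = (\<Sum>i\<in>I. cnj (r i) * Q i G0) - of_real (\<Sum>i\<in>I. (cmod (r i))\<^sup>2)"
        unfolding of_real_sum sum_subtractf[symmetric]
        by (rule sum.cong) (simp_all only: complex_norm_square, simp add: r_def algebra_simps)
      moreover have "0 < (\<Sum>i\<in>I. (cmod (r i))\<^sup>2)"
      proof -
        obtain i where "i \<in> I" "r i \<noteq> 0" using False by blast
        then show ?thesis by (intro sum_pos2[of I i]) (auto simp: I)
      qed
      ultimately show ?thesis by simp
    qed
    ultimately show ?thesis using that(2) by blast
  qed
qed

section \<open>Inclusion of domains\<close>

text \<open>V ranges over matrices of every size and stands for a vector of a tensor product,
  reshaped. Entries of V beyond the sizes of A and Y only enlarge the right-hand side, so no size
  has to be mentioned.\<close>

definition dset :: "('g::finite \<Rightarrow> fmat) \<Rightarrow> ('g \<Rightarrow> fmat) set" where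
  "dset A = {Y. \<forall>V. 2 * Re (\<Sum>s\<in>UNIV. tr (adj V * A s * V * Y s)) \<le> nrm V}"

lemma dsetD: "Y \<in> dset A \<Longrightarrow> 2 * Re (\<Sum>s\<in>UNIV. tr (adj V * A s * V * Y s)) \<le> nrm V"
  by (simp add: dset_def)

lemma tr_adj_mult_sz:
  assumes "sz R d" shows "tr (adj R * Z) = (\<Sum>p<d. \<Sum>q<d. cnj (ent R p q) * ent Z p q)"
proof -
  obtain n where n: "sz Z n" using sz_ex by blast
  have "sz (adj R * Z) (max d n)" using assms n by (meson max.cobounded1 max.cobounded2 sz_adj sz_mono sz_mult)
  then have "tr (adj R * Z) = (\<Sum>q<max d n. ent (adj R * Z) q q)" by (rule tr_sz)
  also have "\<dots> = (\<Sum>q<d. ent (adj R * Z) q q)"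
    by (rule sum.mono_neutral_right) (use assms in \<open>auto simp: ent_times_sz[of _ d] sz_adj sz_def\<close>)
  also have "\<dots> = (\<Sum>q<d. \<Sum>p<d. cnj (ent R p q) * ent Z p q)"
    by (simp add: ent_times_sz[OF disjI1[OF sz_adj[OF assms]]])
  finally show ?thesis by (subst sum.swap)
qed

lemma nrm_un_mult_un_le: "nrm (un m * V * un n) \<le> nrm V"
  using nrm_mult_proj_le[OF proj_un, of "un m * V" n] nrm_proj_mult_le[OF proj_un, of m V] by simp

text \<open>The separating functional, made strictly positive, is conjugated to a unital one; it is then
  a point of \<open>dset C\<close> outside \<open>dset A\<close>. The row \<open>c\<close>, on which \<open>C\<close> vanishes, makes the
  functional positive and supplies the slack in the contractivity of \<open>W\<close>.\<close>

lemma no_separation: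
  fixes A C R :: "'g::finite \<Rightarrow> fmat"
  assumes C: "\<And>s. sz (C s) c" and A: "\<And>s. sz (A s) d" and sub: "dset C \<subseteq> dset A"
    and R: "sz R0 d" "\<And>s. sz (R s) d"
    and pos: "\<And>W. un (Suc c) * W = W \<Longrightarrow> W * un d = W \<Longrightarrow>
      0 \<le> Re (tr (adj R0 * (adj W * W)) + (\<Sum>s\<in>UNIV. tr (adj (R s) * (adj W * C s * W))))"
    and neg: "Re (tr (adj R0 * un d) + (\<Sum>s\<in>UNIV. tr (adj (R s) * A s))) < 0"
  shows False
proof -
  define t where "t = - Re (tr (adj R0 * un d) + (\<Sum>s\<in>UNIV. tr (adj (R s) * A s)))"
  \<comment> \<open>t is the separation gap. Adding e times the identity to the functional changes
    its value at the identity by e * d < t, so strict positivity is gained while the separation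
    survives.\<close>
  define e where "e = t / real (2 * Suc d)"
  have t: "0 < t" using neg unfolding t_def by linarith
  have e: "0 < e" using t by (simp add: e_def)
  have "e * real d < e * real (2 * Suc d)" using e by (intro mult_strict_left_mono) auto
  also have "\<dots> = t" unfolding e_def by (simp del: of_nat_mult of_nat_Suc)
  finally have ed: "e * d < t" .
  \<comment> \<open>On hermitian matrices such as adj W * W only the hermitian part of
    \<open>R0\<close> is visible (fact \<open>trP\<close>).\<close>
  define P where "P = smul (1/2) (R0 + adj R0)"
  have szP: "sz P d" "adj P = P" using R by (simp_all add: P_def sz_smul sz_add sz_adj add.commute)
  have trP: "Re (tr (adj R0 * H)) = Re (tr (P * H))" if "adj H = H" for H
  proof -
    have "tr (R0 * H) = cnj (tr (adj H * adj R0))" by (simp flip: tr_linear(6))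
    then have "Re (tr (R0 * H)) = Re (tr (adj R0 * H))" using that by (simp add: tr_commute[of H])
    then show ?thesis by (simp add: P_def distrib_right)
  qed
  have Ppos: "0 \<le> Re (tr (adj V * P * V))" for V
  proof -
    obtain n where n: "sz V n" using sz_ex by blast
    \<comment> \<open>These lie in row c and are killed by every \<open>C s\<close>, so the
      hypothesis \<open>pos\<close> sees only its \<open>R0\<close> term. Summed over j, the
      products adj (W j) * W j rebuild V * adj V, cut to size d.\<close>
    define W where "W j = E c j * adj V * un d" for j
    have CW: "C s * W j = 0" for s j
    proof -
      have "C s * E c j = 0" using C[of s] by (intro fmat_eqI) (auto simp: ent_mult_E sz_def)
      then show ?thesis by (simp add: W_def mult.assoc[symmetric])
    qed
    have "0 \<le> Re (tr (P * (adj (W j) * W j)))" for j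
    proof -
      have "un (Suc c) * E c j = E c j" by (rule fmat_eqI) (auto simp: ent_un_mult)
      then have "un (Suc c) * W j = W j" by (simp add: W_def mult.assoc[symmetric])
      moreover have "W j * un d = W j" by (simp add: W_def mult.assoc)
      ultimately show ?thesis using pos[of "W j"] CW trP[of "adj (W j) * W j"] by (simp add: mult.assoc)
    qed
    then have "0 \<le> Re (tr (P * (\<Sum>j<n. adj (W j) * W j)))"
      by (simp add: sum_distrib_left sum_nonneg)
    also have "(\<Sum>j<n. adj (W j) * W j) = un d * V * un n * adj V * un d"
    proof -
      have "un n = (\<Sum>j<n. E j j)" by (rule fmat_eqI) auto
      moreover have "E j c * (E c j * X) = E j j * X" for j X
        by (simp add: mult.assoc[symmetric] E_mult)
      ultimately show ?thesis
        by (simp add: W_def sum_distrib_left sum_distrib_right mult.assoc)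
    qed
    also have "tr (P * \<dots>) = tr (un d * P * un d * V * un n * adj V)"
      by (simp only: mult.assoc) (metis mult.assoc tr_commute)
    also have "\<dots> = tr (P * V * adj V)"
      using un_mult_sz[OF szP(1)] mult_un_sz[OF szP(1)] mult_un_sz[OF n] by (simp add: mult.assoc)
    also have "\<dots> = tr (adj V * P * V)" by (subst tr_commute) (simp add: mult.assoc)
    finally show ?thesis .
  qed
  define P' where "P' = P + smul (of_real e) (un d)"
  have P': "sz P' d" "adj P' = P'" using szP by (simp_all add: P'_def sz_add sz_smul)
  obtain K L where K: "sz K d" "sz L d" "P' = K * adj K" "K * L = un d" "L * K = un d"
  proof (rule posdef_factorization[OF P' e])
    fix V assume "un d * V = V"
    then have "Re (tr (adj V * P' * V)) = Re (tr (adj V * P * V)) + e * nrm V"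
      by (simp add: P'_def algebra_simps nrm_def)
    then show "e * nrm V \<le> Re (tr (adj V * P' * V))" using Ppos[of V] by simp
  qed
  \<comment> \<open>Substituting W = V * L bounds the unit term of the functional by
    \<open>nrm V\<close>, because \<open>P'\<close> = K * adj K and L inverts K. The factor -1/2
    cancels the 2 in \<open>dset\<close>.\<close>
  define Y where "Y s = smul (-1/2) (L * adj (R s) * adj L)" for s
  have "Y \<in> dset C" unfolding dset_def
  proof (intro CollectI allI)
    fix V
    define W where "W = un (Suc c) * V * L"
    have W: "un (Suc c) * W = W" "W * un d = W"
      using mult_un_sz[OF K(2)] by (simp_all add: W_def mult.assoc)
    have C': "un (Suc c) * C s * un (Suc c) = C s" for s
      using sz_mono[OF C, of "Suc c"] by (simp add: un_mult_sz mult_un_sz)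
    have "tr (adj (R s) * (adj W * C s * W)) = - 2 * tr (adj V * C s * V * Y s)" for s
    proof -
      have "adj W * C s * W = adj L * adj V * (un (Suc c) * C s * un (Suc c)) * V * L"
        by (simp add: W_def mult.assoc)
      then have "tr (adj (R s) * (adj W * C s * W)) = tr (adj V * C s * V * (L * adj (R s) * adj L))"
        unfolding C' by (metis (no_types) mult.assoc tr_commute)
      then show ?thesis by (simp add: Y_def)
    qed
    then have "Re (tr (adj R0 * (adj W * W))) - 2 * Re (\<Sum>s\<in>UNIV. tr (adj V * C s * V * Y s)) \<ge> 0"
      using pos[OF W] by (simp add: sum_negf sum_distrib_left[symmetric])
    moreover have "Re (tr (adj R0 * (adj W * W))) \<le> nrm V"
    proof -
      have "Re (tr (adj R0 * (adj W * W))) = Re (tr (P * (adj W * W)))" by (rule trP) simp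
      also have "\<dots> \<le> Re (tr (P' * (adj W * W)))"
      proof -
        have "tr (un d * (adj W * W)) = tr (adj W * W)"
          using arg_cong[OF W(2), of adj] by (simp add: mult.assoc[symmetric])
        then show ?thesis using e nrm_ge_0[of W] by (simp add: P'_def distrib_right nrm_def)
      qed
      also have "tr (P' * (adj W * W)) = tr (adj (W * K) * (W * K))"
        unfolding K(3) by (simp add: mult.assoc tr_commute[of K])
      also have "W * K = un (Suc c) * V * un d" by (simp add: W_def mult.assoc K)
      finally show ?thesis using nrm_un_mult_un_le[of "Suc c" V d] by (simp add: nrm_def)
    qed
    ultimately show "2 * Re (\<Sum>s\<in>UNIV. tr (adj V * C s * V * Y s)) \<le> nrm V" by linarith
  qed
  then have "Y \<in> dset A" using sub by blast
  \<comment> \<open>Testing with V = K undoes the conjugation by L: the inequality evaluates the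
    original functional at A, up to the error e * d.\<close>
  then have "2 * Re (\<Sum>s\<in>UNIV. tr (adj K * A s * K * Y s)) \<le> nrm K" by (rule dsetD)
  moreover have "tr (adj K * A s * K * Y s) = (-1/2) * tr (adj (R s) * A s)" for s
  proof -
    have KL: "adj L * adj K = un d" "K * (L * X) = un d * X" for X
      using K(4) by (metis adj_mult adj_simps(3), metis mult.assoc)
    have "tr (adj K * (A s * K * (L * adj (R s) * adj L)))
        = tr (A s * K * (L * adj (R s) * adj L) * adj K)" by (rule tr_commute)
    also have "\<dots> = tr (A s * (un d * adj (R s) * un d))"
      by (simp add: mult.assoc KL)
    also have "\<dots> = tr (A s * adj (R s))"
      using un_mult_sz[OF sz_adj[OF R(2)]] mult_un_sz[OF sz_adj[OF R(2)]] by simp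
    finally show ?thesis by (simp add: Y_def mult.assoc tr_commute[of "A s"])
  qed
  moreover have "nrm K = Re (tr P) + e * d"
  proof -
    have "nrm K = Re (tr P')" unfolding nrm_def K(3) by (simp add: tr_commute)
    then show ?thesis by (simp add: P'_def tr_un)
  qed
  moreover have "Re (tr P) = Re (tr (adj R0 * un d))"
    using mult_un_sz[OF szP(1)] trP[of "un d"] by simp
  ultimately have "0 \<le> - t + e * d"
    by (simp add: t_def sum_negf sum_distrib_left[symmetric] sum_divide_distrib[symmetric])
  then show False using ed by simp
qed

text \<open>W is flattened to a vector indexed by S. The index (None, p, q) records an entry of adj
  W * W, the index (Some s, p, q) an entry of adj W * C s * W, and the target x consists of the
  identity and A. If x lies in the cone, the generators are the coefficients sought; otherwise
  \<open>no_separation\<close> applies.\<close>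

lemma dset_subset_imp_compression:
  fixes A C :: "'g::finite \<Rightarrow> fmat"
  assumes C: "\<And>s. sz (C s) c" and A: "\<And>s. sz (A s) d" and sub: "dset C \<subseteq> dset A"
  obtains N W where "\<And>s. A s = (\<Sum>k<(N::nat). adj (W k) * C s * W k)"
    "\<And>V. (\<Sum>k<N. nrm (W k * V)) \<le> nrm V" "\<And>k. W k * un d = W k" "\<And>k. un c * W k = W k"
proof -
  define S where "S = {..<Suc c} \<times> {..<d}"
  define I where "I = (UNIV :: 'g option set) \<times> {..<d} \<times> {..<d}"
  define C' where "C' i = (case i of None \<Rightarrow> un (Suc c) | Some s \<Rightarrow> C s)" for i
  have C': "sz (C' i) (Suc c)" for i
    using sz_mono[OF C, of "Suc c"] by (auto simp: C'_def split: option.split)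
  define M where "M = (\<lambda>(i, p :: nat, q :: nat) (a, p') (b, q'). if p' = p \<and> q' = q then ent (C' i) a b else 0)"
  \<comment> \<open>Summing the diagonal entries of the component None gives the trace of adj W * W,
    the squared length of the flattened vector; this is the coercivity condition.\<close>
  define coef where "coef = (\<lambda>(i :: 'g option, p, q). if i = None \<and> (p::nat) = q then 1 else 0 :: complex)"
  define x where "x = (\<lambda>(i, p, q). case i of None \<Rightarrow> ent (un d) p q | Some s \<Rightarrow> ent (A s) p q)"
  define mw where "mw w = Fmat (\<lambda>a p. if (a, p) \<in> S then w (a, p) else 0)" for w :: "nat \<times> nat \<Rightarrow> complex"
  have ent_mw: "ent (mw w) a p = (if (a, p) \<in> S then w (a, p) else 0)" for w a p
    unfolding mw_def by (subst ent_Fmat[of "max (Suc c) d"]) (auto simp: S_def)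
  have mw: "un (Suc c) * mw w = mw w" "mw w * un d = mw w" for w
    by (rule fmat_eqI; auto simp: ent_un_mult ent_mult_un ent_mw S_def)+
  have mw_adj: "un d * (adj (mw w) * X) = adj (mw w) * X" for w X
    by (metis adj_mult adj_simps(3) mult.assoc mw(2))
  have mw_surj: "W = mw (\<lambda>(a, p). ent W a p)" if "un (Suc c) * W = W" "W * un d = W" for W
  proof (rule fmat_eqI)
    fix a p
    have "ent W a p = ent (un (Suc c) * W * un d) a p" using that by simp
    then have "ent W a p = (if p < d then if a < Suc c then ent W a p else 0 else 0)"
      by (simp only: ent_mult_un ent_un_mult)
    then show "ent W a p = ent (mw (\<lambda>(a, p). ent W a p)) a p"
      by (simp add: ent_mw S_def split: if_splits)
  qed
  have fin: "finite S" "finite I" by (simp_all add: S_def I_def)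
  have cp: "(\<Sum>y\<in>{..<Suc c} \<times> {..<d}. h y) = (\<Sum>a<Suc c. \<Sum>p<d. h (a, p))"
    for h :: "nat \<times> nat \<Rightarrow> complex"
    by (subst sum.cartesian_product) (rule sum.cong, auto)
  have form: "(\<Sum>y\<in>S. \<Sum>z\<in>S. M (i, p, q) y z * (cnj (w y) * w z)) = ent (adj (mw w) * C' i * mw w) p q"
    if "p < d" "q < d" for i p q w
  proof -
    have "(\<Sum>y\<in>S. \<Sum>z\<in>S. M (i, p, q) y z * (cnj (w y) * w z)) =
      (\<Sum>a<Suc c. \<Sum>p'<d. \<Sum>b<Suc c. \<Sum>q'<d. if q' = q then (if p' = p then
         ent (C' i) a b * (cnj (w (a, p)) * w (b, q)) else 0) else 0)"
      unfolding S_def cp by (intro sum.cong refl) (auto simp: M_def)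
    also have "\<dots> = (\<Sum>a<Suc c. \<Sum>b<Suc c. ent (C' i) a b * (cnj (w (a, p)) * w (b, q)))"
      using that by (subst sum.swap[of _ "{..<Suc c}" "{..<d}"]) (simp add: sum.delta sum.If_cases
        del: sum.lessThan_Suc)
    also have "\<dots> = (\<Sum>b<Suc c. (\<Sum>a<Suc c. ent (adj (mw w)) p a * ent (C' i) a b) * ent (mw w) b q)"
      unfolding sum_distrib_right using that
      by (subst sum.swap) (intro sum.cong refl, simp add: ent_mw S_def mult_ac del: sum.lessThan_Suc)
    also have "\<dots> = ent (adj (mw w) * C' i * mw w) p q"
      using C'[of i] by (simp add: ent_times_sz[of "C' i" "Suc c"] ent_times_sz[of _ "Suc c" "C' i"]
        ent_times[of "Suc c" "adj (mw w) * C' i"] sz_def ent_mw S_def del: sum.lessThan_Suc)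
    finally show ?thesis .
  qed
  have coercive: "(\<Sum>i\<in>I. coef i * M i y z) = (if y = z then 1 else 0)" if yz: "y \<in> S" "z \<in> S" for y z
  proof -
    obtain a p b q where ap: "y = (a, p)" "z = (b, q)" by (cases y, cases z) blast
    have "(\<Sum>i\<in>I. coef i * M i y z) = (\<Sum>i\<in>{(None, p, p)}. coef i * M i y z)"
      by (rule sum.mono_neutral_right) (use yz fin in \<open>auto simp: I_def S_def coef_def M_def ap split: if_splits\<close>)
    then show ?thesis using yz by (auto simp: coef_def M_def ap C'_def S_def)
  qed
  show ?thesis
  proof (rule cone_separation[OF fin, of coef M x])
    show "(\<Sum>i\<in>I. coef i * M i y z) = (if y = z then 1 else 0)" if "y \<in> S" "z \<in> S" for y z
      by (rule coercive[OF that])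
  next
    fix N w assume *: "\<And>i. i \<in> I \<Longrightarrow> (\<Sum>k<(N::nat). \<Sum>y\<in>S. \<Sum>z\<in>S. M i y z * (cnj (w k y) * w k z)) = x i"
    define W where "W k = mw (w k)" for k
    have W: "(\<Sum>k<N. adj (W k) * C' i * W k) = (case i of None \<Rightarrow> un d | Some s \<Rightarrow> A s)" for i
    proof (rule fmat_eqI)
      fix p q
      show "ent (\<Sum>k<N. adj (W k) * C' i * W k) p q = ent (case i of None \<Rightarrow> un d | Some s \<Rightarrow> A s) p q"
      proof (cases "p < d \<and> q < d")
        case True
        then have "(i, p, q) \<in> I" by (simp add: I_def)
        from *[OF this] True show ?thesis by (simp add: form W_def x_def split: option.splits)
      next
        case False
        define Z where "Z = (\<Sum>k<N. adj (W k) * C' i * W k)"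
        have "un d * Z * un d = Z"
          using mw(2) mw_adj by (simp add: Z_def W_def sum_distrib_left sum_distrib_right mult.assoc)
        then have "ent Z p q = ent (un d * Z * un d) p q" by simp
        then have "ent Z p q = 0" using False by (auto simp only: ent_mult_un ent_un_mult if_False split: if_splits)
        then have "ent (\<Sum>k<N. adj (W k) * C' i * W k) p q = 0" unfolding Z_def .
        moreover have "ent (case i of None \<Rightarrow> un d | Some s \<Rightarrow> A s) p q = 0"
          using False A by (auto simp: sz_def not_less split: option.splits)
        ultimately show ?thesis by simp
      qed
    qed
    \<comment> \<open>Row c has done its work in the separation. Without it the representation of A
      is unchanged, since C vanishes there, while the equality of the sum of adj W * W with
      \<open>un d\<close> weakens to an inequality.\<close>
    define V where "V k = un c * W k" for k
    show thesis
    proof (rule that[of V N])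
      show "A s = (\<Sum>k<N. adj (V k) * C s * V k)" for s
      proof -
        have "adj (V k) * C s * V k = adj (W k) * C s * W k" for k
          using un_mult_sz[OF C] mult_un_sz[OF C] by (simp add: V_def mult.assoc)
            (metis mult.assoc)
        then show ?thesis using W[of "Some s"] by (simp add: C'_def)
      qed
      show "(\<Sum>k<N. nrm (V k * X)) \<le> nrm X" for X
      proof -
        have "(\<Sum>k<N. nrm (V k * X)) \<le> (\<Sum>k<N. nrm (W k * X))"
          by (rule sum_mono) (simp add: V_def mult.assoc nrm_proj_mult_le)
        also have "\<dots> = Re (tr (adj X * (\<Sum>k<N. adj (W k) * C' None * W k) * X))"
          using mw(1) by (simp add: nrm_def C'_def W_def sum_distrib_left sum_distrib_right mult.assoc)
        also have "\<dots> = nrm (un d * X)"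
          unfolding W by (simp add: nrm_def mult.assoc)
        also have "\<dots> \<le> nrm X" by (rule nrm_proj_mult_le) simp
        finally show ?thesis .
      qed
      show "V k * un d = V k" "un c * V k = V k" for k
        using mw(2) by (simp_all add: V_def W_def mult.assoc)
    qed
  next
    fix r
    assume r1: "\<And>w. 0 \<le> Re (\<Sum>i\<in>I. cnj (r i) * (\<Sum>y\<in>S. \<Sum>z\<in>S. M i y z * (cnj (w y) * w z)))"
      and r2: "Re (\<Sum>i\<in>I. cnj (r i) * x i) < 0"
    define R where "R i = Fmat (\<lambda>p q. if p < d \<and> q < d then r (i, p, q) else 0)" for i
    have entR: "ent (R i) p q = (if p < d \<and> q < d then r (i, p, q) else 0)" for i p q
      unfolding R_def by (subst ent_Fmat[of d]) auto
    have szR: "sz (R i) d" for i by (auto simp: sz_def entR)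
    have sumI: "(\<Sum>i\<in>I. cnj (r i) * f i) = tr (adj (R None) * Z None) + (\<Sum>s\<in>UNIV. tr (adj (R (Some s)) * Z (Some s)))"
      if "\<And>i p q. p < d \<Longrightarrow> q < d \<Longrightarrow> f (i, p, q) = ent (Z i) p q" for f Z
    proof -
      have "(\<Sum>i\<in>I. cnj (r i) * f i) = (\<Sum>i\<in>UNIV. \<Sum>p<d. \<Sum>q<d. cnj (r (i, p, q)) * f (i, p, q))"
        unfolding I_def sum.cartesian_product by (rule sum.cong) auto
      also have "\<dots> = (\<Sum>i\<in>UNIV. tr (adj (R i) * Z i))"
        unfolding tr_adj_mult_sz[OF szR] by (intro sum.cong refl) (simp add: that entR)
      also have "\<dots> = tr (adj (R None) * Z None) + (\<Sum>i\<in>range Some. tr (adj (R i) * Z i))"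
        by (simp add: UNIV_option_conv)
      finally show ?thesis by (simp add: sum.reindex)
    qed
    have False
    proof (rule no_separation[OF C A sub szR[of None] szR[of "Some _"]])
      fix W assume W: "un (Suc c) * W = W" "W * un d = W"
      have "0 \<le> Re (tr (adj (R None) * (adj W * C' None * W)) +
          (\<Sum>s\<in>UNIV. tr (adj (R (Some s)) * (adj W * C' (Some s) * W))))"
        using r1[of "\<lambda>(a, p). ent W a p"]
        by (subst (asm) sumI[of _ "\<lambda>i. adj W * C' i * W"]) (auto simp: form mw_surj[OF W, symmetric])
      then show "0 \<le> Re (tr (adj (R None) * (adj W * W)) +
          (\<Sum>s\<in>UNIV. tr (adj (R (Some s)) * (adj W * C s * W))))"
        by (simp add: C'_def mult.assoc W)
    next
      show "Re (tr (adj (R None) * un d) + (\<Sum>s\<in>UNIV. tr (adj (R (Some s)) * A s))) < 0"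
        using r2 by (subst (asm) sumI[of _ "\<lambda>i. case i of None \<Rightarrow> un d | Some s \<Rightarrow> A s"])
          (auto simp: x_def split: option.split)
    qed
    then show thesis ..
  qed
qed

section \<open>Rigidity\<close>

lemma nrm_sum_mult:
  "(\<Sum>k\<in>K. nrm (T k * V)) = Re (tr (adj V * (\<Sum>k\<in>K. adj (T k) * T k) * V))"
  by (simp add: nrm_def sum_distrib_left sum_distrib_right mult.assoc)

text \<open>An equality case: \<open>\<Sum>T\<^sub>k\<^sup>*T\<^sub>k\<close> is a positive contraction, so it fixes every
  vector on which it preserves the norm.\<close>

lemma contraction_fixes:
  assumes contr: "\<And>V. (\<Sum>k\<in>K. nrm (T k * V)) \<le> nrm V" and eq: "nrm Z \<le> (\<Sum>k\<in>K. nrm (T k * Z))"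
  shows "(\<Sum>k\<in>K. adj (T k) * T k) * Z = Z"
proof -
  define S where "S = (\<Sum>k\<in>K. adj (T k) * T k)"
  have adjS: "adj S = S" by (simp add: S_def)
  have "2 * nrm (S * Z) = (\<Sum>k\<in>K. 2 * Re (tr (adj (T k * (S * Z)) * (T k * Z))))"
    by (simp add: nrm_def adjS S_def[symmetric] sum_distrib_left[symmetric] flip: Re_sum tr_sum)
      (simp add: S_def sum_distrib_left sum_distrib_right mult.assoc)
  also have "\<dots> \<le> (\<Sum>k\<in>K. nrm (T k * (S * Z)) + nrm (T k * Z))"
    by (intro sum_mono) (use two_Re_tr_le[of 1] in \<open>simp del: adj_mult\<close>)
  also have "\<dots> \<le> nrm (S * Z) + nrm Z"
    unfolding sum.distrib using contr[of "S * Z"] contr[of Z] by linarith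
  finally have "nrm (S * Z) \<le> nrm Z" by simp
  moreover have "(\<Sum>k\<in>K. nrm (T k * Z)) = Re (tr (adj (S * Z) * Z))"
    unfolding nrm_sum_mult by (simp add: adjS S_def[symmetric])
  ultimately have "nrm (S * Z - Z) \<le> 0" using eq unfolding nrm_diff by linarith
  then have "S * Z - Z = 0" using nrm_ge_0[of "S * Z - Z"] nrm_eq_0_iff by (metis antisym)
  then show ?thesis by (simp add: S_def)
qed

text \<open>The projection p is a parameter because a tight compression lives on the range of p,
  which may be smaller than the ambient space. Only one inclusion is tested: the other one holds for
  every compression (\<open>dset_compression_mono\<close>).\<close>

definition tight :: "fmat \<Rightarrow> ('g::finite \<Rightarrow> fmat) \<Rightarrow> bool" where
  "tight p B \<longleftrightarrow> proj p \<and> (\<forall>s. p * B s = B s \<and> B s * p = B s) \<and>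
    (\<forall>q. proj q \<longrightarrow> p * q = q \<longrightarrow> dset (\<lambda>s. q * B s * q) \<subseteq> dset B \<longrightarrow> q = p)"

lemma one_row_mult_adj:
  assumes "un 1 * y = y" "nrm y = 1" shows "y * adj y = un 1"
proof -
  have "y * adj y = smul (tr (y * adj y)) (un 1)"
    using assms(1) by (intro one_by_one) (metis mult.assoc, metis adj_mult adj_simps(3) mult.assoc)
  moreover have "tr (y * adj y) = 1"
  proof -
    have "cnj (tr (y * adj y)) = tr (y * adj y)" by (simp flip: tr_linear(6))
    moreover have "Re (tr (y * adj y)) = 1" using assms(2) by (simp add: nrm_def tr_commute)
    ultimately show ?thesis by (simp add: complex_eq_iff)
  qed
  ultimately show ?thesis by simp
qed

context
  fixes K :: "'k set" and T :: "'k \<Rightarrow> fmat"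
begin

text \<open>The map \<Phi> acting on quadratic forms: the form of X is sent to the form of \<Phi>
  X.\<close>

definition push :: "(fmat \<Rightarrow> real) \<Rightarrow> fmat \<Rightarrow> real" where
  "push g V = (\<Sum>k\<in>K. g (T k * V))"

lemma push_pow_mono: "(\<And>V. g V \<le> h V) \<Longrightarrow> (push ^^ n) g V \<le> (push ^^ n) h V"
  by (induction n arbitrary: V) (auto simp: push_def intro: sum_mono)

lemma push_pow_linear:
  "(push ^^ n) (\<lambda>V. a * g V + b * h V) V = a * (push ^^ n) g V + b * (push ^^ n) h V"
  by (induction n arbitrary: V) (auto simp: push_def sum.distrib sum_distrib_left)

lemma push_pow_le:
  assumes "\<And>V. push f V \<le> f V" shows "(push ^^ n) f V \<le> f V"
proof (induction n arbitrary: V)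
  case (Suc n)
  have "(push ^^ Suc n) f V \<le> push f V"
    unfolding funpow.simps o_apply by (subst (1 2) push_def) (intro sum_mono Suc.IH)
  then show ?case using assms[of V] by linarith
qed simp

text \<open>The increments \<open>push \<beta> - \<beta>\<close> of a bounded form telescope.\<close>

lemma push_pow_small:
  assumes contr: "\<And>V. push nrm V \<le> nrm V"
    and bd: "\<And>V. \<bar>\<beta> V\<bar> \<le> c * nrm V" and "0 < \<kappa>" "\<And>V. 0 \<le> g V"
    and incr: "\<And>V. \<kappa> * g V \<le> push \<beta> V - \<beta> V" and "0 < \<eta>"
  obtains n where "(push ^^ n) g V < \<eta>"
proof (rule ccontr)
  assume "\<not> thesis"
  with that have ge: "\<eta> \<le> (push ^^ n) g V" for n by (meson not_less)
  have c: "0 \<le> c" using bd[of "un 1"] by (simp add: nrm_def tr_un)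
  have bd_pow: "\<bar>(push ^^ n) \<beta> V\<bar> \<le> c * nrm V" for n
  proof -
    have "(push ^^ n) \<beta> V \<le> (push ^^ n) (\<lambda>V. c * nrm V + 0 * nrm V) V"
      using bd by (intro push_pow_mono) (simp add: abs_le_iff)
    moreover have "(push ^^ n) (\<lambda>V. (-c) * nrm V + 0 * nrm V) V \<le> (push ^^ n) \<beta> V"
      using bd by (intro push_pow_mono) (auto simp: abs_le_iff intro: minus_le_iff[THEN iffD1])
    moreover have "c * (push ^^ n) nrm V \<le> c * nrm V"
      using push_pow_le[OF contr] c by (intro mult_left_mono)
    ultimately show ?thesis unfolding push_pow_linear by (simp add: abs_le_iff)
  qed
  have step: "\<kappa> * (push ^^ n) g V \<le> (push ^^ Suc n) \<beta> V - (push ^^ n) \<beta> V" for n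
  proof -
    have "(push ^^ n) (\<lambda>V. \<kappa> * g V + 0 * g V) V \<le> (push ^^ n) (\<lambda>V. 1 * push \<beta> V + (-1) * \<beta> V) V"
      using incr by (intro push_pow_mono) simp
    moreover have "(push ^^ Suc n) \<beta> V = (push ^^ n) (push \<beta>) V"
      by (simp only: funpow_Suc_right o_apply)
    ultimately show ?thesis unfolding push_pow_linear by simp
  qed
  have "real n * (\<kappa> * \<eta>) \<le> (push ^^ n) \<beta> V - \<beta> V" for n
  proof (induction n)
    case (Suc n)
    have "\<kappa> * \<eta> \<le> \<kappa> * (push ^^ n) g V" using ge assms(3) by simp
    then show ?case using Suc.IH step[of n] by (simp add: algebra_simps)
  qed simp
  moreover have "(push ^^ n) \<beta> V - \<beta> V \<le> 2 * (c * nrm V)" for n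
    using bd_pow[of n] bd[of V] by (simp add: abs_le_iff)
  ultimately have "real n * (\<kappa> * \<eta>) \<le> 2 * (c * nrm V)" for n using order_trans by blast
  moreover obtain n where "2 * (c * nrm V) < real n * (\<kappa> * \<eta>)"
    using reals_Archimedean3[of "\<kappa> * \<eta>"] assms(3,6) by auto
  ultimately show False by (meson not_less)
qed

text \<open>The row y is a unit vector below p, and q cuts it off. If some bounded form \<beta>
  grows under \<open>push\<close> by at least \<kappa> times the y-component, then that component
  becomes arbitrarily small along the powers of \<open>push\<close> (\<open>push_pow_small\<close>).
  It then costs nothing to know an inequality only on the range of q, so the compression to q has
  the same domain, against tightness.\<close>

lemma tight_no_increment:
  fixes B :: "'g::finite \<Rightarrow> fmat"
  assumes tight: "tight p B"
    and BT: "\<And>s. B s = (\<Sum>k\<in>K. adj (T k) * B s * T k)"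
    and contr: "\<And>V. (\<Sum>k\<in>K. nrm (T k * V)) \<le> nrm V"
    and y: "un 1 * y = y" "y * p = y" "nrm y = 1"
    and bd: "\<And>V. \<bar>\<beta> V\<bar> \<le> c * nrm V" and \<kappa>: "0 < \<kappa>"
    and incr: "\<And>V. \<kappa> * nrm (y * V) \<le> push \<beta> V - \<beta> V"
  shows False
proof -
  have p: "proj p" "adj p = p" "p * p = p" and Bp: "\<And>s. p * B s = B s" "\<And>s. B s * p = B s"
    using tight by (auto simp: tight_def proj_def)
  have yy: "y * adj y = un 1" by (rule one_row_mult_adj[OF y(1,3)])
  have adjy: "adj y * un 1 = adj y" "p * adj y = adj y"
    using arg_cong[OF y(1), of adj] arg_cong[OF y(2), of adj] p(2) by simp_all
  define q where "q = p - adj y * y"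
  have yy_assoc: "y * (adj y * Z) = un 1 * Z" for Z by (simp add: mult.assoc[symmetric] yy)
  have y1: "un (Suc 0) * (y * Z) = y * Z" for Z using y(1) by (simp add: mult.assoc[symmetric])
  have p_adjy: "p * (adj y * Z) = adj y * Z" for Z using adjy(2) by (simp add: mult.assoc[symmetric])
  have y_p: "y * (p * Z) = y * Z" for Z using y(2) by (simp add: mult.assoc[symmetric])
  have q: "proj q" "p * q = q"
    unfolding proj_def q_def using p y(1,2) y1 yy_assoc
    by (simp_all add: algebra_simps p_adjy y_p)
  have qy: "q * (adj y * Z) = adj y * Z - adj y * (un 1 * Z)" for Z
    by (simp add: q_def algebra_simps p_adjy yy_assoc)
  have "q \<noteq> p"
  proof
    assume "q = p"
    then have "y * (adj y * y) = 0" by (simp add: q_def)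
    then show False using y(3) by (simp only: yy_assoc y(1)) simp
  qed
  have "dset (\<lambda>s. q * B s * q) \<subseteq> dset B"
  proof
    fix X assume X: "X \<in> dset (\<lambda>s. q * B s * q)"
    \<comment> \<open>X lies in \<open>dset B\<close> iff f is nonnegative. Since \<Phi> fixes B and
      does not enlarge the norm form, \<open>push\<close> can only lower f; so a lower bound on a
      late iterate of f suffices.\<close>
    define f where "f V = nrm V - 2 * Re (\<Sum>s\<in>UNIV. tr (adj V * B s * V * X s))" for V
    have f_push: "push f V \<le> f V" for V
    proof -
      have "(\<Sum>k\<in>K. adj (T k * V) * B s * (T k * V) * X s) = adj V * B s * V * X s" for s
        by (subst BT[of s]) (simp add: sum_distrib_left sum_distrib_right mult.assoc)
      then have "(\<Sum>k\<in>K. \<Sum>s\<in>UNIV. tr (adj (T k * V) * B s * (T k * V) * X s))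
          = (\<Sum>s\<in>UNIV. tr (adj V * B s * V * X s))"
        by (subst sum.swap) (simp only: tr_sum[symmetric])
      then have "push f V = (\<Sum>k\<in>K. nrm (T k * V)) - 2 * Re (\<Sum>s\<in>UNIV. tr (adj V * B s * V * X s))"
        by (simp only: push_def f_def sum_subtractf sum_distrib_left[symmetric] Re_sum[symmetric])
      then show ?thesis using contr[of V] by (simp add: f_def)
    qed
    define m where "m = (\<Sum>s\<in>UNIV. nrm (B s) * nrm (X s))"
    have m: "0 \<le> m" by (simp add: m_def sum_nonneg)
    define g where "g = real (card (UNIV :: 'g set))"
    have g: "0 < g" by (simp add: g_def finite_UNIV_card_ge_0)
    \<comment> \<open>V1 is the component of V along y. On V0 the compression to q loses nothing, so
      the hypothesis on X applies there; terms involving V1 are absorbed by Young's inequality, at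
      the price of a large multiple of nrm (y * V).\<close>
    have lower: "- \<epsilon> * nrm V - (4 * g * m / \<epsilon> + g + m) * nrm (y * V) \<le> f V" if \<epsilon>: "0 < \<epsilon>" for \<epsilon> V
    proof -
      \<comment> \<open>Each of the g indices contributes two mixed terms of weight e on
        \<open>nrm V0\<close>, in total 2 * g * e = \<epsilon>.\<close>
      define e where "e = \<epsilon> / (2 * g)"
      have e: "0 < e" using \<epsilon> g by (simp add: e_def)
      define V1 where "V1 = adj y * (y * V)"
      define V0 where "V0 = V - V1"
      have nV1: "nrm V1 = nrm (y * V)"
        by (simp add: nrm_def V1_def mult.assoc yy_assoc y1)
      have nV: "nrm V = nrm V0 + nrm V1"
      proof -
        have "adj V0 * V1 = 0" by (simp add: V0_def V1_def algebra_simps yy_assoc y1)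
        then show ?thesis using nrm_add[of V0 V1] by (simp add: V0_def)
      qed
      have pV0: "p * V0 = q * V0"
        by (simp add: V0_def V1_def q_def algebra_simps p_adjy yy_assoc y1)
      have V0: "2 * Re (\<Sum>s\<in>UNIV. tr (adj V0 * B s * V0 * X s)) \<le> nrm V0"
      proof -
        have "adj V0 * B s * V0 = adj V0 * (q * B s * q) * V0" for s
        proof -
          have "adj V0 * B s * V0 = adj (p * V0) * B s * (p * V0)"
            using Bp p(2) by (simp add: mult.assoc) (metis mult.assoc)
          also have "\<dots> = adj V0 * (q * B s * q) * V0"
            unfolding pV0 using q(1) by (simp add: proj_def mult.assoc)
          finally show ?thesis .
        qed
        then show ?thesis using dsetD[OF X, of V0] by simp
      qed
      have c1: "2 * Re (tr (adj V0 * B s * V1 * X s)) \<le> e * nrm V0 + nrm (B s) * nrm (X s) * nrm V1 / e" for s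
      proof -
        have "nrm (B s * V1 * X s) \<le> nrm (B s) * nrm V1 * nrm (X s)"
          by (meson nrm_mult_le mult_right_mono nrm_ge_0 order_trans)
        then have "nrm (B s * V1 * X s) / e \<le> nrm (B s) * nrm (X s) * nrm V1 / e"
          using e by (simp add: divide_right_mono mult_ac)
        then show ?thesis using two_Re_tr_le[OF e, of V0 "B s * V1 * X s"] by (simp add: mult.assoc)
      qed
      have c2: "2 * Re (tr (adj V1 * B s * V0 * X s)) \<le> e * nrm V0 + nrm (B s) * nrm (X s) * nrm V1 / e" for s
      proof -
        have "tr (adj V1 * B s * V0 * X s) = cnj (tr (adj (X s) * adj V0 * adj (B s) * V1))"
          by (simp add: mult.assoc flip: tr_linear(6))
        also have "tr (adj (X s) * adj V0 * adj (B s) * V1) = tr (adj V0 * (adj (B s) * V1 * adj (X s)))"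
          by (simp add: mult.assoc tr_commute[of "adj (X s)"])
        finally have "Re (tr (adj V1 * B s * V0 * X s)) = Re (tr (adj V0 * (adj (B s) * V1 * adj (X s))))"
          by simp
        moreover have "nrm (adj (B s) * V1 * adj (X s)) \<le> nrm (B s) * nrm V1 * nrm (X s)"
          by (metis nrm_mult_le mult_right_mono nrm_ge_0 order_trans nrm_adj)
        then have "nrm (adj (B s) * V1 * adj (X s)) / e \<le> nrm (B s) * nrm (X s) * nrm V1 / e"
          using e by (simp add: divide_right_mono mult_ac)
        ultimately show ?thesis using two_Re_tr_le[OF e, of V0 "adj (B s) * V1 * adj (X s)"] by simp
      qed
      have c3: "2 * Re (tr (adj V1 * B s * V1 * X s)) \<le> nrm V1 + nrm (B s) * nrm (X s) * nrm V1" for s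
      proof -
        have "nrm (B s * V1 * X s) \<le> nrm (B s) * nrm V1 * nrm (X s)"
          by (meson nrm_mult_le mult_right_mono nrm_ge_0 order_trans)
        then show ?thesis using two_Re_tr_le[of 1 V1 "B s * V1 * X s"] by (simp add: mult_ac mult.assoc)
      qed
      have split: "adj V * B s * V * X s = adj V0 * B s * V0 * X s + adj V0 * B s * V1 * X s
          + adj V1 * B s * V0 * X s + adj V1 * B s * V1 * X s" for s
        by (simp add: V0_def algebra_simps)
      have "2 * Re (\<Sum>s\<in>UNIV. tr (adj V * B s * V * X s))
          = 2 * Re (\<Sum>s\<in>UNIV. tr (adj V0 * B s * V0 * X s))
          + (\<Sum>s\<in>UNIV. 2 * Re (tr (adj V0 * B s * V1 * X s)) + 2 * Re (tr (adj V1 * B s * V0 * X s))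
              + 2 * Re (tr (adj V1 * B s * V1 * X s)))"
        unfolding split by (simp add: sum.distrib sum_distrib_left)
      also have "\<dots> \<le> nrm V0 + (\<Sum>s\<in>UNIV. (e * nrm V0 + nrm (B s) * nrm (X s) * nrm V1 / e)
          + (e * nrm V0 + nrm (B s) * nrm (X s) * nrm V1 / e)
          + (nrm V1 + nrm (B s) * nrm (X s) * nrm V1))"
        by (intro add_mono V0 sum_mono c1 c2 c3)
      also have "\<dots> = nrm V0 + 2 * g * e * nrm V0 + (2 * m / e + g + m) * nrm V1"
      proof -
        have "(\<Sum>s\<in>UNIV. nrm (B s) * nrm (X s) * nrm V1 / e) = m * nrm V1 / e"
          "(\<Sum>s\<in>UNIV. nrm (B s) * nrm (X s) * nrm V1) = m * nrm V1"
          by (simp_all only: m_def sum_distrib_right sum_divide_distrib)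
        then show ?thesis
          by (simp only: sum.distrib sum_constant) (simp add: g_def algebra_simps)
      qed
      also have "2 * g * e = \<epsilon>" using g by (simp add: e_def)
      also have "2 * m / e = 4 * g * m / \<epsilon>" by (simp add: e_def)
      finally have "nrm V - f V \<le> nrm V0 + \<epsilon> * nrm V0 + (4 * g * m / \<epsilon> + g + m) * nrm V1"
        by (simp add: f_def)
      moreover have "\<epsilon> * nrm V0 \<le> \<epsilon> * nrm V" using \<epsilon> nV by simp
      ultimately show ?thesis using nV nrm_ge_0[of "y * V"] unfolding nV1 by linarith
    qed
    have "0 \<le> f V" for V
    proof (rule field_le_epsilon)
      fix \<delta> :: real assume \<delta>: "0 < \<delta>"
      \<comment> \<open>Half of the tolerance \<delta> pays for \<epsilon> * nrm V, the other half
        for the y-component of a late iterate.\<close>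
      define \<epsilon> where "\<epsilon> = \<delta> / 2 / (nrm V + 1)"
      have nV1: "0 < nrm V + 1" using nrm_ge_0[of V] by linarith
      have \<epsilon>: "0 < \<epsilon>" using \<delta> nV1 by (simp add: \<epsilon>_def)
      have "\<epsilon> * nrm V \<le> \<epsilon> * (nrm V + 1)" using \<epsilon> by simp
      also have "\<dots> = \<delta> / 2" using nV1 \<epsilon>_def by (metis nonzero_eq_divide_eq less_irrefl)
      finally have \<epsilon>V: "\<epsilon> * nrm V \<le> \<delta> / 2" .
      define C where "C = 4 * g * m / \<epsilon> + g + m"
      have C: "0 < C" using g m \<epsilon> by (simp add: C_def add_nonneg_pos add_pos_nonneg)
      obtain n where n: "(push ^^ n) (\<lambda>V. nrm (y * V)) V < \<delta> / (2 * C)"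
      proof (rule push_pow_small[of \<beta> c \<kappa> "\<lambda>V. nrm (y * V)" "\<delta> / (2 * C)" V])
        show "push nrm V \<le> nrm V" for V using contr by (simp add: push_def)
      qed (use bd \<kappa> incr \<delta> C in auto)
      have "(push ^^ n) (\<lambda>V. (- \<epsilon>) * nrm V + (- C) * nrm (y * V)) V \<le> (push ^^ n) f V"
        by (rule push_pow_mono) (use lower[OF \<epsilon>] in \<open>simp add: C_def[symmetric]\<close>)
      also have "\<dots> \<le> f V" by (rule push_pow_le[OF f_push])
      finally have "- \<epsilon> * (push ^^ n) nrm V - C * (push ^^ n) (\<lambda>V. nrm (y * V)) V \<le> f V"
        unfolding push_pow_linear by simp
      moreover have "\<epsilon> * (push ^^ n) nrm V \<le> \<epsilon> * nrm V"
        using push_pow_le[of nrm n V] contr \<epsilon> by (simp add: push_def)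
      moreover have "C * (push ^^ n) (\<lambda>V. nrm (y * V)) V \<le> \<delta> / 2"
        using n C by (simp add: field_simps)
      ultimately show "0 \<le> f V + \<delta>" using \<epsilon>V by linarith
    qed
    then show "X \<in> dset B" by (simp add: dset_def f_def)
  qed
  then show False using tight q \<open>q \<noteq> p\<close> unfolding tight_def by blast
qed

text \<open>y is a normalised nonzero row of D. It turns a growth bound in terms of D into the form
  required by \<open>tight_no_increment\<close>.\<close>

lemma nonzero_row:
  assumes "D \<noteq> 0" "D * p = D"
  obtains y \<kappa> where "un 1 * y = y" "y * p = y" "nrm y = 1" "0 < \<kappa>"
    "\<And>V. \<kappa> * nrm (y * V) \<le> nrm (D * V)"
proof -
  obtain i j where "ent D i j \<noteq> 0" using assms(1) by (metis ent_zero fmat_eqI)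
  then have "ent (E 0 i * D) 0 j \<noteq> 0" by (simp add: ent_E_mult)
  then have nz: "E 0 i * D \<noteq> 0" by auto
  define \<kappa> where "\<kappa> = nrm (E 0 i * D)"
  have \<kappa>: "0 < \<kappa>" using nrm_pos[OF nz] by (simp add: \<kappa>_def)
  define y where "y = smul (1 / sqrt \<kappa>) (E 0 i * D)"
  have "un 1 * E 0 i = E 0 i" by (rule fmat_eqI) (auto simp: ent_un_mult)
  then have "un 1 * y = y" by (simp add: y_def mult.assoc[symmetric])
  moreover have "y * p = y" using assms(2) by (simp add: y_def mult.assoc)
  moreover have "nrm y = 1" using \<kappa> nz by (simp add: y_def \<kappa>_def norm_divide power_divide)
  moreover have "\<kappa> * nrm (y * V) \<le> nrm (D * V)" for V
  proof -
    have "nrm (E 0 i) = 1" by (simp add: nrm_def E_mult tr_E)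
    then have "nrm (E 0 i * (D * V)) \<le> nrm (D * V)" using nrm_mult_le[of "E 0 i" "D * V"] by simp
    then show ?thesis using \<kappa> by (simp add: y_def norm_divide power_divide mult.assoc)
  qed
  ultimately show ?thesis using that \<kappa> by blast
qed

text \<open>Two uses of \<open>tight_no_increment\<close>. With \<beta> V = - nrm (p * V) the
  increment is the form of p minus the sum of adj T * T, so this difference vanishes. With \<beta> V
  = nrm (X * V), for X = B s or its adjoint, the increment is the sum of the squares of the
  commutators with the T k, so all of them vanish.\<close>

lemma tight_rigid:
  fixes B :: "'g::finite \<Rightarrow> fmat"
  assumes K: "finite K" and tight: "tight p B"
    and T: "\<And>k. k \<in> K \<Longrightarrow> p * T k = T k" "\<And>k. k \<in> K \<Longrightarrow> T k * p = T k"
    and BT: "\<And>s. B s = (\<Sum>k\<in>K. adj (T k) * B s * T k)"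
    and contr: "\<And>V. (\<Sum>k\<in>K. nrm (T k * V)) \<le> nrm V"
  shows "(\<Sum>k\<in>K. adj (T k) * T k) = p"
    and "\<And>k s. k \<in> K \<Longrightarrow> T k * B s = B s * T k \<and> T k * adj (B s) = adj (B s) * T k"
proof -
  have p: "proj p" "adj p = p" "p * p = p" and Bp: "\<And>s. p * B s = B s" "\<And>s. B s * p = B s"
    using tight by (auto simp: tight_def proj_def)
  note no_incr = tight_no_increment[OF tight BT contr]
  show sum_eq: "(\<Sum>k\<in>K. adj (T k) * T k) = p"
  proof (rule ccontr)
    define S where "S = p - (\<Sum>k\<in>K. adj (T k) * T k)"
    assume "(\<Sum>k\<in>K. adj (T k) * T k) \<noteq> p"
    then have "S \<noteq> 0" by (auto simp: S_def)
    have adjS: "adj S = S" using p by (simp add: S_def)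
    have Sp: "S * p = S" using p T by (simp add: S_def left_diff_distrib sum_distrib_right mult.assoc)
    have form: "Re (tr (adj V * S * V)) = nrm (p * V) - (\<Sum>k\<in>K. nrm (T k * V))" for V
      unfolding nrm_sum_mult using p
      by (simp add: S_def nrm_def algebra_simps) (metis mult.assoc)
    have Spos: "0 \<le> Re (tr (adj V * S * V))" for V
    proof -
      have "(\<Sum>k\<in>K. nrm (T k * V)) = (\<Sum>k\<in>K. nrm (T k * (p * V)))"
        using T by (simp add: mult.assoc[symmetric])
      then show ?thesis using contr[of "p * V"] unfolding form by simp
    qed
    obtain d where d: "\<forall>X\<in>{S, p}. sz X d" using sz_common[of "{S, p}" id] by auto
    obtain R where R: "sz R d" "S = adj R * R" using pos_factorization[OF _ adjS Spos] d by blast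
    have nR: "nrm (R * V) = Re (tr (adj V * S * V))" for V by (simp add: nrm_def R(2) mult.assoc)
    have "R * p = R"
    proof -
      have "S * (un d - p) = 0" using d Sp by (simp add: right_diff_distrib mult_un_sz)
      then have "nrm (R * (un d - p)) = 0" unfolding nR by (simp add: mult.assoc)
      then show ?thesis using mult_un_sz[OF R(1)] by (simp add: right_diff_distrib)
    qed
    moreover have "R \<noteq> 0" using R(2) \<open>S \<noteq> 0\<close> by auto
    ultimately obtain y \<kappa> where y: "un 1 * y = y" "y * p = y" "nrm y = 1" "0 < \<kappa>"
      "\<And>V. \<kappa> * nrm (y * V) \<le> nrm (R * V)"
      using nonzero_row by blast
    show False
    proof (rule no_incr[OF y(1-3) _ y(4)])
      show "\<bar>- nrm (p * V)\<bar> \<le> 1 * nrm V" for V using nrm_proj_mult_le[OF p(1)] by simp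
      show "\<kappa> * nrm (y * V) \<le> push (\<lambda>V. - nrm (p * V)) V - - nrm (p * V)" for V
      proof -
        have "push (\<lambda>V. - nrm (p * V)) V = - (\<Sum>k\<in>K. nrm (T k * V))"
          unfolding push_def sum_negf by (simp add: T mult.assoc[symmetric])
        then show ?thesis using y(5)[of V] by (simp add: nR form)
      qed
    qed
  qed
  have comm: "T k * X = X * T k" if k: "k \<in> K" and X: "p * X = X" "X * p = X"
    "X = (\<Sum>k\<in>K. adj (T k) * X * T k)" for k X
  proof (rule ccontr)
    assume "T k * X \<noteq> X * T k"
    define D where "D k = T k * X - X * T k" for k
    have "D k \<noteq> 0" "D k * p = D k"
      using \<open>T k * X \<noteq> X * T k\<close> X T[OF k] by (auto simp: D_def left_diff_distrib mult.assoc)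
    then obtain y \<kappa> where y: "un 1 * y = y" "y * p = y" "nrm y = 1" "0 < \<kappa>"
      "\<And>V. \<kappa> * nrm (y * V) \<le> nrm (D k * V)"
      using nonzero_row by blast
    show False
    proof (rule no_incr[OF y(1-3) _ y(4)])
      show "\<bar>nrm (X * V)\<bar> \<le> nrm X * nrm V" for V using nrm_mult_le by simp
      show "\<kappa> * nrm (y * V) \<le> push (\<lambda>V. nrm (X * V)) V - nrm (X * V)" for V
      proof -
        have s1: "(\<Sum>k\<in>K. nrm (T k * (X * V))) = nrm (X * V)"
          unfolding nrm_sum_mult sum_eq using X(1) by (simp add: nrm_def mult.assoc)
            (metis mult.assoc)
        have s2: "(\<Sum>k\<in>K. tr (adj (T k * (X * V)) * (X * (T k * V)))) = tr (adj (X * V) * (X * V))"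
        proof -
          have "(\<Sum>k\<in>K. adj (T k * (X * V)) * (X * (T k * V)))
              = adj (X * V) * (\<Sum>k\<in>K. adj (T k) * X * T k) * V"
            by (simp add: sum_distrib_left sum_distrib_right mult.assoc)
          then show ?thesis using X(3) by (simp only: tr_sum[symmetric] mult.assoc)
        qed
        \<comment> \<open>Expand the squares of D k = T k * X - X * T k. The first sum is nrm (X *
          V) because the sum of adj T * T is p, and the mixed terms give - 2 * nrm (X * V) because
          \<Phi> fixes X. What remains is the Kadison-Schwarz defect of X.\<close>
        have "(\<Sum>k\<in>K. nrm (D k * V)) = (\<Sum>k\<in>K. nrm (T k * (X * V))) + push (\<lambda>V. nrm (X * V)) V
            - 2 * Re (\<Sum>k\<in>K. tr (adj (T k * (X * V)) * (X * (T k * V))))"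
          by (simp only: D_def left_diff_distrib mult.assoc nrm_diff sum.distrib sum_subtractf push_def
              sum_distrib_left[symmetric] Re_sum)
        then have "(\<Sum>k\<in>K. nrm (D k * V)) = push (\<lambda>V. nrm (X * V)) V - nrm (X * V)"
          unfolding s1 s2 by (simp add: nrm_def)
        moreover have "nrm (D k * V) \<le> (\<Sum>k\<in>K. nrm (D k * V))"
          using K k by (intro member_le_sum) auto
        ultimately show ?thesis using y(5)[of V] by linarith
      qed
    qed
  qed
  show "T k * B s = B s * T k \<and> T k * adj (B s) = adj (B s) * T k" if "k \<in> K" for k s
  proof
    show "T k * B s = B s * T k" by (rule comm[OF that Bp BT])
    show "T k * adj (B s) = adj (B s) * T k"
    proof (rule comm[OF that])
      show "p * adj (B s) = adj (B s)" "adj (B s) * p = adj (B s)"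
        using Bp p(2) by (metis adj_mult)+
      show "adj (B s) = (\<Sum>k\<in>K. adj (T k) * adj (B s) * T k)"
        by (subst BT[of s]) (simp add: mult.assoc)
    qed
  qed
qed

end

section \<open>Reduction and intertwiners\<close>

lemma sz_below_proj: "proj p \<Longrightarrow> proj q \<Longrightarrow> p * q = q \<Longrightarrow> sz p d \<Longrightarrow> sz q d"
proof -
  assume *: "proj p" "proj q" "p * q = q" "sz p d"
  then have "un d * q = q" by (metis mult.assoc un_mult_sz)
  moreover have "q * un d = q" using * \<open>un d * q = q\<close> by (metis adj_mult adj_simps(3) proj_def)
  ultimately show "sz q d" by (simp add: sz_iff)
qed

lemma nrm_proj: "proj p \<Longrightarrow> nrm p = Re (tr p)"
  by (simp add: nrm_def proj_def)

text \<open>Any slack below 1 would do: the ranks compared later differ by at least 1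
  (\<open>one_le_nrm_proj\<close>). So neither integrality of traces nor attainment of the infimum
  has to be proved.\<close>

lemma ex_almost_minimal:
  fixes f :: "'a \<Rightarrow> real"
  assumes "x \<in> X" "\<And>y. y \<in> X \<Longrightarrow> b \<le> f y"
  obtains z where "z \<in> X" "\<And>y. y \<in> X \<Longrightarrow> f z \<le> f y + 1/2"
proof -
  have bdd: "bdd_below (f ` X)" using assms(2) by (intro bdd_belowI[of _ b]) auto
  have "Inf (f ` X) < Inf (f ` X) + 1/2" by simp
  then obtain z where "z \<in> X" "f z < Inf (f ` X) + 1/2"
    using cInf_lessD[of "f ` X"] assms(1) by blast
  moreover have "Inf (f ` X) \<le> f y" if "y \<in> X" for y using cInf_lower[OF _ bdd] that by blast
  ultimately show ?thesis using that[of z] by force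
qed

text \<open>For q below p, compressing p A p to q gives q A q. Hence a projection of almost least
  trace among those that keep the domain is tight.\<close>

lemma tight_compression_exists:
  fixes A :: "'g::finite \<Rightarrow> fmat"
  assumes A: "\<And>s. sz (A s) d"
  obtains p where "proj p" "sz p d" "dset (\<lambda>s. p * A s * p) \<subseteq> dset A" "tight p (\<lambda>s. p * A s * p)"
proof -
  define X where "X = {p. proj p \<and> sz p d \<and> dset (\<lambda>s. p * A s * p) \<subseteq> dset A}"
  have "un d \<in> X" using A by (simp add: X_def un_mult_sz mult_un_sz)
  then obtain p where p: "p \<in> X" "\<And>q. q \<in> X \<Longrightarrow> nrm p \<le> nrm q + 1/2"
    using ex_almost_minimal[of "un d" X 0 nrm] by auto
  have p': "proj p" "sz p d" "dset (\<lambda>s. p * A s * p) \<subseteq> dset A" using p(1) by (auto simp: X_def)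
  have pp: "p * p = p" using p'(1) by (simp add: proj_def)
  have "tight p (\<lambda>s. p * A s * p)" unfolding tight_def
  proof (intro conjI allI impI)
    show "proj p" by (rule p'(1))
    show "p * (p * A s * p) = p * A s * p" "p * A s * p * p = p * A s * p" for s
      using pp by (simp_all add: mult.assoc[symmetric]) (simp add: mult.assoc)
    fix q assume q: "proj q" "p * q = q" "dset (\<lambda>s. q * (p * A s * p) * q) \<subseteq> dset (\<lambda>s. p * A s * p)"
    note diff = nrm_proj_diff[OF p'(1) q(1,2)]
    have "q * (p * A s * p) * q = q * A s * q" for s
      using q(2) diff(3) by (metis mult.assoc)
    then have "q \<in> X" using q p' sz_below_proj[OF p'(1) q(1,2) p'(2)] by (auto simp: X_def)
    then have "nrm (p - q) \<le> 1/2" using p(2) diff(2) by fastforce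
    then show "q = p" using one_le_nrm_proj[OF diff(1)] by fastforce
  qed
  then show ?thesis using that p' by blast
qed

lemma nrm_mult_eq_imp_proj_eq:
  "proj p \<Longrightarrow> nrm V \<le> nrm (p * V) \<Longrightarrow> p * V = V"
  using proj_pythagoras[of p V] nrm_ge_0[of "V - p * V"] nrm_eq_0_iff[of "V - p * V"] by simp

text \<open>A representation of \<open>A\<close> as a compression of a compression \<open>p A p\<close> with minimal \<open>p\<close> is rigid,
  which forces \<open>p\<close> to reduce \<open>A\<close>.\<close>

lemma tight_reduction:
  fixes A :: "'g::finite \<Rightarrow> fmat"
  assumes A: "\<And>s. sz (A s) d"
  obtains p where "proj p" "sz p d" "dset (\<lambda>s. p * A s * p) \<subseteq> dset A" "tight p (\<lambda>s. p * A s * p)"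
    "\<And>s. A s * p = p * A s"
proof -
  obtain p where p: "proj p" "sz p d" "dset (\<lambda>s. p * A s * p) \<subseteq> dset A" "tight p (\<lambda>s. p * A s * p)"
    by (rule tight_compression_exists[OF A]) (rule that; assumption)
  define B where "B s = p * A s * p" for s
  have pp: "adj p = p" "p * p = p" "p * (p * X) = p * X" for X
    using p(1) by (auto simp: proj_def mult.assoc[symmetric])
  have tight: "tight p B" using p(4) by (simp add: B_def[abs_def])
  have Bp: "p * B s = B s" "B s * p = B s" for s by (simp_all add: B_def mult.assoc pp)
  have szB: "sz (B s) d" for s using A p(2) by (simp add: B_def sz_mult)
  obtain N V where V: "\<And>s. A s = (\<Sum>k<(N::nat). adj (V k) * B s * V k)"
      "\<And>X. (\<Sum>k<N. nrm (V k * X)) \<le> nrm X"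
  proof (rule dset_subset_imp_compression[OF szB A])
    show "dset B \<subseteq> dset A" using p(3) by (simp add: B_def[abs_def])
  next
    fix N :: nat and V
    assume "\<And>s. A s = (\<Sum>k<N. adj (V k) * B s * V k)" "\<And>X. (\<Sum>k<N. nrm (V k * X)) \<le> nrm X"
    then show thesis by (rule that)
  qed
  \<comment> \<open>The compressed coefficients represent B by itself, so rigidity applies to them.
    The rest of the proof shows that V k * p is already T k.\<close>
  define T where "T k = p * V k * p" for k
  have BT: "B s = (\<Sum>k<N. adj (T k) * B s * T k)" for s
  proof -
    have "B s = p * (\<Sum>k<N. adj (V k) * B s * V k) * p" by (subst V(1)[symmetric]) (rule B_def)
    also have "\<dots> = (\<Sum>k<N. p * adj (V k) * (p * B s * p) * V k * p)"
      by (simp add: sum_distrib_left sum_distrib_right mult.assoc Bp)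
    also have "\<dots> = (\<Sum>k<N. adj (T k) * B s * T k)" by (simp add: T_def mult.assoc pp)
    finally show ?thesis .
  qed
  have le: "nrm (T k * X) \<le> nrm (V k * (p * X))" for k X
    unfolding T_def mult.assoc by (rule nrm_proj_mult_le[OF p(1)])
  have contr: "(\<Sum>k<N. nrm (T k * X)) \<le> nrm X" for X
  proof -
    have "(\<Sum>k<N. nrm (T k * X)) \<le> (\<Sum>k<N. nrm (V k * (p * X)))" by (intro sum_mono le)
    also have "\<dots> \<le> nrm X" using V(2)[of "p * X"] nrm_proj_mult_le[OF p(1), of X] by linarith
    finally show ?thesis .
  qed
  have rigid: "(\<Sum>k<N. adj (T k) * T k) = p"
    "\<And>k s. k \<in> {..<N} \<Longrightarrow> T k * B s = B s * T k \<and> T k * adj (B s) = adj (B s) * T k"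
    using tight_rigid[OF finite_lessThan tight _ _ BT contr] by (simp_all add: T_def mult.assoc pp)
  \<comment> \<open>The T k already use up the whole norm of p. As the V k are jointly contractive,
    V k * p cannot be larger than its compression, and so it equals it.\<close>
  have nT: "(\<Sum>k<N. nrm (T k * p)) = nrm p"
    unfolding nrm_sum_mult rigid(1) by (simp add: nrm_def pp)
  have ge: "nrm p \<le> (\<Sum>k<N. nrm (V k * p))"
    unfolding nT[symmetric] using le[of _ p] by (intro sum_mono) (simp add: pp)
  have fix_p: "(\<Sum>k<N. adj (V k) * V k) * p = p"
    by (rule contraction_fixes[OF V(2) ge])
  have Vp: "V k * p = T k" if k: "k < N" for k
  proof -
    have "(\<Sum>k<N. nrm (V k * p) - nrm (T k * p)) \<le> 0"
      using nT V(2)[of p] by (simp add: sum_subtractf)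
    moreover have "0 \<le> nrm (V k * p) - nrm (T k * p)" for k
      using le[of k p] by (simp add: pp)
    ultimately have "nrm (V k * p) - nrm (T k * p) \<le> 0"
      using member_le_sum[of k "{..<N}" "\<lambda>k. nrm (V k * p) - nrm (T k * p)"] k by fastforce
    then have "p * (V k * p) = V k * p"
      by (intro nrm_mult_eq_imp_proj_eq[OF p(1)]) (simp add: T_def mult.assoc pp)
    then show ?thesis by (simp add: T_def mult.assoc)
  qed
  \<comment> \<open>On the range of p, V k acts as T k, which commutes with X; so X moves to the
    right end, and the sum of adj V * V fixes p.\<close>
  have main: "(\<Sum>k<N. adj (V k) * X * V k) * p = X"
    if "\<And>k. k < N \<Longrightarrow> T k * X = X * T k" "p * X = X" for X
  proof -
    have "(\<Sum>k<N. adj (V k) * X * V k) * p = (\<Sum>k<N. adj (V k) * (T k * X))"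
      unfolding sum_distrib_right by (intro sum.cong refl) (simp add: mult.assoc Vp that)
    also have "\<dots> = (\<Sum>k<N. adj (V k) * V k) * p * X"
      unfolding sum_distrib_right by (intro sum.cong refl) (simp add: mult.assoc Vp[symmetric])
    finally show ?thesis unfolding fix_p that(2) .
  qed
  have "A s * p = B s" for s
    using main[of "B s"] rigid(2) Bp by (simp add: V(1)[symmetric])
  moreover have "adj (A s) * p = adj (B s)" for s
  proof -
    have "adj (A s) = (\<Sum>k<N. adj (V k) * adj (B s) * V k)" by (subst V(1)) (simp add: mult.assoc)
    moreover have "p * adj (B s) = adj (B s)" using Bp(2)[of s] pp(1) by (metis adj_mult)
    ultimately show ?thesis using main[of "adj (B s)"] rigid(2) by simp
  qed
  then have "p * A s = B s" for s by (metis adj_mult adj_simps(1) pp(1))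
  ultimately show ?thesis using that p by metis
qed

text \<open>Representing A through C and C through A, the products V l * W k represent A by itself
  and hence commute with A. Rigidity leaves no loss of norm in either step, so the sum of adj V * V
  fixes each W k. Moving A s past V l * W k in C s * W k, with C s written through A s, then gives W
  k * A s.\<close>

lemma tight_intertwiners:
  fixes A C :: "'g::finite \<Rightarrow> fmat"
  assumes A: "\<And>s. sz (A s) d" and tight: "tight (un d) A" and C: "\<And>s. sz (C s) c"
    and eq: "dset C = dset A"
  obtains N W where "\<And>s k. k < (N::nat) \<Longrightarrow> C s * W k = W k * A s"
    "\<And>s k. k < N \<Longrightarrow> adj (C s) * W k = W k * adj (A s)"
    "(\<Sum>k<N. adj (W k) * W k) = un d" "\<And>k. W k * un d = W k" "\<And>k. un c * W k = W k"
proof -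
  obtain N W where W: "\<And>s. A s = (\<Sum>k<(N::nat). adj (W k) * C s * W k)"
    "\<And>V. (\<Sum>k<N. nrm (W k * V)) \<le> nrm V" "\<And>k. W k * un d = W k" "\<And>k. un c * W k = W k"
  proof (rule dset_subset_imp_compression[OF C A])
    fix N :: nat and W
    assume "\<And>s. A s = (\<Sum>k<N. adj (W k) * C s * W k)" "\<And>V. (\<Sum>k<N. nrm (W k * V)) \<le> nrm V"
      "\<And>k. W k * un d = W k" "\<And>k. un c * W k = W k"
    then show thesis by (rule that)
  qed (simp add: eq)
  obtain M V where V: "\<And>s. C s = (\<Sum>k<(M::nat). adj (V k) * A s * V k)"
    "\<And>X. (\<Sum>k<M. nrm (V k * X)) \<le> nrm X" "\<And>k. un d * V k = V k"
  proof (rule dset_subset_imp_compression[OF A C])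
    fix M :: nat and V
    assume "\<And>s. C s = (\<Sum>k<M. adj (V k) * A s * V k)" "\<And>X. (\<Sum>k<M. nrm (V k * X)) \<le> nrm X"
      "\<And>k. un d * V k = V k"
    then show thesis by (rule that)
  qed (simp add: eq)
  define K where "K = {..<M} \<times> {..<N}"
  define T where "T = (\<lambda>(l, k). V l * W k)"
  have sumK: "(\<Sum>k\<in>K. f k) = (\<Sum>k<N. \<Sum>l<M. f (l, k))" for f :: "nat \<times> nat \<Rightarrow> 'b::comm_monoid_add"
    unfolding K_def by (subst sum.swap, subst sum.cartesian_product) simp
  have BT: "A s = (\<Sum>k\<in>K. adj (T k) * A s * T k)" for s
  proof -
    have "A s = (\<Sum>k<N. adj (W k) * (\<Sum>l<M. adj (V l) * A s * V l) * W k)"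
      by (simp only: V(1)[symmetric] W(1)[symmetric])
    then show ?thesis
      by (simp add: sumK T_def sum_distrib_left sum_distrib_right mult.assoc)
  qed
  have nT: "(\<Sum>k\<in>K. nrm (T k * X)) = (\<Sum>k<N. \<Sum>l<M. nrm (V l * (W k * X)))" for X
    by (simp add: sumK T_def mult.assoc)
  have contr: "(\<Sum>k\<in>K. nrm (T k * X)) \<le> nrm X" for X
    unfolding nT using sum_mono[of "{..<N}", OF V(2)] W(2) order_trans by fastforce
  have "finite K" by (simp add: K_def)
  have Tun: "un d * T k = T k" "T k * un d = T k" for k
    using V(3) W(3) by (auto simp: T_def mult.assoc split: prod.split)
      (simp add: mult.assoc[symmetric])
  note rigid = tight_rigid[OF \<open>finite K\<close> tight Tun BT contr]
  have total: "(\<Sum>k\<in>K. nrm (T k * un d)) = nrm (un d)"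
    unfolding nrm_sum_mult rigid(1) by (simp add: nrm_def)
  have "(\<Sum>k<N. nrm (W k * un d) - (\<Sum>l<M. nrm (V l * (W k * un d)))) \<le> 0"
    using total W(2)[of "un d"] unfolding nT sum_subtractf by linarith
  moreover have nonneg: "0 \<le> nrm (W k * un d) - (\<Sum>l<M. nrm (V l * (W k * un d)))" for k
    using V(2)[of "W k * un d"] by simp
  ultimately have eq0: "nrm (W k) \<le> (\<Sum>l<M. nrm (V l * W k))" if "k < N" for k
    using member_le_sum[of k "{..<N}" "\<lambda>k. nrm (W k * un d) - (\<Sum>l<M. nrm (V l * (W k * un d)))"] that
    by (fastforce simp: W(3))
  have fixW: "(\<Sum>l<M. adj (V l) * V l) * W k = W k" if "k < N" for k
    by (rule contraction_fixes[OF V(2) eq0[OF that]])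
  have main: "(\<Sum>l<M. adj (V l) * X * V l) * W k = W k * X"
    if "k < N" "\<And>l. l < M \<Longrightarrow> V l * W k * X = X * (V l * W k)" for k X
  proof -
    have "(\<Sum>l<M. adj (V l) * X * V l) * W k = (\<Sum>l<M. adj (V l) * (V l * W k * X))"
      unfolding sum_distrib_right by (intro sum.cong refl) (simp add: mult.assoc that(2)[symmetric, simplified mult.assoc])
    also have "\<dots> = (\<Sum>l<M. adj (V l) * V l) * W k * X"
      by (simp add: sum_distrib_right mult.assoc)
    finally show ?thesis unfolding fixW[OF that(1)] .
  qed
  show ?thesis
  proof (rule that[of N W])
    have rig: "V l * W k * A s = A s * (V l * W k)" "V l * W k * adj (A s) = adj (A s) * (V l * W k)"
      if "k < N" "l < M" for k l s
      using rigid(2)[of "(l, k)" s] that by (simp_all add: K_def T_def)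
    show "C s * W k = W k * A s" if "k < N" for s k
      unfolding V(1)[of s] by (rule main[OF that rig(1)[OF that]])
    show "adj (C s) * W k = W k * adj (A s)" if "k < N" for s k
    proof -
      have "adj (C s) = (\<Sum>l<M. adj (V l) * adj (A s) * V l)" by (subst V(1)) (simp add: mult.assoc)
      then show ?thesis using main[OF that rig(2)[OF that]] by simp
    qed
    have "nrm (un d) \<le> (\<Sum>k<N. nrm (W k * un d))"
      unfolding total[symmetric] nT using V(2) by (intro sum_mono)
    from contraction_fixes[OF W(2) this] show "(\<Sum>k<N. adj (W k) * W k) = un d"
      using W(3) by (simp add: sum_distrib_right mult.assoc)
  qed (rule W(3) W(4))+
qed

section \<open>Consequences of tightness; free circular domains\<close>

lemma tight_no_square:
  assumes "tight (un d) A" "proj q" "un d * q = q" "\<And>V Y. Y \<in> dset (\<lambda>s. q * A s * q) \<Longrightarrow>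
    2 * Re (\<Sum>s\<in>UNIV. tr (adj V * A s * V * Y s)) \<le> nrm V"
  shows "q = un d"
  using assms unfolding tight_def dset_def by blast

text \<open>A vector annihilated by all A s and their adjoints can be cut off without changing A at
  all.\<close>

lemma tight_nonzero_column:
  assumes A: "\<And>s. sz (A s) d" and tight: "tight (un d) A" and v: "un d * v = v" "v * un 1 = v" "v \<noteq> 0"
  shows "\<exists>s. A s * v \<noteq> 0 \<or> adj (A s) * v \<noteq> 0"
proof (rule ccontr)
  assume "\<not> ?thesis"
  then have Av: "A s * v = 0" "adj (A s) * v = 0" for s by auto
  define y where "y = smul (1 / sqrt (nrm v)) (adj v)"
  have y: "un 1 * y = y" "nrm y = 1" "y * un d = y"
    using arg_cong[OF v(1), of adj] arg_cong[OF v(2), of adj] nrm_pos[OF v(3)] v(3)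
    by (simp_all add: y_def norm_divide power_divide)
  have yy: "y * adj y = un 1" by (rule one_row_mult_adj[OF y(1,2)])
  define q where "q = un d - adj y * y"
  have yyX: "y * (adj y * X) = un 1 * X" for X by (simp add: mult.assoc[symmetric] yy)
  have dy: "un d * adj y = adj y" using arg_cong[OF y(3), of adj] by simp
  have q: "proj q" "un d * q = q"
    using y dy yyX by (simp_all add: proj_def q_def algebra_simps) (simp_all add: mult.assoc[symmetric] dy)
  have Ay: "A s * adj y = 0" "y * A s = 0" for s
  proof -
    show "A s * adj y = 0" using Av by (simp add: y_def)
    have "adj (adj (A s) * v) = 0" using Av by simp
    then show "y * A s = 0" by (simp add: y_def)
  qed
  have "q * A s * q = A s" for s
    using Ay[of s] un_mult_sz[OF A] mult_un_sz[OF A]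
    by (simp add: q_def algebra_simps) (simp add: mult.assoc[symmetric] Ay)
  then have "q = un d" using tight_no_square[OF tight q] dsetD[of _ A] by simp
  then have "y * (adj y * y) = 0" by (simp add: q_def)
  then show False using y(2) by (simp only: yyX y(1)) simp
qed

text \<open>The block column of a zero and an identity block of size n, an isometry onto the second
  half of size 2 n. For M of size n, M * adj (sh n) is M placed in the upper right block.\<close>

definition sh :: "nat \<Rightarrow> fmat" where
  "sh n = Fmat (\<lambda>i j. if i = j + n \<and> j < n then 1 else 0)"

lemma ent_sh [simp]: "ent (sh n) i j = (if i = j + n \<and> j < n then 1 else 0)"
  unfolding sh_def by (subst ent_Fmat[of "2 * n"]) auto

lemma sz_sh: "sz (sh n) (2 * n)" by (auto simp: sz_def)

lemma ent_adj_sh_mult: "ent (adj (sh n) * X) i j = (if i < n then ent X (i + n) j else 0)"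
proof -
  have "ent (adj (sh n) * X) i j = (\<Sum>k<2 * n. if k = i + n then (if i < n then ent X (i + n) j else 0) else 0)"
    unfolding ent_times_sz[OF disjI1[OF sz_adj[OF sz_sh]]] by (rule sum.cong) auto
  then show ?thesis by simp
qed

lemma ent_sh_mult: "ent (sh n * X) i j = (if n \<le> i \<and> i < 2 * n then ent X (i - n) j else 0)"
proof -
  have "ent (sh n * X) i j = (\<Sum>k<2 * n. if k = i - n then (if n \<le> i \<and> i < 2 * n then ent X (i - n) j else 0) else 0)"
    unfolding ent_times_sz[OF disjI1[OF sz_sh]] by (rule sum.cong) auto
  then show ?thesis by auto
qed

lemma sh_simps:
  "adj (sh n) * sh n = un n" "sh n * adj (sh n) = un (2 * n) - un n" "un n * sh n = 0"
  "sh n * un n = sh n" "adj (sh n) * un n = 0" "un n * adj (sh n) = adj (sh n)"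
  by (rule fmat_eqI; auto simp: ent_adj_sh_mult ent_sh_mult ent_un_mult ent_mult_un)+

lemma sh_simps_assoc:
  "adj (sh n) * (sh n * X) = un n * X" "un n * (sh n * X) = 0"
  "sh n * (un n * X) = sh n * X" "adj (sh n) * (un n * X) = 0" "un n * (adj (sh n) * X) = adj (sh n) * X"
  by (simp_all add: mult.assoc[symmetric] sh_simps)

text \<open>A free circular domain contains \<open>X\<close> iff it contains \<open>((0, X), (0, 0))\<close>, i.e. iff
  \<open>\<parallel>\<Sum>A\<^sub>s \<otimes> X\<^sub>s\<parallel> \<le> 1\<close>; so it is also the domain of the tuple \<open>((0, A), (0, 0))\<close>.\<close>

lemma free_circular_dset:
  fixes A :: "'g::finite \<Rightarrow> fmat"
  assumes A: "\<And>s. sz (A s) d"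
    and fc: "\<And>n U Y. 1 \<le> n \<Longrightarrow> unitary n U \<Longrightarrow> Y \<in> dset A \<Longrightarrow> (\<And>s. sz (Y s) n) \<Longrightarrow> (\<lambda>s. Y s * U) \<in> dset A"
  shows "dset (\<lambda>s. A s * adj (sh d)) = dset A"
proof
  \<comment> \<open>The flip of the two halves: right multiplication by it moves a point of size n,
    seen in size 2 n, to the upper right corner.\<close>
  have swap: "unitary (2 * n) (sh n + adj (sh n))" for n
  proof -
    have "sh n * sh n = 0" "adj (sh n) * adj (sh n) = 0"
      by (metis mult.assoc mult_zero_right sh_simps(3,4), metis mult.assoc mult_zero_left sh_simps(5,6) mult_zero_right)
    moreover have "sz (sh n + adj (sh n)) (2 * n)" by (intro sz_add sz_adj sz_sh)
    ultimately show ?thesis unfolding unitary_def by (simp add: algebra_simps sh_simps)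
  qed
  have unA: "un d * A s = A s" "A s * un d = A s" for s using A by (simp_all add: un_mult_sz mult_un_sz)
  have ex_n: "\<exists>n\<ge>1. \<forall>s. sz (Y s) n" for Y :: "'g \<Rightarrow> fmat"
  proof -
    obtain n where "\<forall>s\<in>UNIV. sz (Y s) n" using sz_common[of UNIV Y] by auto
    then show ?thesis by (intro exI[of _ "Suc n"]) (auto intro: sz_mono)
  qed
  show "dset A \<subseteq> dset (\<lambda>s. A s * adj (sh d))"
  proof
    fix Y assume Y: "Y \<in> dset A"
    obtain n where n: "1 \<le> n" "\<And>s. sz (Y s) n" using ex_n by blast
    have unY: "un n * Y s = Y s" "Y s * un n = Y s" for s using n by (simp_all add: un_mult_sz mult_un_sz)
    define K where "K = sh n"
    have YK: "Y s * K = 0" "adj K * Y s = 0" for s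
      unfolding K_def by (metis mult.assoc mult_zero_right sh_simps(3) unY(2), metis mult.assoc mult_zero_left sh_simps(5) unY(1))
    have "(\<lambda>s. Y s * (K + adj K)) \<in> dset A"
      unfolding K_def using n by (intro fc[of "2 * n"] swap Y) (auto intro: sz_mono[OF n(2)])
    then have YK': "(\<lambda>s. Y s * adj K) \<in> dset A" by (simp add: distrib_left YK)
    show "Y \<in> dset (\<lambda>s. A s * adj (sh d))" unfolding dset_def
    proof (intro CollectI allI)
      fix V0
      define V where "V = V0 * un n"
      have V: "V * un n = V" by (simp add: V_def mult.assoc)
      have VK: "V * K = 0" "adj K * adj V = 0"
        unfolding K_def by (metis V mult.assoc mult_zero_right sh_simps(3),
          metis V mult.assoc mult_zero_right sh_simps(3) adj_mult adj_simps(2))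
      \<comment> \<open>V consists of two stacked halves; W sets them side by side, the lower half
        first. So the norm of W is that of both halves, and the form of A at the moved point is the
        form of the doubled tuple at Y.\<close>
      define W where "W = adj (sh d) * V + un d * V * adj K"
      have WY: "W * Y s = adj (sh d) * V * Y s" for s
        by (simp add: W_def distrib_right mult.assoc YK)
      have WK: "W * K = un d * V" using VK V
        by (simp add: W_def distrib_right mult.assoc) (simp add: K_def sh_simps V)
      have "tr (adj W * A s * W * (Y s * adj K)) = tr (adj V0 * (A s * adj (sh d)) * V0 * Y s)" for s
      proof -
        have "tr (adj W * A s * W * (Y s * adj K)) = tr (adj K * adj W * A s * (W * Y s))"
          using tr_commute[of "adj W * A s * W * Y s" "adj K"] by (simp add: mult.assoc)
        also have "adj K * adj W = adj V * un d" using arg_cong[OF WK, of adj] by simp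
        also have "adj V * un d * A s * (W * Y s) = un n * adj V0 * (A s * adj (sh d)) * V0 * Y s"
          unfolding WY by (simp add: V_def mult.assoc) (simp add: unA unY mult.assoc[symmetric])
        also have "tr \<dots> = tr (adj V0 * (A s * adj (sh d)) * V0 * Y s * un n)"
          using tr_commute[of "un n" "adj V0 * (A s * adj (sh d)) * V0 * Y s"] by (simp add: mult.assoc)
        finally show ?thesis by (simp add: mult.assoc unY)
      qed
      then have "2 * Re (\<Sum>s\<in>UNIV. tr (adj V0 * (A s * adj (sh d)) * V0 * Y s)) \<le> nrm W"
        using dsetD[OF YK', of W] by simp
      also have "nrm W = nrm (adj (sh d) * V) + nrm (un d * V * adj K)"
      proof -
        have "tr (adj (adj (sh d) * V) * (un d * V * adj K)) = tr (adj K * adj V * sh d * (un d * V))"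
          using tr_commute[of "adj V * sh d * un d * V" "adj K"] by (simp add: mult.assoc)
        also have "\<dots> = 0" by (simp add: VK)
        finally show ?thesis unfolding W_def nrm_add by simp
      qed
      also have "nrm (un d * V * adj K) = nrm (un d * V)"
      proof -
        have "nrm (un d * V * adj K) = nrm (K * (adj V * un d))"
          using nrm_adj[of "un d * V * adj K"] by (simp add: mult.assoc)
        also have "\<dots> = nrm (un n * adj V * un d)"
          by (simp add: nrm_def K_def mult.assoc sh_simps_assoc)
        also have "un n * adj V = adj V" using arg_cong[OF V, of adj] by simp
        finally show ?thesis using nrm_adj[of "un d * V"] by simp
      qed
      also have "nrm (adj (sh d) * V) + nrm (un d * V) = nrm (un (2 * d) * V)"
      proof -
        have r: "nrm (Z * V) = Re (tr (adj V * (adj Z * Z) * V))" for Z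
          by (simp add: nrm_def mult.assoc)
        show ?thesis unfolding r by (simp add: sh_simps algebra_simps)
      qed
      also have "\<dots> \<le> nrm V0"
        unfolding V_def mult.assoc[symmetric] by (rule nrm_un_mult_un_le)
      finally show "2 * Re (\<Sum>s\<in>UNIV. tr (adj V0 * (A s * adj (sh d)) * V0 * Y s)) \<le> nrm V0" .
    qed
  qed
  show "dset (\<lambda>s. A s * adj (sh d)) \<subseteq> dset A"
  proof
    fix Y assume Y: "Y \<in> dset (\<lambda>s. A s * adj (sh d))"
    obtain n where n: "1 \<le> n" "\<And>s. sz (Y s) n" using ex_n by blast
    have unY: "un n * Y s = Y s" "Y s * un n = Y s" for s using n by (simp_all add: un_mult_sz mult_un_sz)
    define K where "K = sh n"
    have "(\<lambda>s. Y s * adj K) \<in> dset A" unfolding dset_def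
    proof (intro CollectI allI)
      fix W
      \<comment> \<open>The inverse rearrangement: the two column blocks of W are stacked, the right
        one on top.\<close>
      define V where "V = un d * W * K + sh d * W * un n"
      have JV: "adj (sh d) * V = un d * W * un n"
        by (simp add: V_def distrib_left mult.assoc sh_simps_assoc)
      have VA: "adj V * A s = adj K * adj W * A s" for s
      proof -
        have "adj (sh d) * A s = 0" by (metis mult.assoc mult_zero_left sh_simps(5) unA(1))
        then show ?thesis by (simp add: V_def distrib_right mult.assoc unA)
      qed
      have "tr (adj V * (A s * adj (sh d)) * V * Y s) = tr (adj W * A s * W * (Y s * adj K))" for s
      proof -
        have "adj V * (A s * adj (sh d)) * V * Y s = adj V * A s * (adj (sh d) * V) * Y s"
          by (simp add: mult.assoc)
        also have "\<dots> = adj K * (adj W * A s * W * Y s)"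
          unfolding VA JV by (simp add: mult.assoc unY) (simp add: mult.assoc[symmetric] unA)
        also have "tr \<dots> = tr (adj W * A s * W * Y s * adj K)" by (rule tr_commute)
        finally show ?thesis by (simp add: mult.assoc)
      qed
      then have "2 * Re (\<Sum>s\<in>UNIV. tr (adj W * A s * W * (Y s * adj K))) \<le> nrm V"
        using dsetD[OF Y, of V] by simp
      also have "nrm V = nrm (un d * W * K) + nrm (sh d * W * un n)"
        unfolding V_def nrm_add by (simp add: mult.assoc sh_simps_assoc)
      also have "nrm (sh d * W * un n) = nrm (un d * W * un n)"
        by (simp add: nrm_def mult.assoc sh_simps_assoc)
      also have "nrm (un d * W * K) + nrm (un d * W * un n) = nrm (un d * W * un (2 * n))"
      proof -
        have r: "nrm (un d * W * X) = Re (tr (adj W * un d * W * (X * adj X)))" for X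
          by (simp add: nrm_def mult.assoc tr_commute[of "adj X"])
        show ?thesis unfolding r
          by (simp add: K_def sh_simps algebra_simps)
      qed
      also have "\<dots> \<le> nrm W" by (rule nrm_un_mult_un_le)
      finally show "2 * Re (\<Sum>s\<in>UNIV. tr (adj W * A s * W * (Y s * adj K))) \<le> nrm W" .
    qed
    moreover have "sz (Y s * adj K) (2 * n)" for s
      using sz_mono[OF n(2), of "2 * n"] by (simp add: K_def sz_mult sz_adj sz_sh)
    \<comment> \<open>Another flip brings the corner block back to the place of Y.\<close>
    ultimately have "(\<lambda>s. Y s * adj K * (K + adj K)) \<in> dset A"
      using n(1) swap[of n] unfolding K_def
      by (intro fc[of "2 * n" "sh n + adj (sh n)" "\<lambda>s. Y s * adj (sh n)"]) auto
    moreover have "Y s * adj K * (K + adj K) = Y s" for s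
    proof -
      have "adj K * adj K = 0" unfolding K_def
        by (metis mult.assoc mult_zero_left sh_simps(5,6))
      then show ?thesis by (simp add: distrib_left mult.assoc) (simp add: K_def sh_simps unY)
    qed
    ultimately show "Y \<in> dset A" by simp
  qed
qed

text \<open>Each intertwiner W k carries the product of A i and A j to that of F i and F j, which
  vanishes because all F s map into the first half and are zero on it. The W k are jointly
  injective.\<close>

lemma free_circular_products_zero:
  fixes A :: "'g::finite \<Rightarrow> fmat"
  assumes A: "\<And>s. sz (A s) d" and tight: "tight (un d) A"
    and fc: "\<And>n U Y. 1 \<le> n \<Longrightarrow> unitary n U \<Longrightarrow> Y \<in> dset A \<Longrightarrow> (\<And>s. sz (Y s) n) \<Longrightarrow> (\<lambda>s. Y s * U) \<in> dset A"
  shows "A i * A j = 0"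
proof -
  define F where "F s = A s * adj (sh d)" for s
  have szF: "sz (F s) (2 * d)" for s
    unfolding F_def by (intro sz_mult sz_adj sz_sh sz_mono[OF A]) auto
  have eq: "dset F = dset A" unfolding F_def by (rule free_circular_dset[OF A fc])
  obtain N W where W: "\<And>s k. k < (N::nat) \<Longrightarrow> F s * W k = W k * A s"
    "(\<Sum>k<N. adj (W k) * W k) = un d"
  proof (rule tight_intertwiners[OF A tight szF eq])
    fix N :: nat and W
    assume "\<And>s k. k < N \<Longrightarrow> F s * W k = W k * A s" "(\<Sum>k<N. adj (W k) * W k) = un d"
    then show thesis by (rule that)
  qed
  have "adj (sh d) * A j = 0"
    by (metis A mult.assoc mult_zero_left sh_simps(5) un_mult_sz)
  then have FF: "F i * F j = 0" by (simp add: F_def mult.assoc) (simp add: mult.assoc[symmetric])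
  have "W k * (A i * A j) = 0" if "k < N" for k
  proof -
    have "W k * (A i * A j) = F i * F j * W k"
      using W(1)[OF that] by (metis mult.assoc)
    then show ?thesis by (simp add: FF)
  qed
  then have "(\<Sum>k<N. adj (W k) * W k) * (A i * A j) = 0"
    by (simp add: sum_distrib_right mult.assoc)
  then show ?thesis unfolding W(2) by (simp add: mult.assoc[symmetric] un_mult_sz[OF A])
qed

section \<open>A unitary intertwiner\<close>

text \<open>Commutation with A and its adjoints up to the phase w. Such spaces multiply with the
  phases, and w = 1 is the commutant of A.\<close>

definition intertw :: "nat \<Rightarrow> ('g \<Rightarrow> fmat) \<Rightarrow> complex \<Rightarrow> fmat \<Rightarrow> bool" where
  "intertw d A w X \<longleftrightarrow> sz X d \<and>
    (\<forall>s. X * A s = smul w (A s * X) \<and> X * adj (A s) = smul (cnj w) (adj (A s) * X))"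

lemma intertw_mult:
  assumes "intertw d A w X" "intertw d A v Y" shows "intertw d A (w * v) (X * Y)"
proof -
  have "X * Y * A s = smul (w * v) (A s * (X * Y))"
    "X * Y * adj (A s) = smul (cnj (w * v)) (adj (A s) * (X * Y))" for s
  proof -
    have X: "X * A s = smul w (A s * X)" "X * adj (A s) = smul (cnj w) (adj (A s) * X)"
      using assms(1) by (simp_all add: intertw_def)
    have "X * Y * A s = smul v (X * A s * Y)" "X * Y * adj (A s) = smul (cnj v) (X * adj (A s) * Y)"
      using assms(2) by (simp_all add: intertw_def mult.assoc)
    then show "X * Y * A s = smul (w * v) (A s * (X * Y))"
      "X * Y * adj (A s) = smul (cnj (w * v)) (adj (A s) * (X * Y))"
      unfolding X by (simp_all add: mult.assoc mult.commute)
  qed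
  then show ?thesis using assms by (simp add: intertw_def sz_mult)
qed

lemma intertw_adj:
  assumes "intertw d A w X" "cmod w = 1" shows "intertw d A (cnj w) (adj X)"
proof -
  have w: "cnj w * w = 1" using assms(2) complex_norm_square[of w] by (simp add: mult.commute)
  have "adj X * A s = smul (cnj w) (A s * adj X)" "adj X * adj (A s) = smul w (adj (A s) * adj X)" for s
  proof -
    have X: "X * A s = smul w (A s * X)" "X * adj (A s) = smul (cnj w) (adj (A s) * X)"
      using assms(1) by (auto simp: intertw_def)
    have "A s * adj X = smul w (adj X * A s)" "adj (A s) * adj X = smul (cnj w) (adj X * adj (A s))"
      using arg_cong[OF X(2), of adj] arg_cong[OF X(1), of adj] by simp_all
    then show "adj X * A s = smul (cnj w) (A s * adj X)"
      "adj X * adj (A s) = smul w (adj (A s) * adj X)"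
      using w by (simp_all add: mult.commute)
  qed
  then show ?thesis using assms(1) by (simp add: intertw_def sz_adj)
qed

lemma intertw_add: "intertw d A w X \<Longrightarrow> intertw d A w Y \<Longrightarrow> intertw d A w (X + Y)"
  by (simp add: intertw_def sz_add distrib_left distrib_right smul_distribs)

lemma intertw_diff: "intertw d A w X \<Longrightarrow> intertw d A w Y \<Longrightarrow> intertw d A w (X - Y)"
  by (simp add: intertw_def sz_diff left_diff_distrib right_diff_distrib smul_distribs)

lemma intertw_smul: "intertw d A w X \<Longrightarrow> intertw d A w (smul c X)"
  by (simp add: intertw_def sz_smul mult.commute)

lemma intertw_un: "(\<And>s. sz (A s) d) \<Longrightarrow> intertw d A 1 (un d)"
  by (simp add: intertw_def un_mult_sz mult_un_sz sz_adj)

text \<open>A partial isometry contained in the polar decomposition of an intertwiner.\<close>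

lemma partial_isometry_exists:
  assumes A: "\<And>s. sz (A s) d" and Y: "intertw d A w Y" "Y \<noteq> 0" and w: "cmod w = 1"
  obtains V P c where "intertw d A w V" "adj V * V = P" "proj P" "P \<noteq> 0" "intertw d A 1 P"
    "V = smul c (Y * P)" "\<And>Q. proj Q \<Longrightarrow> Y * Q = Y \<Longrightarrow> Q * P = P"
proof -
  \<comment> \<open>The phases w and cnj w cancel in S, so S and its spectral projections lie in the
    commutant of A. Dividing Y * P by the root of the eigenvalue makes it isometric on P.\<close>
  define S where "S = adj Y * Y"
  have S1: "intertw d A 1 S"
    using intertw_mult[OF intertw_adj[OF Y(1) w] Y(1)] w complex_norm_square[of w]
    by (simp add: S_def mult.commute)
  have S: "sz S d" "adj S = S" using S1 by (simp_all add: intertw_def S_def)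
  have "S \<noteq> 0"
  proof
    assume "S = 0"
    then have "nrm Y = 0" by (simp add: nrm_def S_def)
    then show False using Y(2) by simp
  qed
  then obtain r P where P: "r \<noteq> 0" "sz P d" "proj P" "P \<noteq> 0" "S * P = smul (complex_of_real r) P"
    "\<And>M. sz M d \<Longrightarrow> M * S = S * M \<Longrightarrow> M * P = P * M"
    using spectral_projection[OF S] by blast
  have PP: "adj P = P" "P * P = P" using P(3) by (auto simp: proj_def)
  have PSP: "P * (S * P) = smul (of_real r) P" by (simp add: P(5) PP)
  have "r * nrm P = nrm (Y * P)"
  proof -
    have "nrm (Y * P) = Re (tr (P * (S * P)))" by (simp add: nrm_def S_def PP mult.assoc)
    also have "\<dots> = r * nrm P" unfolding PSP by (simp add: nrm_def PP)
    finally show ?thesis ..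
  qed
  then have "0 \<le> r * nrm P" by simp
  then have r: "0 < r" using P(1) nrm_pos[OF P(4)] by (simp add: zero_le_mult_iff)
  have P1: "intertw d A 1 P"
  proof -
    have "A s * P = P * A s" "adj (A s) * P = P * adj (A s)" for s
      using P(6)[OF A[of s]] P(6)[OF sz_adj[OF A[of s]]] S1 by (simp_all add: intertw_def)
    then show ?thesis using P(2) by (simp add: intertw_def)
  qed
  define V where "V = smul (1 / sqrt r) (Y * P)"
  have "intertw d A w V"
    using intertw_smul[OF intertw_mult[OF Y(1) P1]] by (simp add: V_def)
  moreover have "adj V * V = P"
  proof -
    have "complex_of_real (sqrt r) * complex_of_real (sqrt r) = of_real r"
      using r by (simp flip: of_real_mult)
    then have "adj V * V = smul (1 / of_real r) (P * (S * P))"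
      by (simp add: V_def S_def PP mult.assoc)
    then show ?thesis unfolding PSP using r by simp
  qed
  moreover have "Q * P = P" if "proj Q" "Y * Q = Y" for Q
  proof -
    have "Q * S = S" using arg_cong[OF that(2), of adj] that(1)
      by (simp add: S_def proj_def mult.assoc[symmetric])
    then have "Q * (S * P) = S * P" by (simp add: mult.assoc[symmetric])
    then show ?thesis using P(1) unfolding P(5) by (auto dest: smul_cancel[rotated])
  qed
  ultimately show ?thesis using that[of V P "1 / sqrt r"] P P1 by (simp add: V_def)
qed

text \<open>Tightness excludes two equivalent orthogonal summands: the corner of a commuting partial
  isometry between orthogonal ranges could be cut off without changing the domain.\<close>

lemma tight_no_duplicates:
  fixes A :: "'g::finite \<Rightarrow> fmat"
  assumes A: "\<And>s. sz (A s) d" and tight: "tight (un d) A"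
    and V: "intertw d A 1 V" "adj V * V = P" "proj P" "P \<noteq> 0" "intertw d A 1 P" "P * V = 0"
  shows False
proof -
  define q where "q = un d - P"
  have P: "sz P d" "adj P = P" "P * P = P" "un d * P = P" "P * un d = P"
    using V(3,5) by (auto simp: intertw_def proj_def un_mult_sz mult_un_sz)
  have szV: "sz V d" using V(1) by (simp add: intertw_def)
  have q: "proj q" "un d * q = q"
    using P by (simp_all add: proj_def q_def algebra_simps)
  have qV: "q * V = V" using V(6) un_mult_sz[OF szV] by (simp add: q_def left_diff_distrib)
  have AV: "V * A s = A s * V" "P * A s = A s * P" for s using V(1,5) by (simp_all add: intertw_def)
  have qq: "adj q = q" "q * q = q" "q * A s = A s * q" for s
    using q un_mult_sz[OF A] mult_un_sz[OF A] AV
    by (simp_all add: proj_def q_def left_diff_distrib right_diff_distrib)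
  have "q = un d"
  proof (rule tight_no_square[OF tight q])
    fix X Y assume Y: "Y \<in> dset (\<lambda>s. q * A s * q)"
    \<comment> \<open>The part of the form on P, lost in the compression to q, is recovered from its
      copy V * X inside q. The norms of q * X and V * X add up to at most
      \<open>nrm X\<close>.\<close>
    have split: "adj X * A s * X = adj (q * X) * (q * A s * q) * (q * X) + adj (V * X) * (q * A s * q) * (V * X)" for s
    proof -
      have 1: "adj (q * X) * (q * A s * q) * (q * X) = adj X * (q * A s) * X"
        using qq by (simp add: mult.assoc) (metis mult.assoc)
      have "adj V * (q * A s * q) * V = adj V * A s * V"
      proof -
        have "adj V * q = adj V" using arg_cong[OF qV, of adj] qq by simp
        then show ?thesis using qV by (metis mult.assoc)
      qed
      also have "\<dots> = P * A s" using V(2) AV by (metis mult.assoc)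
      finally have 2: "adj (V * X) * (q * A s * q) * (V * X) = adj X * (P * A s) * X"
        by (simp add: mult.assoc) (metis mult.assoc)
      show ?thesis unfolding 1 2 using un_mult_sz[OF A, of s]
        by (simp add: q_def algebra_simps)
    qed
    have "2 * Re (\<Sum>s\<in>UNIV. tr (adj X * A s * X * Y s))
        = 2 * Re (\<Sum>s\<in>UNIV. tr (adj (q * X) * (q * A s * q) * (q * X) * Y s))
        + 2 * Re (\<Sum>s\<in>UNIV. tr (adj (V * X) * (q * A s * q) * (V * X) * Y s))"
      unfolding split by (simp only: distrib_right tr_linear sum.distrib plus_complex.simps distrib_left)
    also have "\<dots> \<le> nrm (q * X) + nrm (V * X)"
      by (intro add_mono dsetD[OF Y])
    also have "nrm (V * X) = nrm (P * X)"
      using V(2) P by (simp add: nrm_def mult.assoc) (metis mult.assoc)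
    also have "nrm (q * X) + nrm (P * X) = nrm (un d * X)"
    proof -
      have "q * P = 0" using P by (simp add: q_def left_diff_distrib)
      moreover have "adj (q * X) * (P * X) = adj X * (q * P) * X" by (simp add: qq mult.assoc)
      ultimately have "adj (q * X) * (P * X) = 0" by simp
      then show ?thesis using nrm_add[of "q * X" "P * X"] by (simp add: q_def left_diff_distrib)
    qed
    also have "\<dots> \<le> nrm X" by (rule nrm_proj_mult_le) simp
    finally show "2 * Re (\<Sum>s\<in>UNIV. tr (adj X * A s * X * Y s)) \<le> nrm X" .
  qed
  then show False using V(4) by (simp add: q_def)
qed

text \<open>The W k need not be unitary. Among partial isometries that intertwine A with phase w,
  one of almost maximal rank is shown to be isometric, hence unitary: the W k would otherwise
  provide an extension or two equivalent summands of A.\<close>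

lemma unitary_intertwiner:
  fixes A :: "'g::finite \<Rightarrow> fmat"
  assumes A: "\<And>s. sz (A s) d" and tight: "tight (un d) A" and w: "cmod w = 1"
    and eq: "dset (\<lambda>s. smul w (A s)) = dset A"
  obtains U where "unitary d U" "\<And>s. U * A s = smul w (A s * U)"
proof -
  have ww: "cnj w * w = 1" "w * cnj w = 1" using w complex_norm_square[of w] by (simp_all add: mult.commute)
  obtain N W where W: "\<And>k. k < (N::nat) \<Longrightarrow> intertw d A w (W k)" "(\<Sum>k<N. adj (W k) * W k) = un d"
  proof (rule tight_intertwiners[OF A tight sz_smul[OF A] eq])
    fix N :: nat and W
    assume W: "\<And>s k. k < N \<Longrightarrow> smul w (A s) * W k = W k * A s"
      "\<And>s k. k < N \<Longrightarrow> adj (smul w (A s)) * W k = W k * adj (A s)"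
      "(\<Sum>k<N. adj (W k) * W k) = un d" "\<And>k. W k * un d = W k" "\<And>k. un d * W k = W k"
    have "intertw d A w (W k)" if "k < N" for k
      unfolding intertw_def sz_iff using W(1,2)[OF that] W(4,5) by simp
    then show thesis using W(3) by (rule that)
  qed
  define Rs where "Rs = {R. intertw d A w R \<and> proj (adj R * R)}"
  have nrm_R: "nrm R \<le> d" if "R \<in> Rs" for R
  proof -
    have p: "proj (adj R * R)" "sz (adj R * R) d"
      using that by (auto simp: Rs_def intertw_def sz_mult sz_adj)
    then have "nrm (adj R * R) \<le> nrm (un d)"
      using nrm_proj_mult_le[OF p(1), of "un d"] by (simp add: mult_un_sz)
    then show ?thesis using p(1) by (simp add: nrm_proj) (simp add: nrm_def tr_un)
  qed
  have "intertw d A w 0" by (simp add: intertw_def)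
  then have "0 \<in> Rs" by (simp add: Rs_def proj_def)
  obtain R where R: "R \<in> Rs" "\<And>R'. R' \<in> Rs \<Longrightarrow> nrm R' \<le> nrm R + 1/2"
  proof (rule ex_almost_minimal[OF \<open>0 \<in> Rs\<close>, of "- real d" "\<lambda>R. - nrm R"])
    show "- real d \<le> - nrm y" if "y \<in> Rs" for y using nrm_R[OF that] by simp
  next
    fix z assume z: "z \<in> Rs" "\<And>y. y \<in> Rs \<Longrightarrow> - nrm z \<le> - nrm y + 1/2"
    have "nrm y \<le> nrm z + 1/2" if "y \<in> Rs" for y using z(2)[OF that] by simp
    with z(1) show thesis by (rule that)
  qed
  have iR: "intertw d A w R" and pR: "proj (adj R * R)" using R(1) by (auto simp: Rs_def)
  have szR: "sz R d" using iR by (simp add: intertw_def)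
  have unR: "un d * R = R" "R * un d = R" "un d * adj R = adj R" "adj R * un d = adj R"
    using szR by (simp_all add: un_mult_sz mult_un_sz sz_adj)
  have RRR: "R * (adj R * R) = R"
  proof -
    have "nrm (R - R * (adj R * R)) = 0"
      using pR by (simp add: nrm_def proj_def algebra_simps)
    then show ?thesis by simp
  qed
  have RRR': "adj R * (R * adj R) = adj R" using arg_cong[OF RRR, of adj] by (simp add: mult.assoc)
  have RRRX: "R * (adj R * (R * X)) = R * X" "adj R * (R * (adj R * X)) = adj R * X" for X
    using arg_cong[OF RRR, of "\<lambda>Z. Z * X"] arg_cong[OF RRR', of "\<lambda>Z. Z * X"]
    by (simp_all add: mult.assoc)
  have unRX: "un d * (adj R * X) = adj R * X" "un d * (R * X) = R * X" for X
    using unR by (simp_all add: mult.assoc[symmetric])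
  define P0 where "P0 = un d - adj R * R"
  define Q0 where "Q0 = un d - R * adj R"
  have P0: "proj P0" "un d * P0 = P0" "P0 * un d = P0" "P0 * adj R = 0" "R * P0 = 0" "adj R * R * P0 = 0"
    using unR pR RRR' RRR RRRX unRX by (simp_all add: P0_def proj_def algebra_simps)
  have Q0: "proj Q0" "adj R * Q0 = 0" "Q0 * R = 0"
    using unR RRR' RRR RRRX unRX by (simp_all add: Q0_def proj_def algebra_simps)
  have iadj: "intertw d A (cnj w) (adj R)" by (rule intertw_adj[OF iR w])
  have iRR: "intertw d A 1 (adj R * R)" "intertw d A 1 (R * adj R)"
    using intertw_mult[OF iadj iR] intertw_mult[OF iR iadj] ww by simp_all
  have iP0: "intertw d A 1 P0" and iQ0: "intertw d A 1 Q0"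
    unfolding P0_def Q0_def by (intro intertw_diff intertw_un A iRR)+
  have "P0 = 0"
  proof (rule ccontr)
    assume "P0 \<noteq> 0"
    have "\<exists>k<N. W k * P0 \<noteq> 0"
    proof (rule ccontr)
      assume "\<not> ?thesis"
      then have "(\<Sum>k<N. adj (W k) * W k) * P0 = 0" by (simp add: sum_distrib_right mult.assoc)
      then show False using \<open>P0 \<noteq> 0\<close> P0(2) by (simp add: W(2))
    qed
    then obtain k where k: "k < N" "W k * P0 \<noteq> 0" by blast
    have iY0: "intertw d A w (W k * P0)" using intertw_mult[OF W(1)[OF k(1)] iP0] by simp
    show False
    \<comment> \<open>If W k * P0 leaves the range of R, the partial isometry extracted there is
      orthogonal to R on both sides, and adding it raises the rank by at least 1. Otherwise adj R *
      (W k * P0) is a nonzero element of the commutant leading from P0 into its complement, which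
      \<open>tight_no_duplicates\<close> excludes.\<close>
    proof (cases "Q0 * (W k * P0) = 0")
      case False
      have iY: "intertw d A w (Q0 * (W k * P0))" using intertw_mult[OF iQ0 iY0] by simp
      obtain V P c where V: "intertw d A w V" "adj V * V = P" "proj P" "P \<noteq> 0"
        "V = smul c (Q0 * (W k * P0) * P)" "\<And>Q. proj Q \<Longrightarrow> Q0 * (W k * P0) * Q = Q0 * (W k * P0) \<Longrightarrow> Q * P = P"
        by (rule partial_isometry_exists[OF A iY False w]) (rule that; assumption)
      have P0P: "P0 * P = P" using P0(1) by (intro V(6)) (simp_all add: proj_def mult.assoc)
      have RV: "adj R * V = 0" using Q0(2) by (simp add: V(5)) (simp add: mult.assoc[symmetric])
      then have VR: "adj V * R = 0" by (metis RV adj_mult adj_simps(1,2))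
      have RRP: "adj R * R * P = 0" using P0(6) by (metis P0P mult.assoc mult_zero_left)
      then have PRR: "P * (adj R * R) = 0"
        using V(3) by (metis RRP adj_mult adj_simps(1,2) proj_def)
      have sum: "adj (R + V) * (R + V) = adj R * R + P"
        using RV VR V(2) by (simp add: algebra_simps)
      have "proj (adj (R + V) * (R + V))"
        unfolding sum using pR V(3) RRP PRR by (simp add: proj_def algebra_simps)
      then have "R + V \<in> Rs" using intertw_add[OF iR V(1)] by (simp add: Rs_def)
      then have "nrm (R + V) \<le> nrm R + 1/2" by (rule R(2))
      moreover have "nrm (R + V) = nrm R + nrm P"
        unfolding nrm_proj[OF V(3)] using sum by (simp add: nrm_def)
      ultimately show False using one_le_nrm_proj[OF V(3,4)] by simp
    next
      case True
      have iY: "intertw d A 1 (adj R * (W k * P0))" using intertw_mult[OF iadj iY0] ww by simp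
      have nz: "adj R * (W k * P0) \<noteq> 0"
      proof
        assume "adj R * (W k * P0) = 0"
        then have "R * adj R * (W k * P0) = 0" by (simp add: mult.assoc)
        then have "un d * (W k * P0) = 0" using True by (simp add: Q0_def left_diff_distrib)
        moreover have "un d * (W k * P0) = W k * P0"
          using iY0 un_mult_sz by (simp add: intertw_def)
        ultimately show False using k(2) by simp
      qed
      obtain V P c where V: "intertw d A 1 V" "adj V * V = P" "proj P" "P \<noteq> 0" "intertw d A 1 P"
        "V = smul c (adj R * (W k * P0) * P)"
        "\<And>Q. proj Q \<Longrightarrow> adj R * (W k * P0) * Q = adj R * (W k * P0) \<Longrightarrow> Q * P = P"
        by (rule partial_isometry_exists[OF A iY nz norm_one]) (rule that; assumption)
      have P0P: "P0 * P = P" using P0(1) by (intro V(7)) (simp_all add: proj_def mult.assoc)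
      then have PP0: "P * P0 = P" using P0(1) V(3) by (metis adj_mult proj_def)
      have "P0 * V = 0" using P0(4) by (simp add: V(6)) (simp add: mult.assoc[symmetric])
      then have "P * V = 0" by (metis PP0 mult.assoc mult_zero_right)
      then show False using tight_no_duplicates[OF A tight V(1-5)] by blast
    qed
  qed
  then have RR: "adj R * R = un d" by (simp add: P0_def)
  \<comment> \<open>adj R * R and R * adj R have the same trace, so within size d an isometry is
    onto.\<close>
  have "Q0 = 0"
  proof -
    have "nrm Q0 = Re (tr (un d)) - Re (tr (R * adj R))"
      unfolding nrm_proj[OF Q0(1)] by (simp add: Q0_def)
    also have "\<dots> = 0" using RR by (simp add: tr_commute[of R])
    finally show ?thesis by simp
  qed
  then have "unitary d R" using RR szR by (simp add: unitary_def Q0_def)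
  then show ?thesis using that iR by (auto simp: intertw_def)
qed

section \<open>From matrix tuples to finitely supported matrices\<close>

lemma sum_div_mod:
  fixes f :: "nat \<Rightarrow> 'a::comm_monoid_add"
  assumes "0 < n" shows "(\<Sum>i<d * n. f i) = (\<Sum>a<d. \<Sum>k<n. f (a * n + k))"
proof -
  have "(\<Sum>i<d * n. f i) = (\<Sum>(a, k)\<in>{..<d} \<times> {..<n}. f (a * n + k))"
  proof (rule sum.reindex_bij_witness[of _ "\<lambda>(a, k). a * n + k" "\<lambda>i. (i div n, i mod n)"])
    fix i assume "i \<in> {..<d * n}"
    then show "(i div n, i mod n) \<in> {..<d} \<times> {..<n}"
      using assms by (simp add: less_mult_imp_div_less)
  next
    fix p assume "p \<in> {..<d} \<times> {..<n}"
    then obtain a k where p: "p = (a, k)" "a < d" "k < n" by auto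
    have "a * n + k < Suc a * n" using p by simp
    also have "\<dots> \<le> d * n" using p by (intro mult_le_mono1) simp
    finally show "(case p of (a, k) \<Rightarrow> a * n + k) \<in> {..<d * n}" using p by simp
  qed (use assms in auto)
  then show ?thesis by (simp add: sum.cartesian_product)
qed

definition trn :: "fmat \<Rightarrow> fmat" where
  "trn M = Fmat (\<lambda>i j. ent M j i)"

lemma ent_trn [simp]: "ent (trn M) i j = ent M j i"
proof -
  obtain n where "sz M n" using sz_ex by blast
  then show ?thesis unfolding trn_def by (subst ent_Fmat[of n]) (auto simp: sz_def)
qed

lemma trn_simps [simp]: "trn (trn M) = M" "trn (un n) = un n" "trn (smul c M) = smul c (trn M)"
  "trn (adj M) = adj (trn M)"
  by (rule fmat_eqI; auto)+

lemma trn_mult: "trn (M * N) = trn N * trn M"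
proof (rule fmat_eqI)
  fix i k
  obtain n where n: "\<forall>X\<in>{M, N}. sz X n" using sz_common[of "{M, N}" id] by auto
  then have "sz (trn N) n" by (simp add: sz_def)
  then show "ent (trn (M * N)) i k = ent (trn N * trn M) i k"
    using n by (simp add: ent_times_sz[of M n] ent_times_sz[of "trn N" n] mult.commute)
qed

lemma sz_trn: "sz (trn M) n \<longleftrightarrow> sz M n" by (auto simp: sz_def)

lemma unitary_trn: "unitary n U \<Longrightarrow> unitary n (trn U)"
  unfolding unitary_def by (metis sz_trn trn_mult trn_simps(2,4))

lemma fm_smult: "fm (c \<cdot>\<^sub>m M) = smul c (fm M)"
  by (rule fmat_eqI) auto

definition fmt :: "('g \<Rightarrow> complex mat) \<Rightarrow> 'g \<Rightarrow> fmat" where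
  "fmt A s = fm (A s)"

lemma sz_fmt: "A \<in> tuples d \<Longrightarrow> sz (fmt A s) d"
  by (simp add: tuples_def fmt_def sz_fm)

lemma pencil_carrier: "A \<in> tuples d \<Longrightarrow> X \<in> tuples n \<Longrightarrow> pencil d n A X \<in> carrier_mat (d * n) (d * n)"
  by (intro carrier_matI) (simp_all add: pencil_def kronecker_def sum_of_mats_def)

lemma pencil_index:
  fixes A X :: "('g::finite) mat_tuple"
  assumes A: "A \<in> tuples d" and X: "X \<in> tuples n" and n: "0 < n" and ij: "i < d * n" "j < d * n"
  shows "pencil d n A X $$ (i, j) =
    (if i div n = j div n \<and> i mod n = j mod n then 1 else 0)
    - (\<Sum>s\<in>UNIV. ent (fmt A s) (i div n) (j div n) * ent (fmt X s) (i mod n) (j mod n))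
    - (\<Sum>s\<in>UNIV. cnj (ent (fmt A s) (j div n) (i div n)) * cnj (ent (fmt X s) (j mod n) (i mod n)))"
proof -
  have dims: "dim_row (A s) = d" "dim_col (A s) = d" "dim_row (X s) = n" "dim_col (X s) = n" for s
    using A X by (auto simp: tuples_def)
  have b: "i div n < d" "j div n < d" "i mod n < n" "j mod n < n"
    using n ij by (simp_all add: less_mult_imp_div_less)
  show ?thesis using ij b n
    by (simp add: pencil_def kronecker_def sum_of_mats_def dims mat_adjoint_index fmt_def
        conjugate_complex_def)
qed

text \<open>Reshaping a vector v of length d * n into a d x n matrix V turns the form of the
  Kronecker product of A s and X s into the trace of adj V * A s * V times the transpose of X
  s.\<close>

lemma mem_free_spectrahedron:
  fixes A X :: "('g::finite) mat_tuple"
  assumes A: "A \<in> tuples d" and X: "X \<in> tuples n" and n: "0 < n"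
  shows "X \<in> free_spectrahedron d A n \<longleftrightarrow> (\<lambda>s. trn (fmt X s)) \<in> dset (fmt A)"
proof -
  define P where "P = pencil d n A X"
  have P: "P \<in> carrier_mat (d * n) (d * n)" using pencil_carrier[OF A X] by (simp add: P_def)
  have szA: "sz (fmt A s) d" and szX: "sz (fmt X s) n" "sz (trn (fmt X s)) n" for s
    using A X by (simp_all add: sz_fmt sz_trn)
  have herm: "mat_adjoint P = P"
  proof (rule eq_matI)
    fix i j assume ij: "i < dim_row P" "j < dim_col P"
    then have "mat_adjoint P $$ (i, j) = cnj (P $$ (j, i))"
      using P by (simp add: mat_adjoint_index)
    also have "\<dots> = P $$ (i, j)" using ij P
      by (simp add: P_def pencil_index[OF A X n])
    finally show "mat_adjoint P $$ (i, j) = P $$ (i, j)" .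
  qed (use P in \<open>simp_all add: mat_adjoint_index\<close>)
  \<comment> \<open>The row-major index a * n + k is the one that \<open>kronecker\<close>
    uses.\<close>
  define tv where "tv v = Fmat (\<lambda>a k. if a < d \<and> k < n then v $ (a * n + k) else 0)" for v :: "complex vec"
  have ent_tv: "ent (tv v) a k = (if a < d \<and> k < n then v $ (a * n + k) else 0)" for v a k
    unfolding tv_def by (subst ent_Fmat[of "max d n"]) auto
  have tv: "un d * tv v = tv v" "tv v * un n = tv v" for v
    by (rule fmat_eqI; auto simp: ent_un_mult ent_mult_un ent_tv)+
  define q where "q v = (\<Sum>s\<in>UNIV. tr (adj (tv v) * fmt A s * tv v * trn (fmt X s)))" for v
  have lt: "a * n + k < d * n" if "a < d" "k < n" for a k
  proof -
    have "a * n + k < Suc a * n" using that by simp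
    also have "\<dots> \<le> d * n" using that by (intro mult_le_mono1) simp
    finally show ?thesis .
  qed
  have form: "Re ((P *\<^sub>v v) \<bullet>c v) = nrm (tv v) - 2 * Re (q v)" if v: "v \<in> carrier_vec (d * n)" for v
  proof -
    have e1: "tr (adj (tv v) * fmt A s * tv v * trn (fmt X s))
      = (\<Sum>a<d. \<Sum>k<n. \<Sum>b<d. \<Sum>l<n. ent (fmt A s) a b * ent (fmt X s) k l * ent (tv v) b l * cnj (ent (tv v) a k))" for s
    proof -
      have z: "sz (adj (tv v) * fmt A s * tv v * trn (fmt X s)) n"
      proof -
        have "un n * adj (tv v) = adj (tv v)" using arg_cong[OF tv(2), of adj v] by simp
        then show ?thesis unfolding sz_iff using mult_un_sz[OF szX(2)]
          by (simp add: mult.assoc) (simp add: mult.assoc[symmetric])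
      qed
      have "tr (adj (tv v) * fmt A s * tv v * trn (fmt X s))
        = (\<Sum>k<n. \<Sum>l<n. (\<Sum>b<d. (\<Sum>a<d. cnj (ent (tv v) a k) * ent (fmt A s) a b) * ent (tv v) b l) * ent (fmt X s) k l)"
        unfolding tr_sz[OF z] ent_times_sz[OF disjI2[OF szX(2)]]
        by (simp add: ent_times_sz[OF disjI2[OF szA]] ent_times[of d "adj (tv v) * fmt A s"] ent_tv)
      also have "\<dots> = (\<Sum>k<n. \<Sum>l<n. \<Sum>b<d. \<Sum>a<d. ent (fmt A s) a b * ent (fmt X s) k l * ent (tv v) b l * cnj (ent (tv v) a k))"
        by (simp add: sum_distrib_left sum_distrib_right mult_ac)
      also have "\<dots> = (\<Sum>k<n. \<Sum>b<d. \<Sum>l<n. \<Sum>a<d. ent (fmt A s) a b * ent (fmt X s) k l * ent (tv v) b l * cnj (ent (tv v) a k))"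
        by (rule sum.cong[OF refl], rule sum.swap)
      also have "\<dots> = (\<Sum>k<n. \<Sum>b<d. \<Sum>a<d. \<Sum>l<n. ent (fmt A s) a b * ent (fmt X s) k l * ent (tv v) b l * cnj (ent (tv v) a k))"
        by (rule sum.cong[OF refl], rule sum.cong[OF refl], rule sum.swap)
      also have "\<dots> = (\<Sum>k<n. \<Sum>a<d. \<Sum>b<d. \<Sum>l<n. ent (fmt A s) a b * ent (fmt X s) k l * ent (tv v) b l * cnj (ent (tv v) a k))"
        by (rule sum.cong[OF refl], rule sum.swap)
      finally show ?thesis by (subst sum.swap)
    qed
    define g where "g a k b l = ent (tv v) b l * cnj (ent (tv v) a k)" for a k b l
    \<comment> \<open>S1, S2 and S3 come from the identity, the A-term and the adjoint term of the
      pencil. S3 is the conjugate of S2, whence the factor 2 Re.\<close>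
    define S1 where "S1 = (\<Sum>a<d. \<Sum>k<n. \<Sum>b<d. \<Sum>l<n. (if a = b \<and> k = l then 1 else 0) * g a k b l)"
    define S2 where "S2 = (\<Sum>a<d. \<Sum>k<n. \<Sum>b<d. \<Sum>l<n. \<Sum>s\<in>UNIV. ent (fmt A s) a b * ent (fmt X s) k l * g a k b l)"
    define S3 where "S3 = (\<Sum>a<d. \<Sum>k<n. \<Sum>b<d. \<Sum>l<n. \<Sum>s\<in>UNIV. cnj (ent (fmt A s) b a) * cnj (ent (fmt X s) l k) * g a k b l)"
    have "(P *\<^sub>v v) \<bullet>c v = (\<Sum>i<d * n. \<Sum>j<d * n. P $$ (i, j) * (v $ j * cnj (v $ i)))"
      using P v by (simp add: scalar_prod_def atLeast0LessThan sum_distrib_right mult.assoc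
          conjugate_complex_def)
    also have "\<dots> = (\<Sum>a<d. \<Sum>k<n. \<Sum>b<d. \<Sum>l<n. P $$ (a * n + k, b * n + l) * g a k b l)"
      unfolding sum_div_mod[OF n] by (intro sum.cong refl) (simp add: g_def ent_tv)
    also have "\<dots> = S1 - S2 - S3"
      unfolding S1_def S2_def S3_def sum_subtractf[symmetric]
      by (intro sum.cong refl) (simp add: P_def pencil_index[OF A X n] lt left_diff_distrib sum_distrib_right)
    also have "S1 = of_real (nrm (tv v))"
    proof -
      have "S1 = (\<Sum>a<d. \<Sum>k<n. g a k a k)"
      proof (unfold S1_def, intro sum.cong refl)
        fix a k assume ak: "a \<in> {..<d}" "k \<in> {..<n}"
        have "(\<Sum>b<d. \<Sum>l<n. (if a = b \<and> k = l then 1 else 0) * g a k b l)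
          = (\<Sum>b<d. if b = a then g a k a k else 0)"
        proof (intro sum.cong refl)
          fix b
          have "(\<Sum>l<n. (if a = b \<and> k = l then 1 else 0) * g a k b l)
            = (\<Sum>l<n. if l = k then (if b = a then g a k a k else 0) else 0)"
            by (intro sum.cong refl) auto
          then show "(\<Sum>l<n. (if a = b \<and> k = l then 1 else 0) * g a k b l) = (if b = a then g a k a k else 0)"
            using ak by simp
        qed
        then show "(\<Sum>b<d. \<Sum>l<n. (if a = b \<and> k = l then 1 else 0) * g a k b l) = g a k a k"
          using ak by simp
      qed
      also have "\<dots> = (\<Sum>a<d. \<Sum>k<n. of_real ((cmod (ent (tv v) a k))\<^sup>2))"
        by (simp only: g_def complex_norm_square)
      also have "\<dots> = of_real (\<Sum>a<d. \<Sum>k<n. (cmod (ent (tv v) a k))\<^sup>2)" by simp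
      also have "(\<Sum>a<d. \<Sum>k<n. (cmod (ent (tv v) a k))\<^sup>2) = nrm (tv v)"
      proof -
        have "sz (tv v) (max d n)" by (auto simp: sz_def ent_tv)
        then have "nrm (tv v) = (\<Sum>a<max d n. \<Sum>k<max d n. (cmod (ent (tv v) a k))\<^sup>2)" by (rule nrm_sz)
        also have "\<dots> = (\<Sum>a<d. \<Sum>k<max d n. (cmod (ent (tv v) a k))\<^sup>2)"
          by (rule sum.mono_neutral_right) (auto simp: ent_tv)
        also have "\<dots> = (\<Sum>a<d. \<Sum>k<n. (cmod (ent (tv v) a k))\<^sup>2)"
          by (intro sum.cong refl sum.mono_neutral_right) (auto simp: ent_tv)
        finally show ?thesis ..
      qed
      finally show ?thesis .
    qed
    also have S2: "S2 = q v"
    proof -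
      have "q v = (\<Sum>s\<in>UNIV. \<Sum>a<d. \<Sum>k<n. \<Sum>b<d. \<Sum>l<n. ent (fmt A s) a b * ent (fmt X s) k l * g a k b l)"
        unfolding q_def e1 by (simp add: g_def mult.assoc)
      also have "\<dots> = (\<Sum>a<d. \<Sum>s\<in>UNIV. \<Sum>k<n. \<Sum>b<d. \<Sum>l<n. ent (fmt A s) a b * ent (fmt X s) k l * g a k b l)"
        by (rule sum.swap)
      also have "\<dots> = (\<Sum>a<d. \<Sum>k<n. \<Sum>s\<in>UNIV. \<Sum>b<d. \<Sum>l<n. ent (fmt A s) a b * ent (fmt X s) k l * g a k b l)"
        by (rule sum.cong[OF refl], rule sum.swap)
      also have "\<dots> = (\<Sum>a<d. \<Sum>k<n. \<Sum>b<d. \<Sum>s\<in>UNIV. \<Sum>l<n. ent (fmt A s) a b * ent (fmt X s) k l * g a k b l)"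
        by (rule sum.cong[OF refl], rule sum.cong[OF refl], rule sum.swap)
      also have "\<dots> = S2" unfolding S2_def
        by (rule sum.cong[OF refl], rule sum.cong[OF refl], rule sum.cong[OF refl], rule sum.swap)
      finally show ?thesis ..
    qed
    also have "S3 = cnj S2"
    proof -
      have "cnj S2 = (\<Sum>a<d. \<Sum>k<n. \<Sum>b<d. \<Sum>l<n. \<Sum>s\<in>UNIV. cnj (ent (fmt A s) a b) * cnj (ent (fmt X s) k l) * g b l a k)"
        by (simp add: S2_def g_def mult_ac)
      also have "\<dots> = (\<Sum>a<d. \<Sum>b<d. \<Sum>k<n. \<Sum>l<n. \<Sum>s\<in>UNIV. cnj (ent (fmt A s) a b) * cnj (ent (fmt X s) k l) * g b l a k)"
        by (rule sum.cong[OF refl], rule sum.swap)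
      also have "\<dots> = (\<Sum>b<d. \<Sum>a<d. \<Sum>k<n. \<Sum>l<n. \<Sum>s\<in>UNIV. cnj (ent (fmt A s) a b) * cnj (ent (fmt X s) k l) * g b l a k)"
        by (rule sum.swap)
      also have "\<dots> = (\<Sum>b<d. \<Sum>a<d. \<Sum>l<n. \<Sum>k<n. \<Sum>s\<in>UNIV. cnj (ent (fmt A s) a b) * cnj (ent (fmt X s) k l) * g b l a k)"
        by (rule sum.cong[OF refl], rule sum.cong[OF refl], rule sum.swap)
      also have "\<dots> = S3" unfolding S3_def
        by (rule sum.cong[OF refl], rule sum.swap)
      finally show ?thesis ..
    qed
    finally show ?thesis by (simp add: S2)
  qed
  have "X \<in> free_spectrahedron d A n \<longleftrightarrow> (\<forall>v\<in>carrier_vec (d * n). 2 * Re (q v) \<le> nrm (tv v))"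
    using X P herm form by (simp add: free_spectrahedron_def pos_semidef_def P_def[symmetric])
  also have "\<dots> \<longleftrightarrow> (\<lambda>s. trn (fmt X s)) \<in> dset (fmt A)"
  proof
    assume *: "\<forall>v\<in>carrier_vec (d * n). 2 * Re (q v) \<le> nrm (tv v)"
    show "(\<lambda>s. trn (fmt X s)) \<in> dset (fmt A)" unfolding dset_def
    proof (intro CollectI allI)
      fix V
      define v where "v = vec (d * n) (\<lambda>i. ent V (i div n) (i mod n))"
      have tvv: "tv v = un d * V * un n"
        by (rule fmat_eqI) (auto simp: ent_mult_un ent_un_mult ent_tv v_def lt)
      have "tr (adj (tv v) * fmt A s * tv v * trn (fmt X s)) = tr (adj V * fmt A s * V * trn (fmt X s))" for s
      proof -
        have u: "un d * fmt A s * un d = fmt A s" "un n * trn (fmt X s) * un n = trn (fmt X s)"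
          using szA szX(2) by (simp_all add: un_mult_sz mult_un_sz)
        have "tr (adj (tv v) * fmt A s * tv v * trn (fmt X s))
          = tr (un n * (adj V * (un d * fmt A s * un d) * V * un n * trn (fmt X s)))"
          unfolding tvv by (simp add: mult.assoc)
        also have "\<dots> = tr (adj V * (un d * fmt A s * un d) * V * (un n * trn (fmt X s) * un n))"
          by (subst tr_commute) (simp add: mult.assoc)
        finally show ?thesis unfolding u .
      qed
      moreover have "v \<in> carrier_vec (d * n)" by (simp add: v_def)
      ultimately show "2 * Re (\<Sum>s\<in>UNIV. tr (adj V * fmt A s * V * trn (fmt X s))) \<le> nrm V"
        using * nrm_un_mult_un_le[of d V n] unfolding q_def by (fastforce simp: tvv)
    qed
  next
    assume "(\<lambda>s. trn (fmt X s)) \<in> dset (fmt A)"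
    then show "\<forall>v\<in>carrier_vec (d * n). 2 * Re (q v) \<le> nrm (tv v)"
      unfolding q_def by (blast dest: dsetD)
  qed
  finally show ?thesis .
qed

lemma point_of_fmats:
  fixes Y :: "'g::finite \<Rightarrow> fmat"
  assumes "\<And>s. sz (Y s) n"
  shows "(\<lambda>s. mt n (trn (Y s))) \<in> tuples n" "trn (fmt (\<lambda>s. mt n (trn (Y s))) s) = Y s"
  using assms by (simp_all add: tuples_def fmt_def fm_mt sz_trn)

lemma fmats_size:
  fixes Y :: "'g::finite \<Rightarrow> fmat"
  obtains n where "0 < n" "\<And>s. sz (Y s) n"
proof -
  obtain n where "\<forall>s\<in>UNIV. sz (Y s) n" using sz_common[of UNIV Y] by auto
  then show ?thesis by (intro that[of "Suc n"]) (auto intro: sz_mono)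
qed

lemma free_spectrahedron_tuples: "X \<in> free_spectrahedron d A n \<Longrightarrow> X \<in> tuples n"
  by (simp add: free_spectrahedron_def)

lemma free_spectrahedron_eq_iff:
  fixes A B :: "('g::finite) mat_tuple"
  assumes A: "A \<in> tuples d" and B: "B \<in> tuples e" and eq: "dset (fmt A) = dset (fmt B)" and n: "0 < n"
  shows "free_spectrahedron d A n = free_spectrahedron e B n"
  using mem_free_spectrahedron[OF A _ n] mem_free_spectrahedron[OF B _ n] eq free_spectrahedron_tuples
  by blast

lemma circular_iff:
  fixes A :: "('g::finite) mat_tuple"
  assumes A: "A \<in> tuples d"
  shows "circular (free_spectrahedron d A) \<longleftrightarrow>
    (\<forall>w Y. cmod w = 1 \<longrightarrow> Y \<in> dset (fmt A) \<longrightarrow> (\<lambda>s. smul w (Y s)) \<in> dset (fmt A))"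
proof
  assume c: "circular (free_spectrahedron d A)"
  show "\<forall>w Y. cmod w = 1 \<longrightarrow> Y \<in> dset (fmt A) \<longrightarrow> (\<lambda>s. smul w (Y s)) \<in> dset (fmt A)"
  proof (intro allI impI)
    fix w Y assume w: "cmod w = 1" and Y: "Y \<in> dset (fmt A)"
    obtain t where t: "w = exp (\<i> * complex_of_real t)"
      using rcis_cmod_Arg[of w] w by (metis cis_conv_exp mult_1 of_real_1 rcis_def)
    obtain n where n: "0 < n" "\<And>s. sz (Y s) n" by (rule fmats_size[of Y]) (rule that; assumption)
    define X where "X s = mt n (trn (Y s))" for s
    have X: "X \<in> tuples n" "\<And>s. trn (fmt X s) = Y s"
      using point_of_fmats[OF n(2)] by (simp_all add: X_def[abs_def])
    have "X \<in> free_spectrahedron d A n"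
      unfolding mem_free_spectrahedron[OF A X(1) n(1)] X(2) by (rule Y)
    then have r: "(\<lambda>s. w \<cdot>\<^sub>m X s) \<in> free_spectrahedron d A n"
      using c n(1) unfolding circular_def t by simp
    have "trn (fmt (\<lambda>s. w \<cdot>\<^sub>m X s) s) = smul w (Y s)" for s
      using X(2)[of s] by (simp add: fmt_def fm_smult)
    then show "(\<lambda>s. smul w (Y s)) \<in> dset (fmt A)"
      using mem_free_spectrahedron[OF A free_spectrahedron_tuples[OF r] n(1)] r by simp
  qed
next
  assume *: "\<forall>w Y. cmod w = 1 \<longrightarrow> Y \<in> dset (fmt A) \<longrightarrow> (\<lambda>s. smul w (Y s)) \<in> dset (fmt A)"
  show "circular (free_spectrahedron d A)" unfolding circular_def
  proof (intro allI impI ballI)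
    fix n Z and t :: real assume n: "1 \<le> (n::nat)" and Z: "Z \<in> free_spectrahedron d A n"
    define w where "w = exp (\<i> * complex_of_real t)"
    have n0: "0 < n" using n by simp
    note Zt = free_spectrahedron_tuples[OF Z]
    have "(\<lambda>s. smul w (trn (fmt Z s))) \<in> dset (fmt A)"
      using * Z mem_free_spectrahedron[OF A Zt n0] by (simp add: w_def)
    moreover have "trn (fmt (\<lambda>s. w \<cdot>\<^sub>m Z s) s) = smul w (trn (fmt Z s))" for s
      by (simp add: fmt_def fm_smult)
    moreover have "(\<lambda>s. w \<cdot>\<^sub>m Z s) \<in> tuples n" using Zt by (simp add: tuples_def)
    ultimately show "(\<lambda>s. exp (\<i> * complex_of_real t) \<cdot>\<^sub>m Z s) \<in> free_spectrahedron d A n"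
      using mem_free_spectrahedron[OF A _ n0] unfolding w_def by simp
  qed
qed

text \<open>Points of \<open>dset\<close> are transposed, so left multiplication by U becomes right
  multiplication by the transpose of U, which is again unitary.\<close>

lemma free_circular_iff:
  fixes A :: "('g::finite) mat_tuple"
  assumes A: "A \<in> tuples d"
  shows "free_circular (free_spectrahedron d A) \<longleftrightarrow>
    (\<forall>n U Y. 1 \<le> n \<longrightarrow> unitary n U \<longrightarrow> Y \<in> dset (fmt A) \<longrightarrow> (\<forall>s. sz (Y s) n) \<longrightarrow>
      (\<lambda>s. Y s * U) \<in> dset (fmt A))"
proof
  assume c: "free_circular (free_spectrahedron d A)"
  show "\<forall>n U Y. 1 \<le> n \<longrightarrow> unitary n U \<longrightarrow> Y \<in> dset (fmt A) \<longrightarrow> (\<forall>s. sz (Y s) n) \<longrightarrow>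
      (\<lambda>s. Y s * U) \<in> dset (fmt A)"
  proof (intro allI impI)
    fix n U Y assume n: "1 \<le> n" and U: "unitary n U" and Y: "Y \<in> dset (fmt A)" "\<forall>s. sz (Y s) n"
    define X where "X s = mt n (trn (Y s))" for s
    have X: "X \<in> tuples n" "\<And>s. trn (fmt X s) = Y s"
      using point_of_fmats[of Y n] Y(2) by (simp_all add: X_def[abs_def])
    have n0: "0 < n" using n by simp
    have "X \<in> free_spectrahedron d A n"
      unfolding mem_free_spectrahedron[OF A X(1) n0] X(2) by (rule Y(1))
    moreover have "unitary_mat n (mt n (trn U))" by (intro unitary_mt unitary_trn U)
    ultimately have r: "(\<lambda>s. mt n (trn U) * X s) \<in> free_spectrahedron d A n"
      using c n unfolding free_circular_def by blast
    have "trn (fmt (\<lambda>s. mt n (trn U) * X s) s) = Y s * U" for s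
    proof -
      have "fm (mt n (trn U) * X s) = trn U * fm (X s)"
        using X(1) unitaryD(1)[OF U] by (subst fm_mult) (auto simp: fm_mt sz_trn tuples_def)
      then show ?thesis using X(2)[of s] by (simp add: fmt_def trn_mult)
    qed
    then show "(\<lambda>s. Y s * U) \<in> dset (fmt A)"
      using mem_free_spectrahedron[OF A free_spectrahedron_tuples[OF r] n0] r by simp
  qed
next
  assume *: "\<forall>n U Y. 1 \<le> n \<longrightarrow> unitary n U \<longrightarrow> Y \<in> dset (fmt A) \<longrightarrow> (\<forall>s. sz (Y s) n) \<longrightarrow>
      (\<lambda>s. Y s * U) \<in> dset (fmt A)"
  show "free_circular (free_spectrahedron d A)" unfolding free_circular_def
  proof (intro allI impI ballI)
    fix n Z U assume n: "1 \<le> (n::nat)" and Z: "Z \<in> free_spectrahedron d A n" and U: "unitary_mat n U"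
    have n0: "0 < n" using n by simp
    note Zt = free_spectrahedron_tuples[OF Z]
    have Uc: "U \<in> carrier_mat n n" using U by (simp add: unitary_mat_def)
    have "(\<lambda>s. trn (fmt Z s) * trn (fm U)) \<in> dset (fmt A)"
      using * n unitary_trn[OF unitary_fm[OF U]] Z mem_free_spectrahedron[OF A Zt n0] sz_fmt[OF Zt]
      by (simp add: sz_trn)
    moreover have "trn (fmt (\<lambda>s. U * Z s) s) = trn (fmt Z s) * trn (fm U)" for s
    proof -
      have "fm (U * Z s) = fm U * fm (Z s)" using Zt Uc by (intro fm_mult) (auto simp: tuples_def)
      then show ?thesis by (simp add: fmt_def trn_mult)
    qed
    moreover have "(\<lambda>s. U * Z s) \<in> tuples n" using Zt Uc by (auto simp: tuples_def)
    ultimately show "(\<lambda>s. U * Z s) \<in> free_spectrahedron d A n"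
      using mem_free_spectrahedron[OF A _ n0] by simp
  qed
qed

section \<open>Domains under compression and unitary conjugation; tightness of minimal
  pencils\<close>

lemma dset_compression_mono: "proj p \<Longrightarrow> dset A \<subseteq> dset (\<lambda>s. p * A s * p)"
proof
  fix Y assume p: "proj p" and Y: "Y \<in> dset A"
  show "Y \<in> dset (\<lambda>s. p * A s * p)" unfolding dset_def
  proof (intro CollectI allI)
    fix V
    have "2 * Re (\<Sum>s\<in>UNIV. tr (adj V * (p * A s * p) * V * Y s))
        = 2 * Re (\<Sum>s\<in>UNIV. tr (adj (p * V) * A s * (p * V) * Y s))"
      using p by (simp add: proj_def mult.assoc)
    also have "\<dots> \<le> nrm (p * V)" by (rule dsetD[OF Y])
    also have "\<dots> \<le> nrm V" by (rule nrm_proj_mult_le[OF p])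
    finally show "2 * Re (\<Sum>s\<in>UNIV. tr (adj V * (p * A s * p) * V * Y s)) \<le> nrm V" .
  qed
qed

lemma nrm_unitary_mult_le: "unitary d Q \<Longrightarrow> nrm (Q * V) \<le> nrm V"
proof -
  assume Q: "unitary d Q"
  have "nrm (Q * V) = nrm (un d * V)" by (simp add: nrm_def mult.assoc unitaryD[OF Q])
  then show ?thesis using nrm_proj_mult_le[of "un d" V] by simp
qed

lemma dset_unitary_conj:
  assumes Q: "unitary d Q" and A: "\<And>s. sz (A s) d"
  shows "dset (\<lambda>s. adj Q * A s * Q) = dset A"
proof -
  have sub: "dset A \<subseteq> dset (\<lambda>s. adj Q * A s * Q)" if Q: "unitary d Q" for Q and A :: "'a \<Rightarrow> fmat"
  proof
    fix Y assume Y: "Y \<in> dset A"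
    show "Y \<in> dset (\<lambda>s. adj Q * A s * Q)" unfolding dset_def
    proof (intro CollectI allI)
      fix V
      have "2 * Re (\<Sum>s\<in>UNIV. tr (adj V * (adj Q * A s * Q) * V * Y s))
          = 2 * Re (\<Sum>s\<in>UNIV. tr (adj (Q * V) * A s * (Q * V) * Y s))"
        by (simp add: mult.assoc)
      also have "\<dots> \<le> nrm (Q * V)" by (rule dsetD[OF Y])
      also have "\<dots> \<le> nrm V" by (rule nrm_unitary_mult_le[OF Q])
      finally show "2 * Re (\<Sum>s\<in>UNIV. tr (adj V * (adj Q * A s * Q) * V * Y s)) \<le> nrm V" .
    qed
  qed
  have "adj (adj Q) * (adj Q * A s * Q) * adj Q = A s" for s
    using unitaryD[OF Q] un_mult_sz[OF A] mult_un_sz[OF A] by (simp add: mult.assoc)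
  then have "dset (\<lambda>s. adj Q * A s * Q) \<subseteq> dset A"
    using sub[OF unitary_adj[OF Q], of "\<lambda>s. adj Q * A s * Q"] by simp
  then show ?thesis using sub[OF Q, of A] by blast
qed

text \<open>Turns a sorted diagonal into a block structure. The eigenvalue 1 of a projection, a
  kernel, and level 0 of a grading are each split off in this way.\<close>

lemma threshold:
  fixes key :: "nat \<Rightarrow> nat"
  assumes "\<And>i k. i \<le> k \<Longrightarrow> k < d \<Longrightarrow> key i \<le> key k"
  obtains m where "m \<le> d" "\<And>i. i < d \<Longrightarrow> key i = 0 \<longleftrightarrow> i < m"
proof -
  define m where "m = (LEAST i. i = d \<or> key i \<noteq> 0)"
  have P: "m = d \<or> key m \<noteq> 0" unfolding m_def by (rule LeastI[of _ d]) simp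
  have le: "m \<le> d" unfolding m_def by (rule Least_le) simp
  have "key i = 0 \<longleftrightarrow> i < m" if "i < d" for i
  proof
    assume "key i = 0"
    show "i < m"
    proof (rule ccontr)
      assume "\<not> i < m"
      then have "key m \<le> key i" using that by (intro assms) simp_all
      then show False using P \<open>key i = 0\<close> \<open>\<not> i < m\<close> that by simp
    qed
  next
    assume "i < m"
    then show "key i = 0" using not_less_Least[of i "\<lambda>i. i = d \<or> key i \<noteq> 0"] that by (auto simp: m_def)
  qed
  then show ?thesis using that le by blast
qed

lemma unitarily_equivalentI:
  assumes A: "A \<in> tuples d" and Q: "unitary d Q" and B: "\<And>s. B s = mt d (adj Q * fmt A s * Q)"
  shows "unitarily_equivalent d A B"
  unfolding unitarily_equivalent_def
proof (intro exI conjI allI)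
  show "unitary_mat d (mt d Q)" by (rule unitary_mt[OF Q])
  fix s
  note szQ = unitaryD(1)[OF Q]
  have Ac: "A s \<in> carrier_mat d d" using A by (simp add: tuples_def)
  have c: "mat_adjoint (mt d Q) \<in> carrier_mat d d" by (intro mat_adjoint_carrier) simp
  have "fm (mat_adjoint (mt d Q) * A s * mt d Q) = adj Q * fmt A s * Q"
    using Ac c szQ by (simp add: fm_mult fm_adjoint fm_mt fmt_def)
  moreover have "mat_adjoint (mt d Q) * A s * mt d Q \<in> carrier_mat d d"
    using Ac c by (intro mult_carrier_mat) auto
  ultimately show "mat_adjoint (mt d Q) * A s * mt d Q = B s"
    using mt_fm by (metis B)
qed

lemma unitarily_equivalentD:
  assumes A: "A \<in> tuples d" and eq: "unitarily_equivalent d A B"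
  obtains Q where "unitary d Q" "\<And>s. fmt B s = adj Q * fmt A s * Q" "B \<in> tuples d"
proof -
  obtain U where U: "unitary_mat d U" "\<And>s. mat_adjoint U * A s * U = B s"
    using eq unfolding unitarily_equivalent_def by blast
  have Uc: "U \<in> carrier_mat d d" using U(1) by (simp add: unitary_mat_def)
  have Ac: "A s \<in> carrier_mat d d" for s using A by (simp add: tuples_def)
  note c = mat_adjoint_carrier[OF Uc]
  have "fmt B s = adj (fm U) * fmt A s * fm U" for s
    using Uc Ac[of s] c unfolding fmt_def U(2)[symmetric] by (simp add: fm_mult fm_adjoint mult.assoc)
  moreover have "B s \<in> carrier_mat d d" for s
    unfolding U(2)[symmetric] using Uc Ac c by (meson mult_carrier_mat)
  ultimately show ?thesis using that unitary_fm[OF U(1)] by (simp add: tuples_def)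
qed

text \<open>The projection p given by \<open>tight_reduction\<close> commutes with A, so in an
  eigenbasis of p the tuple splits into blocks, and the block on the range of p is a defining
  subpencil. Minimality forces it to have full size.\<close>

lemma minimal_imp_tight:
  fixes A :: "('g::finite) mat_tuple"
  assumes A: "A \<in> tuples d" and min: "minimal_defining_pencil d A"
  shows "tight (un d) (fmt A)"
proof -
  obtain p where p: "proj p" "sz p d" "dset (\<lambda>s. p * fmt A s * p) \<subseteq> dset (fmt A)"
    "tight p (\<lambda>s. p * fmt A s * p)" "\<And>s. fmt A s * p = p * fmt A s"
    by (rule tight_reduction[OF sz_fmt[OF A]]) (rule that; assumption)
  have pp: "adj p = p" "p * p = p" using p(1) by (auto simp: proj_def)
  \<comment> \<open>Key 0 for the eigenvalue 1 puts the range of p first, as the leading block of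
    size e.\<close>
  define key where "key z = (if z = 1 then 0 else 1::nat)" for z :: complex
  obtain Q l where Q: "unitary d Q" "adj Q * p * Q = dg d l"
    "\<And>i k. i \<le> k \<Longrightarrow> k < d \<Longrightarrow> key (l i) \<le> key (l k)"
    using normal_diagonalization[OF p(2), of key] pp by auto
  note QD = unitaryD[OF Q(1)]
  obtain e where e: "e \<le> d" "\<And>i. i < d \<Longrightarrow> key (l i) = 0 \<longleftrightarrow> i < e"
  proof (rule threshold[of d "\<lambda>i. key (l i)"])
    show "key (l i) \<le> key (l k)" if "i \<le> k" "k < d" for i k using Q(3) that by blast
  next
    fix m assume "m \<le> d" "\<And>i. i < d \<Longrightarrow> key (l i) = 0 \<longleftrightarrow> i < m"
    then show thesis by (rule that)
  qed
  have dd: "dg d l * dg d l = dg d l"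
    unfolding Q(2)[symmetric] using un_mult_sz[OF p(2)] pp by (simp add: mult.assoc QD)
      (simp add: mult.assoc[symmetric])
  have "l i * l i = l i" if "i < d" for i
    using arg_cong[OF dd, of "\<lambda>M. ent M i i"] that by (simp add: ent_dg_mult)
  then have l: "l i = (if i < e then 1 else 0)" if "i < d" for i
    using e(2)[OF that] that by (auto simp: key_def split: if_splits)
  have dgl: "dg d l = un e" by (rule fmat_eqI) (use l e(1) in auto)
  define B where "B s = adj Q * fmt A s * Q" for s
  have szB: "sz (B s) d" for s using A QD(1) by (simp add: B_def sz_mult sz_adj sz_fmt)
  have uB: "un e * B s = adj Q * (p * fmt A s) * Q" "B s * un e = adj Q * (fmt A s * p) * Q" for s
  proof -
    have "un d * (fmt A s * X) = fmt A s * X" "un d * (p * X) = p * X" for X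
      using un_mult_sz[OF p(2)] un_mult_sz[OF sz_fmt[OF A]] by (simp_all add: mult.assoc[symmetric])
    then show "un e * B s = adj Q * (p * fmt A s) * Q" "B s * un e = adj Q * (fmt A s * p) * Q"
      unfolding B_def Q(2)[symmetric] dgl[symmetric] by (simp_all add: mult.assoc QD)
  qed
  have comm: "un e * B s = B s * un e" for s by (simp add: uB p(5))
  have "d = e"
  proof (rule ccontr)
    assume "d \<noteq> e"
    define A1 where "A1 s = mat e e (\<lambda>(i, j). ent (B s) i j)" for s
    define A2 where "A2 s = mat (d - e) (d - e) (\<lambda>(i, j). ent (B s) (i + e) (j + e))" for s
    have off: "ent (B s) i j = 0" if "i < e" "\<not> j < e" for i j s
      using arg_cong[OF comm[of s], of "\<lambda>M. ent M i j"] that by (simp add: ent_un_mult ent_mult_un)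
    have off': "ent (B s) i j = 0" if "\<not> i < e" "j < e" for i j s
      using arg_cong[OF comm[of s], of "\<lambda>M. ent M i j"] that by (simp add: ent_un_mult ent_mult_un)
    have blocks: "four_block_mat (A1 s) (0\<^sub>m e (d - e)) (0\<^sub>m (d - e) e) (A2 s) = mt d (B s)" for s
      by (rule eq_matI) (use e(1) off off' in \<open>auto simp: mt_def A1_def A2_def not_less\<close>)
    have A1: "A1 \<in> tuples e" "A2 \<in> tuples (d - e)" by (simp_all add: tuples_def A1_def A2_def)
    have "unitarily_equivalent d A (\<lambda>s. four_block_mat (A1 s) (0\<^sub>m e (d - e)) (0\<^sub>m (d - e) e) (A2 s))"
      by (rule unitarily_equivalentI[OF A Q(1)]) (simp add: blocks B_def)
    then have sub: "subpencil e A1 d A"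
      using A1 e(1) unfolding subpencil_def orthogonal_sum_def
      by (intro exI[of _ "d - e"] exI[of _ A2]) simp
    have "fmt A1 s = adj Q * (p * fmt A s * p) * Q" for s
    proof -
      have "fmt A1 s = un e * (B s * un e)"
        by (rule fmat_eqI) (auto simp: fmt_def A1_def ent_un_mult ent_mult_un)
      also have "\<dots> = un e * (un e * B s)" by (simp only: comm)
      also have "\<dots> = un e * B s" by (rule un_idem_assoc)
      also have "\<dots> = adj Q * (p * fmt A s) * Q" by (rule uB(1))
      finally show ?thesis using p(5) pp by (metis mult.assoc)
    qed
    then have "fmt A1 = (\<lambda>s. adj Q * (p * fmt A s * p) * Q)" by (rule ext)
    then have "dset (fmt A1) = dset (\<lambda>s. adj Q * (p * fmt A s * p) * Q)" by simp
    also have "\<dots> = dset (\<lambda>s. p * fmt A s * p)"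
      using A p(2) by (intro dset_unitary_conj[OF Q(1)]) (simp add: sz_mult sz_fmt)
    also have "\<dots> = dset (fmt A)" using p(3) dset_compression_mono[OF p(1), of "fmt A"] by blast
    finally have "\<forall>n\<ge>1. free_spectrahedron e A1 n = free_spectrahedron d A n"
      using free_spectrahedron_eq_iff[OF A1(1) A] by simp
    with sub have "defining_subpencil e A1 d A" unfolding defining_subpencil_def ..
    \<comment> \<open>This includes e = 0: for p = 0 the pencil of size 0 is the proper defining
      subpencil.\<close>
    moreover have "e < d" using e(1) \<open>d \<noteq> e\<close> by simp
    ultimately show False using min unfolding minimal_defining_pencil_def by blast
  qed
  have "p = Q * dg d l * adj Q" by (rule unitary_conj_inverse[OF Q(1) p(2) Q(2)])
  then have "p = un d" by (simp add: dgl \<open>d = e\<close>[symmetric] mult.assoc QD)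
  then show ?thesis using p(4) un_mult_sz[OF sz_fmt[OF A]] mult_un_sz[OF sz_fmt[OF A]] by simp
qed

text \<open>The kernel of H is the common kernel of the A j. Since all products vanish, it also
  contains all their ranges. In a basis that begins with this kernel only the upper right block
  survives.\<close>

lemma free_circular_block_form:
  fixes A :: "('g::finite) mat_tuple"
  assumes d: "1 \<le> d" and A: "A \<in> tuples d" and tight: "tight (un d) (fmt A)"
    and fc: "free_circular (free_spectrahedron d A)"
  shows "\<exists>s t F. s \<ge> 1 \<and> t \<ge> 1 \<and> s + t = d \<and> (\<forall>j. F j \<in> carrier_mat s t) \<and>
    unitarily_equivalent d A (\<lambda>j. four_block_mat (0\<^sub>m s s) (F j) (0\<^sub>m t s) (0\<^sub>m t t))"
proof -
  note szA = sz_fmt[OF A]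
  have prod0: "fmt A i * fmt A j = 0" for i j
    by (rule free_circular_products_zero[OF szA tight]) (use fc free_circular_iff[OF A] in blast)
  define H where "H = (\<Sum>j\<in>UNIV. adj (fmt A j) * fmt A j)"
  have szH: "sz H d" using szA by (auto simp: H_def intro!: sz_sum sz_mult sz_adj)
  define key where "key z = (if z = 0 then 0 else 1::nat)" for z :: complex
  obtain Q l where Q: "unitary d Q" "adj Q * H * Q = dg d l"
    "\<And>i k. i \<le> k \<Longrightarrow> k < d \<Longrightarrow> key (l i) \<le> key (l k)"
    using normal_diagonalization[OF szH, of key] by (auto simp: H_def)
  note QD = unitaryD[OF Q(1)]
  obtain s where s: "s \<le> d" "\<And>i. i < d \<Longrightarrow> key (l i) = 0 \<longleftrightarrow> i < s"
  proof (rule threshold[of d "\<lambda>i. key (l i)"])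
    show "key (l i) \<le> key (l k)" if "i \<le> k" "k < d" for i k using Q(3) that by blast
  next
    fix m assume "m \<le> d" "\<And>i. i < d \<Longrightarrow> key (l i) = 0 \<longleftrightarrow> i < m"
    then show thesis by (rule that)
  qed
  define B where "B j = adj Q * fmt A j * Q" for j
  have szB: "sz (B j) d" for j using szA QD(1) by (simp add: B_def sz_mult sz_adj)
  have unA: "un d * fmt A j = fmt A j" "un d * (fmt A j * X) = fmt A j * X" for j X
    using un_mult_sz[OF szA] by (simp_all add: mult.assoc[symmetric])
  have BB: "B i * B j = 0" for i j
  proof -
    have "B i * B j = adj Q * (fmt A i * fmt A j) * Q" by (simp add: B_def mult.assoc QD unA)
    then show ?thesis by (simp add: prod0)
  qed
  have HB: "dg d l = (\<Sum>j\<in>UNIV. adj (B j) * B j)"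
    unfolding Q(2)[symmetric] H_def B_def by (simp add: sum_distrib_left sum_distrib_right mult.assoc QD unA)
  have col0: "ent (B j) i k = 0" if "k < s" for i j k
  proof -
    have kd: "k < d" using that s(1) by simp
    then have "l k = 0" using s(2)[OF kd] that by (auto simp: key_def split: if_splits)
    have "(\<Sum>j\<in>UNIV. nrm (B j * E k 0)) = Re (tr (E 0 k * dg d l * E k 0))"
      unfolding nrm_sum_mult HB by simp
    also have "E 0 k * dg d l * E k 0 = 0"
      by (rule fmat_eqI) (simp add: ent_mult_E ent_E_mult \<open>l k = 0\<close>)
    finally have "(\<Sum>j\<in>UNIV. nrm (B j * E k 0)) = 0" by simp
    then have "nrm (B j * E k 0) = 0" by (subst (asm) sum_nonneg_eq_0_iff) auto
    then have "ent (B j * E k 0) i 0 = 0" by simp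
    then show ?thesis by (simp add: ent_mult_E)
  qed
  have row0: "ent (B j) i k = 0" if "s \<le> i" for i j k
  proof (cases "i < d")
    case True
    \<comment> \<open>H times any A j contains only vanishing products, so column vectors of B j lie
      in the kernel of the diagonal matrix, i.e. in the first s coordinates.\<close>
    have "dg d l * B j = 0" unfolding HB by (simp add: sum_distrib_right mult.assoc BB)
    then have "ent (dg d l * B j) i k = 0" by simp
    moreover have "l i \<noteq> 0" using s(2)[OF True] that by (auto simp: key_def split: if_splits)
    ultimately show ?thesis using True by (simp add: ent_dg_mult)
  qed (use szB in \<open>auto simp: sz_def\<close>)
  \<comment> \<open>A zero tuple of positive size is not tight. A nonzero entry must lie in the
    upper right block and so shows that s and t are both positive.\<close>
  have "\<exists>j. B j \<noteq> 0"
  proof -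
    have "un d * E 0 0 = E 0 0" "E 0 0 * un 1 = E 0 0"
      using d by (auto intro!: fmat_eqI simp: ent_un_mult ent_mult_un)
    moreover have "E 0 0 \<noteq> 0" by (metis ent_E ent_zero zero_neq_one)
    ultimately obtain j where "fmt A j * E 0 0 \<noteq> 0 \<or> adj (fmt A j) * E 0 0 \<noteq> 0"
      using tight_nonzero_column[OF szA tight] by blast
    then have "fmt A j \<noteq> 0" by auto
    then have "B j \<noteq> 0"
      using unitary_conj_inverse[OF Q(1) szA, of j "B j"] by (auto simp: B_def)
    then show ?thesis ..
  qed
  then obtain j i k where nz: "ent (B j) i k \<noteq> 0" by (metis ent_zero fmat_eqI)
  have ik: "i < s" "s \<le> k" using nz row0[of i j k] col0[of k j i] not_less by blast+
  have "k < d" by (rule ccontr) (use nz szB[of j] in \<open>simp add: sz_def\<close>)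
  define t where "t = d - s"
  define F where "F j = mat s t (\<lambda>(i, k). ent (B j) i (k + s))" for j
  have blocks: "four_block_mat (0\<^sub>m s s) (F j) (0\<^sub>m t s) (0\<^sub>m t t) = mt d (B j)" for j
    by (rule eq_matI) (use s(1) col0 row0 in \<open>auto simp: mt_def F_def t_def not_less\<close>)
  have "unitarily_equivalent d A (\<lambda>j. four_block_mat (0\<^sub>m s s) (F j) (0\<^sub>m t s) (0\<^sub>m t t))"
    by (rule unitarily_equivalentI[OF A Q(1)]) (simp add: blocks B_def)
  moreover have "1 \<le> s" "1 \<le> t" "s + t = d" using ik \<open>k < d\<close> by (auto simp: t_def)
  moreover have "\<forall>j. F j \<in> carrier_mat s t" by (simp add: F_def)
  ultimately show ?thesis by blast
qed

text \<open>The form of G pairs the upper rows of V, on the adjoint side, with the lower ones. So a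
  unitary acting on Y can be absorbed into the upper rows alone, without increasing the norm of
  V.\<close>

lemma block_form_free_circular:
  fixes A :: "('g::finite) mat_tuple"
  assumes A: "A \<in> tuples d" and d: "s + t = d" and F: "\<And>j. F j \<in> carrier_mat s t"
    and eq: "unitarily_equivalent d A (\<lambda>j. four_block_mat (0\<^sub>m s s) (F j) (0\<^sub>m t s) (0\<^sub>m t t))"
  shows "free_circular (free_spectrahedron d A)"
  unfolding free_circular_iff[OF A]
proof (intro allI impI)
  fix n U Y assume U: "unitary n U" and Y: "Y \<in> dset (fmt A)" "\<forall>s. sz (Y s) n"
  define G where "G = fmt (\<lambda>j. four_block_mat (0\<^sub>m s s) (F j) (0\<^sub>m t s) (0\<^sub>m t t))"
  obtain Q where Q: "unitary d Q" "\<And>j. G j = adj Q * fmt A j * Q"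
    by (rule unitarily_equivalentD[OF A eq, folded G_def]) (rule that; assumption)
  have dsetG: "dset G = dset (fmt A)"
    using dset_unitary_conj[OF Q(1) sz_fmt[OF A]] Q(2) by (simp add: fun_eq_iff[symmetric] Q(2)[abs_def])
  have uG: "un s * G j = G j" "G j * un s = 0" for j
    by (rule fmat_eqI; use F[of j] in \<open>auto simp: G_def fmt_def ent_un_mult ent_mult_un\<close>)+
  have "(\<lambda>j. Y j * U) \<in> dset G" unfolding dset_def
  proof (intro CollectI allI)
    fix V
    define W where "W = un s * V * adj U + (V - un s * V)"
    have sW: "un s * W = un s * V * adj U" by (simp add: W_def algebra_simps)
    have GW: "G j * W = G j * V" for j
    proof -
      have "G j * (un s * X) = 0" for X by (simp add: mult.assoc[symmetric] uG)
      then show ?thesis by (simp add: W_def distrib_left right_diff_distrib mult.assoc)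
    qed
    have WG: "adj W * G j = U * adj V * G j" for j
    proof -
      have "adj W * G j = adj (un s * W) * G j" by (simp add: mult.assoc uG)
      then show ?thesis unfolding sW by (simp add: mult.assoc uG)
    qed
    have "tr (adj V * G j * V * (Y j * U)) = tr (adj W * G j * W * Y j)" for j
    proof -
      have "adj W * G j * W * Y j = U * (adj V * G j * V * Y j)"
        by (simp add: mult.assoc GW) (simp add: mult.assoc[symmetric] WG)
      also have "tr \<dots> = tr (adj V * G j * V * Y j * U)" by (rule tr_commute)
      finally show ?thesis by (simp add: mult.assoc)
    qed
    then have "2 * Re (\<Sum>j\<in>UNIV. tr (adj V * G j * V * (Y j * U))) \<le> nrm W"
      using Y(1) dsetD[of Y G W] dsetG by simp
    also have "nrm W = nrm (un s * V * adj U) + nrm (V - un s * V)"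
      unfolding W_def nrm_add by (simp add: algebra_simps)
    also have "nrm (un s * V * adj U) \<le> nrm (un s * V)"
      using nrm_unitary_mult_le[OF U, of "adj (un s * V)"] nrm_adj[of "un s * V * adj U"]
        nrm_adj[of "un s * V"] by (simp add: mult.assoc)
    also have "nrm (un s * V) + nrm (V - un s * V) = nrm V"
      using proj_pythagoras[of "un s" V] by simp
    finally show "2 * Re (\<Sum>j\<in>UNIV. tr (adj V * G j * V * (Y j * U))) \<le> nrm V" by simp
  qed
  then show "(\<lambda>j. Y j * U) \<in> dset (fmt A)" unfolding dsetG .
qed

section \<open>Gradings and block superdiagonal form\<close>

lemma dset_smul: "Y \<in> dset (\<lambda>s. smul w (A s)) \<longleftrightarrow> (\<lambda>s. smul w (Y s)) \<in> dset A"
  by (simp add: dset_def)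

lemma circular_imp_dset_eq:
  fixes A :: "('g::finite) mat_tuple"
  assumes A: "A \<in> tuples d" and c: "circular (free_spectrahedron d A)" and w: "cmod w = 1"
  shows "dset (\<lambda>s. smul w (fmt A s)) = dset (fmt A)"
proof -
  have rot: "(\<lambda>s. smul v (Y s)) \<in> dset (fmt A)" if "cmod v = 1" "Y \<in> dset (fmt A)" for v Y
    using c that unfolding circular_iff[OF A] by blast
  have "cnj w * w = 1" using w complex_norm_square[of w] by (simp add: mult.commute)
  then have "Y \<in> dset (fmt A)" if "(\<lambda>s. smul w (Y s)) \<in> dset (fmt A)" for Y
    using rot[of "cnj w", OF _ that] w by simp
  then show ?thesis using rot[OF w] by (auto simp: dset_smul)
qed

text \<open>With \<open>w\<close> a primitive root of unity of order \<open>d + 1\<close>, no \<open>w\<close>-orbit fits into the at most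
  \<open>d\<close> eigenvalues of the unitary \<open>U\<close> with \<open>U A = w A U\<close>. The level of an eigenvalue is the
  number of steps after which its orbit leaves the spectrum.\<close>

lemma circular_grading:
  fixes A :: "('g::finite) mat_tuple"
  assumes A: "A \<in> tuples d" and tight: "tight (un d) (fmt A)" and c: "circular (free_spectrahedron d A)"
  obtains Q lev where "unitary d Q" "\<And>i k. i \<le> k \<Longrightarrow> k < d \<Longrightarrow> lev i \<le> (lev k :: nat)"
    "\<And>s i k. i < d \<Longrightarrow> k < d \<Longrightarrow> ent (adj Q * fmt A s * Q) i k \<noteq> 0 \<Longrightarrow> lev k = Suc (lev i)"
proof -
  define w where "w = cis (2 * pi / real (Suc d))"
  have w: "cmod w = 1" by (simp add: w_def)
  obtain U where U: "unitary d U" "\<And>s. U * fmt A s = smul w (fmt A s * U)"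
    by (rule unitary_intertwiner[OF sz_fmt[OF A] tight w circular_imp_dset_eq[OF A c w]])
      (rule that; assumption)
  note UD = unitaryD[OF U(1)]
  have normal: "adj U * U = U * adj U" by (simp add: UD)
  \<comment> \<open>This first diagonalization only lists the spectrum S, from which
    \<open>lv\<close> is defined; a second one then orders the basis by \<open>lv\<close>.\<close>
  from normal_diagonalization[OF UD(1) normal, of "\<lambda>_. 0"]
  obtain Q1 l1 where Q1: "unitary d Q1" "adj Q1 * U * Q1 = dg d l1" by (elim exE conjE)
  note Q1D = unitaryD[OF Q1(1)]
  define S where "S = l1 ` {..<d}"
  have cardS: "card S \<le> d" using card_image_le[of "{..<d}" l1] by (simp add: S_def)
  have finS: "finite S" by (simp add: S_def)
  have eig_S: "z \<in> S" if "eig d U z" for z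
  proof -
    from that obtain v where v: "v \<noteq> 0" "un d * v = v" "U * v = smul z v"
      unfolding eig_def by (elim exE conjE)
    define u where "u = adj Q1 * v"
    have "Q1 * u = v" using v(2) by (simp add: u_def Q1D)
    then have "u \<noteq> 0" using v(1) by auto
    then obtain a b where ab: "ent u a b \<noteq> 0" by (metis ent_zero fmat_eqI)
    have "un d * u = u" by (simp add: u_def mult.assoc[symmetric] Q1D)
    then have "ent (un d * u) a b \<noteq> 0" using ab by simp
    then have a: "a < d" by (simp add: ent_un_mult split: if_splits)
    have "dg d l1 * u = adj Q1 * U * (Q1 * u)" by (simp add: Q1(2)[symmetric] mult.assoc)
    also have "\<dots> = smul z u" unfolding \<open>Q1 * u = v\<close> by (simp add: mult.assoc v(3) u_def)
    finally have "ent (dg d l1 * u) a b = ent (smul z u) a b" by (simp only:)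
    then have "l1 a = z" using a ab by (simp add: ent_dg_mult)
    then show ?thesis using a by (auto simp: S_def)
  qed
  define lv where "lv z = (LEAST n. w ^ n * z \<notin> S)" for z
  from normal_diagonalization[OF UD(1) normal, of lv]
  obtain Q l where Q: "unitary d Q" "adj Q * U * Q = dg d l" "\<forall>i<d. eig d U (l i)"
    "\<forall>i k. i \<le> k \<longrightarrow> k < d \<longrightarrow> lv (l i) \<le> lv (l k)" by (elim exE conjE)
  note QD = unitaryD[OF Q(1)]
  have l_nz: "l i \<noteq> 0" if "i < d" for i
  proof -
    have "adj (dg d l) * dg d l = un d"
      unfolding Q(2)[symmetric] by (simp add: mult.assoc QD UD) (simp add: mult.assoc[symmetric] QD UD)
    from arg_cong[OF this, of "\<lambda>M. ent M i i"] that show ?thesis by (auto simp: dg_mult)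
  qed
  have leaves: "\<exists>n. w ^ n * z \<notin> S" if "z \<noteq> 0" for z
  proof (rule ccontr)
    assume "\<not> ?thesis"
    then have sub: "(\<lambda>n. w ^ n * z) ` {..<Suc d} \<subseteq> S" by auto
    have pow: "w ^ n = cis (2 * pi * real n / real (Suc d))" for n
      by (simp add: w_def DeMoivre mult_ac)
    have "inj_on (\<lambda>n. w ^ n) {..<Suc d}"
      using bij_betw_roots_unity[of "Suc d"] unfolding pow bij_betw_def by blast
    then have "inj_on (\<lambda>n. w ^ n * z) {..<Suc d}" using that by (simp add: inj_on_def)
    then have "Suc d \<le> card S" using card_mono[OF finS sub] by (simp add: card_image)
    then show False using cardS by simp
  qed
  define lev where "lev i = lv (l i)" for i
  have "lev k = Suc (lev i)" if ik: "i < d" "k < d" and nz: "ent (adj Q * fmt A s * Q) i k \<noteq> 0" for s i k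
  proof -
    define B where "B = adj Q * fmt A s * Q"
    have unA: "un d * (fmt A s * X) = fmt A s * X" for X
      using un_mult_sz[OF sz_fmt[OF A]] by (simp add: mult.assoc[symmetric])
    have "dg d l * B = adj Q * (U * fmt A s) * Q"
      by (simp add: B_def Q(2)[symmetric] mult.assoc QD unA)
    also have "\<dots> = smul w (B * dg d l)"
      unfolding U(2) by (simp add: B_def Q(2)[symmetric] mult.assoc QD)
        (simp add: mult.assoc[symmetric] UD)
    finally have "ent (dg d l * B) i k = ent (smul w (B * dg d l)) i k" by (simp only:)
    then have "l i * ent B i k = w * (ent B i k * l k)"
      using ik by (simp add: ent_dg_mult ent_mult_dg)
    then have lik: "l i = w * l k" using nz by (simp add: B_def)
    obtain n where n: "w ^ n * l k \<notin> S" using leaves l_nz ik by blast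
    have "w ^ 0 * l k \<in> S" using eig_S Q(3) ik by simp
    \<comment> \<open>The orbit of l k starts inside S, so its exit time is not 0, and its next
      point w * l k is l i. Hence the exit time of l k is one more than that of l i.\<close>
    then have "lv (l k) = Suc (LEAST m. w ^ Suc m * l k \<notin> S)"
      unfolding lv_def by (intro Least_Suc[of "\<lambda>n. w ^ n * l k \<notin> S", OF n]) simp
    then show ?thesis by (simp add: lev_def lv_def lik mult_ac)
  qed
  then show ?thesis using that[of Q lev] Q(1,4) by (simp add: lev_def)
qed

section \<open>Block indices and splitting into superdiagonal summands\<close>

lemma block_pos_bounds:
  "i < sum_list ms \<Longrightarrow> block_pos ms i = (b, r) \<Longrightarrow>
    b < length ms \<and> r < ms ! b \<and> sum_list (take b ms) + r = i"
proof (induction ms arbitrary: i b r)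
  case (Cons m ms)
  show ?case
  proof (cases "i < m")
    case True
    then show ?thesis using Cons.prems by auto
  next
    case False
    obtain b' r' where bp: "block_pos ms (i - m) = (b', r')" by fastforce
    have "i - m < sum_list ms" using Cons.prems(1) False by simp
    then have "b' < length ms \<and> r' < ms ! b' \<and> sum_list (take b' ms) + r' = i - m"
      using bp by (rule Cons.IH)
    moreover have "b = Suc b'" "r = r'" using Cons.prems(2) False bp by auto
    ultimately show ?thesis using False by auto
  qed
qed simp

lemma block_pos_append:
  "block_pos (xs @ ys) i = (if i < sum_list xs then block_pos xs i
    else (case block_pos ys (i - sum_list xs) of (b, r) \<Rightarrow> (length xs + b, r)))"
  by (induction xs arbitrary: i) (auto split: prod.splits simp: diff_diff_left)

text \<open>Block b collects the indices of level b. A level that does not occur gets a block of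
  size 0; such blocks are dropped in \<open>graded_blocks\<close>.\<close>

lemma block_sizes_exist:
  assumes "\<And>i k. i \<le> k \<Longrightarrow> k < d \<Longrightarrow> lev i \<le> (lev k :: nat)"
  shows "\<exists>ms. sum_list ms = d \<and> (\<forall>i<d. fst (block_pos ms i) = lev i)"
proof -
  have "\<exists>ms. sum_list ms = d \<and> (\<forall>i<d. fst (block_pos ms i) = lev i)"
    if "\<And>i. i < d \<Longrightarrow> lev i < L" "\<And>i k. i \<le> k \<Longrightarrow> k < d \<Longrightarrow> lev i \<le> lev k" for L d lev
    using that
  proof (induction L arbitrary: d lev)
    case 0
    then have "d = 0" by (metis not_less_zero gr0I)
    then show ?case by (intro exI[of _ "[]"]) simp
  next
    case (Suc L)
    obtain m where m: "m \<le> d" "\<And>i. i < d \<Longrightarrow> lev i = 0 \<longleftrightarrow> i < m"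
    proof (rule threshold[of d lev])
      show "lev i \<le> lev k" if "i \<le> k" "k < d" for i k using Suc.prems(2) that .
    next
      fix m assume "m \<le> d" "\<And>i. i < d \<Longrightarrow> lev i = 0 \<longleftrightarrow> i < m"
      then show thesis by (rule that)
    qed
    have pos: "0 < lev (i + m)" if "i < d - m" for i using m(2)[of "i + m"] that by auto
    have "\<exists>ms. sum_list ms = d - m \<and> (\<forall>i<d - m. fst (block_pos ms i) = lev (i + m) - 1)"
    proof (rule Suc.IH)
      show "lev (i + m) - 1 < L" if "i < d - m" for i
      proof -
        have "i + m < d" using that by simp
        then show ?thesis using Suc.prems(1)[of "i + m"] pos[OF that] by linarith
      qed
      show "lev (i + m) - 1 \<le> lev (k + m) - 1" if "i \<le> k" "k < d - m" for i k
      proof -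
        have "k + m < d" using that by simp
        then show ?thesis using Suc.prems(2)[of "i + m" "k + m"] that by (intro diff_le_mono) simp
      qed
    qed
    then obtain ms where ms: "sum_list ms = d - m" "\<And>i. i < d - m \<Longrightarrow> fst (block_pos ms i) = lev (i + m) - 1"
      by blast
    have "fst (block_pos (m # ms) i) = lev i" if "i < d" for i
    proof (cases "i < m")
      case True
      then show ?thesis using m(2)[OF that] by simp
    next
      case False
      then have "i - m < d - m" using that by simp
      from ms(2)[OF this] pos[OF this] False show ?thesis
        by (cases "block_pos ms (i - m)") auto
    qed
    then show ?case using ms(1) m(1) by (intro exI[of _ "m # ms"]) simp
  qed
  \<comment> \<open>The inserted 0 keeps the maximum defined when d = 0.\<close>
  from this[of d lev "Suc (Max (insert 0 (lev ` {..<d})))"] assms show ?thesis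
    by (simp add: less_Suc_eq_le)
qed

lemma block_superdiagonalI:
  fixes M :: "('g::finite) mat_tuple"
  assumes len: "length ms = Suc j" "1 \<le> j"
    and M: "\<And>s. M s \<in> carrier_mat (sum_list ms) (sum_list ms)"
    and graded: "\<And>s i k. i < sum_list ms \<Longrightarrow> k < sum_list ms \<Longrightarrow> M s $$ (i, k) \<noteq> 0 \<Longrightarrow>
      fst (block_pos ms k) = Suc (fst (block_pos ms i))"
    and nonzero: "\<And>b. b < j \<Longrightarrow> \<exists>s i k. i < sum_list ms \<and> k < sum_list ms \<and>
      fst (block_pos ms i) = b \<and> fst (block_pos ms k) = Suc b \<and> M s $$ (i, k) \<noteq> 0"
  shows "block_superdiagonal M"
proof -
  define C where "C s b = mat (ms ! b) (ms ! (b + 1))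
    (\<lambda>(r, q). M s $$ (sum_list (take b ms) + r, sum_list (take (b + 1) ms) + q))" for s b
  have C: "C s b $$ (r, q) = M s $$ (i, k)"
    if "i < sum_list ms" "k < sum_list ms" "block_pos ms i = (b, r)" "block_pos ms k = (b + 1, q)" for s i k b r q
    using block_pos_bounds[OF that(1,3)] block_pos_bounds[OF that(2,4)] by (simp add: C_def)
  have "C s b \<noteq> 0\<^sub>m (ms ! b) (ms ! (b + 1))"
    if ik: "i < sum_list ms" "k < sum_list ms" "fst (block_pos ms i) = b" "fst (block_pos ms k) = Suc b"
      "M s $$ (i, k) \<noteq> 0" for s i k b
  proof -
    obtain r q where rq: "block_pos ms i = (b, r)" "block_pos ms k = (b + 1, q)"
      using ik(3,4) by (cases "block_pos ms i"; cases "block_pos ms k") auto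
    have "C s b $$ (r, q) \<noteq> 0" using C[OF ik(1,2) rq] ik(5) by simp
    then show ?thesis
      using block_pos_bounds[OF ik(1) rq(1)] block_pos_bounds[OF ik(2) rq(2)] by auto
  qed
  then have nz: "\<forall>b<j. \<exists>s. C s b \<noteq> 0\<^sub>m (ms ! b) (ms ! (b + 1))" using nonzero by blast
  have eq: "M s = block_mat ms (\<lambda>b c. if c = b + 1 then C s b else 0\<^sub>m (ms ! b) (ms ! c))" for s
  proof (rule eq_matI)
    fix i k assume "i < dim_row (block_mat ms (\<lambda>b c. if c = b + 1 then C s b else 0\<^sub>m (ms ! b) (ms ! c)))"
      "k < dim_col (block_mat ms (\<lambda>b c. if c = b + 1 then C s b else 0\<^sub>m (ms ! b) (ms ! c)))"
    then have ik: "i < sum_list ms" "k < sum_list ms" by (simp_all add: block_mat_def)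
    obtain b r c q where bp: "block_pos ms i = (b, r)" "block_pos ms k = (c, q)" by fastforce
    show "M s $$ (i, k) = block_mat ms (\<lambda>b c. if c = b + 1 then C s b else 0\<^sub>m (ms ! b) (ms ! c)) $$ (i, k)"
    proof (cases "c = b + 1")
      case True
      then show ?thesis using ik bp C[OF ik] by (simp add: block_mat_def)
    next
      case False
      then have "M s $$ (i, k) = 0" using graded[OF ik] bp by fastforce
      then show ?thesis using ik bp False block_pos_bounds[OF ik(1) bp(1)] block_pos_bounds[OF ik(2) bp(2)]
        by (simp add: block_mat_def)
    qed
  qed (simp_all add: block_mat_def carrier_matD[OF M])
  show ?thesis unfolding block_superdiagonal_def
    using len nz eq by (intro exI[of _ j] exI[of _ ms] exI[of _ C]) (simp add: C_def)
qed

text \<open>Split off the blocks up to the first vanishing superdiagonal block.\<close>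

lemma graded_blocks:
  fixes M :: "('g::finite) mat_tuple"
  assumes "\<And>s. M s \<in> carrier_mat (sum_list ms) (sum_list ms)"
    and "\<And>s i k. i < sum_list ms \<Longrightarrow> k < sum_list ms \<Longrightarrow> M s $$ (i, k) \<noteq> 0 \<Longrightarrow>
      fst (block_pos ms k) = Suc (fst (block_pos ms i))"
    and "\<And>i. i < sum_list ms \<Longrightarrow> \<exists>s k. k < sum_list ms \<and> (M s $$ (i, k) \<noteq> 0 \<or> M s $$ (k, i) \<noteq> 0)"
  shows "\<exists>Es. (\<forall>E\<in>set Es. block_superdiagonal E) \<and> (\<forall>s. M s = diag_block_mat (map (\<lambda>E. E s) Es))"
  using assms
proof (induction "length ms" arbitrary: ms M rule: less_induct)
  case less
  note M = less.prems(1) and graded = less.prems(2) and nz = less.prems(3)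
  show ?case
  proof (cases "ms = []")
    case True
    then have "M s = 0\<^sub>m 0 0" for s using M[of s] by (intro eq_matI) auto
    then show ?thesis by (intro exI[of _ "[]"]) simp
  next
    case False
    \<comment> \<open>P j says that no entry leads from block j to the next one, and it holds for
      the last block by convention. So a least such j exists, and all superdiagonal blocks before it
      are nonzero.\<close>
    define P where "P j \<longleftrightarrow> Suc j = length ms \<or> (\<forall>s i k. i < sum_list ms \<longrightarrow> k < sum_list ms \<longrightarrow>
      fst (block_pos ms i) = j \<longrightarrow> fst (block_pos ms k) = Suc j \<longrightarrow> M s $$ (i, k) = 0)" for j
    define j where "j = (LEAST j. P j)"
    have P0: "P (length ms - 1)" using False by (simp add: P_def)
    have Pj: "P j" unfolding j_def by (rule LeastI[of P, OF P0])
    have jl: "j < length ms" using Least_le[of P, OF P0] False by (simp add: j_def less_le_trans Suc_le_eq)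
        (metis Suc_pred length_greater_0_conv less_Suc_eq_le)
    have notP: "\<not> P b" if "b < j" for b using not_less_Least that by (simp add: j_def)
    define xs where "xs = take (Suc j) ms"
    define ys where "ys = drop (Suc j) ms"
    have ms: "ms = xs @ ys" and lxs: "length xs = Suc j" using jl by (simp_all add: xs_def ys_def)
    define m1 where "m1 = sum_list xs"
    define m2 where "m2 = sum_list ys"
    have N: "sum_list ms = m1 + m2" by (simp add: ms m1_def m2_def)
    have bp1: "block_pos ms i = block_pos xs i" "fst (block_pos ms i) \<le> j" if "i < m1" for i
    proof -
      show "block_pos ms i = block_pos xs i" using that by (simp add: ms block_pos_append m1_def)
      then show "fst (block_pos ms i) \<le> j"
        using block_pos_bounds[of i xs "fst (block_pos xs i)" "snd (block_pos xs i)"] that lxs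
        by (simp add: m1_def)
    qed
    have bp2: "fst (block_pos ms (i + m1)) = Suc j + fst (block_pos ys i)" for i
      by (simp add: ms block_pos_append m1_def lxs split: prod.split)
    \<comment> \<open>By the grading, such an entry would lead from level j to level j + 1, which P
      j forbids.\<close>
    have off1: "M s $$ (i, k + m1) = 0" if "i < m1" "k < m2" for s i k
    proof (rule ccontr)
      assume nz': "M s $$ (i, k + m1) \<noteq> 0"
      have b: "i < sum_list ms" "k + m1 < sum_list ms" using that by (simp_all add: N)
      have e: "fst (block_pos ms (k + m1)) = Suc (fst (block_pos ms i))" by (rule graded[OF b nz'])
      then have "fst (block_pos ms i) = j" using bp1(2)[OF that(1)] bp2[of k] by simp
      moreover have "fst (block_pos ms (k + m1)) < length ms"
        using block_pos_bounds[OF b(2)] by (metis prod.collapse)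
      ultimately show False using Pj b e nz' unfolding P_def by fastforce
    qed
    have off2: "M s $$ (i + m1, k) = 0" if "i < m2" "k < m1" for s i k
    proof (rule ccontr)
      assume "M s $$ (i + m1, k) \<noteq> 0"
      then have "fst (block_pos ms k) = Suc (fst (block_pos ms (i + m1)))"
        using that by (intro graded) (simp_all add: N)
      then show False using bp1(2)[OF that(2)] bp2[of i] by simp
    qed
    define M1 where "M1 s = mat m1 m1 (\<lambda>(i, k). M s $$ (i, k))" for s
    define M2 where "M2 s = mat m2 m2 (\<lambda>(i, k). M s $$ (i + m1, k + m1))" for s
    have split: "M s = four_block_mat (M1 s) (0\<^sub>m m1 m2) (0\<^sub>m m2 m1) (M2 s)" for s
    proof (rule eq_matI)
      fix i k assume "i < dim_row (four_block_mat (M1 s) (0\<^sub>m m1 m2) (0\<^sub>m m2 m1) (M2 s))"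
        "k < dim_col (four_block_mat (M1 s) (0\<^sub>m m1 m2) (0\<^sub>m m2 m1) (M2 s))"
      then have ik: "i < m1 + m2" "k < m1 + m2" by (simp_all add: M1_def M2_def)
      show "M s $$ (i, k) = four_block_mat (M1 s) (0\<^sub>m m1 m2) (0\<^sub>m m2 m1) (M2 s) $$ (i, k)"
        using ik off1[of i "k - m1" s] off2[of "i - m1" k s]
        by (auto simp: M1_def M2_def not_less)
    qed (use M[of s] in \<open>simp_all add: M1_def M2_def N\<close>)
    have "\<exists>Es. (\<forall>E\<in>set Es. block_superdiagonal E) \<and> (\<forall>s. M2 s = diag_block_mat (map (\<lambda>E. E s) Es))"
    proof (rule less.hyps[of ys])
      show "length ys < length ms" by (simp add: ms lxs)
      show "M2 s \<in> carrier_mat (sum_list ys) (sum_list ys)" for s by (simp add: M2_def m2_def)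
      show "fst (block_pos ys k) = Suc (fst (block_pos ys i))"
        if "i < sum_list ys" "k < sum_list ys" "M2 s $$ (i, k) \<noteq> 0" for s i k
        using graded[of "i + m1" "k + m1" s] that bp2[of i] bp2[of k] by (simp add: M2_def N m2_def[symmetric])
      fix i assume i: "i < sum_list ys"
      then obtain s k where k: "k < m1 + m2" "M s $$ (i + m1, k) \<noteq> 0 \<or> M s $$ (k, i + m1) \<noteq> 0"
        using nz[of "i + m1"] by (auto simp: N m2_def[symmetric])
      have "m1 \<le> k" using k(2) off1[of k i s] off2[of i k s] i by (force simp: m2_def not_less[symmetric])
      then show "\<exists>s k. k < sum_list ys \<and> (M2 s $$ (i, k) \<noteq> 0 \<or> M2 s $$ (k, i) \<noteq> 0)"
        using k i by (intro exI[of _ s] exI[of _ "k - m1"]) (auto simp: M2_def m2_def[symmetric])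
    qed
    then obtain Es where Es: "\<forall>E\<in>set Es. block_superdiagonal E" "\<And>s. M2 s = diag_block_mat (map (\<lambda>E. E s) Es)"
      by blast
    have graded1: "fst (block_pos xs k) = Suc (fst (block_pos xs i))"
      if "i < m1" "k < m1" "M1 s $$ (i, k) \<noteq> 0" for s i k
      using graded[of i k s] that bp1(1) by (simp add: M1_def N)
    show ?thesis
    proof (cases "j = 0")
      case True
      then obtain x where xs: "xs = [x]" using lxs by (metis length_0_conv length_Suc_conv)
      have M10: "M1 s $$ (i, k) = 0" if "i < m1" "k < m1" for s i k
        using graded1[OF that, of s] that by (fastforce simp: xs m1_def)
      have "m1 = 0"
      proof (rule ccontr)
        assume "m1 \<noteq> 0"
        then have m1: "0 < m1" by simp
        then obtain s k where k: "k < m1 + m2" "M s $$ (0, k) \<noteq> 0 \<or> M s $$ (k, 0) \<noteq> 0"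
          using nz[of 0] by (auto simp: N)
        show False
        proof (cases "k < m1")
          case True
          then show False using k(2) M10[OF m1 True, of s] M10[OF True m1, of s] m1 by (simp add: M1_def)
        next
          case False
          then show False using k off1[of 0 "k - m1" s] off2[of "k - m1" 0 s] m1
            by (simp add: less_diff_conv2)
        qed
      qed
      then have "M s = M2 s" for s
        unfolding split[of s] by (intro eq_matI) (auto simp: M1_def M2_def)
      then show ?thesis using Es by auto
    next
      case False
      have "block_superdiagonal M1"
      proof (rule block_superdiagonalI[OF lxs])
        show "M1 s \<in> carrier_mat (sum_list xs) (sum_list xs)" for s by (simp add: M1_def m1_def)
        show "fst (block_pos xs k) = Suc (fst (block_pos xs i))"
          if "i < sum_list xs" "k < sum_list xs" "M1 s $$ (i, k) \<noteq> 0" for s i k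
          using graded1 that by (simp add: m1_def)
        fix b assume b: "b < j"
        then obtain s i k where ik: "i < sum_list ms" "k < sum_list ms" "fst (block_pos ms i) = b"
          "fst (block_pos ms k) = Suc b" "M s $$ (i, k) \<noteq> 0"
          using notP[OF b] unfolding P_def by blast
        have lt: "i < m1" if "fst (block_pos ms i) \<le> j" for i
          using bp2[of "i - m1"] that by (cases "i < m1") auto
        have "i < m1" "k < m1" using lt[of i] lt[of k] ik b by simp_all
        then show "\<exists>s i k. i < sum_list xs \<and> k < sum_list xs \<and> fst (block_pos xs i) = b \<and>
            fst (block_pos xs k) = Suc b \<and> M1 s $$ (i, k) \<noteq> 0"
          using ik bp1(1) by (intro exI[of _ s] exI[of _ i] exI[of _ k]) (simp add: M1_def m1_def[symmetric])
      qed (use False in simp)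
      moreover have "M s = diag_block_mat (map (\<lambda>E. E s) (M1 # Es))" for s
        unfolding split[of s] by (simp add: Es(2)[symmetric] Let_def M1_def M2_def)
      ultimately show ?thesis using Es(1) by (intro exI[of _ "M1 # Es"]) simp
    qed
  qed
qed

text \<open>The level of an index is the number of its block. Positivity of the size comes from the
  nonzero first superdiagonal block; it later makes the space of a summand nonzero.\<close>

lemma block_superdiagonal_graded:
  fixes E :: "('g::finite) mat_tuple"
  assumes "block_superdiagonal E"
  obtains m lev where "1 \<le> m" "\<And>s. E s \<in> carrier_mat m m"
    "\<And>s i k. i < m \<Longrightarrow> k < m \<Longrightarrow> E s $$ (i, k) \<noteq> 0 \<Longrightarrow> lev k = Suc (lev i)"
proof -
  obtain k ms C where C: "k \<ge> 1" "length ms = k + 1"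
    "\<forall>s. \<forall>j<k. C s j \<in> carrier_mat (ms ! j) (ms ! (j + 1))"
    "\<forall>j<k. \<exists>s. C s j \<noteq> 0\<^sub>m (ms ! j) (ms ! (j + 1))"
    "\<And>s. E s = block_mat ms (\<lambda>b c. if c = b + 1 then C s b else 0\<^sub>m (ms ! b) (ms ! c))"
    using assms unfolding block_superdiagonal_def by (elim exE conjE) blast
  obtain s where "C s 0 \<noteq> 0\<^sub>m (ms ! 0) (ms ! 1)" using C(1,4) by fastforce
  moreover have "C s 0 \<in> carrier_mat (ms ! 0) (ms ! 1)" using C(1,3) by fastforce
  ultimately have "ms ! 0 \<noteq> 0" by (metis carrier_matD eq_matI index_zero_mat(2,3) not_less_zero)
  moreover have "ms ! 0 \<le> sum_list ms" using elem_le_sum_list[of 0 ms] C(2) by simp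
  ultimately have "1 \<le> sum_list ms" by simp
  moreover have "E s \<in> carrier_mat (sum_list ms) (sum_list ms)" for s by (simp add: C(5) block_mat_def)
  moreover have "fst (block_pos ms j) = Suc (fst (block_pos ms i))"
    if "i < sum_list ms" "j < sum_list ms" "E s $$ (i, j) \<noteq> 0" for s i j
  proof (rule ccontr)
    assume *: "fst (block_pos ms j) \<noteq> Suc (fst (block_pos ms i))"
    obtain b r c q where bp: "block_pos ms i = (b, r)" "block_pos ms j = (c, q)" by fastforce
    have "E s $$ (i, j) = 0" using * that(1,2) bp block_pos_bounds[OF that(1) bp(1)] block_pos_bounds[OF that(2) bp(2)]
      by (simp add: C(5) block_mat_def)
    then show False using that(3) by simp
  qed
  ultimately show ?thesis by (rule that)
qed

lemma diag_block_graded: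
  fixes Es :: "('g::finite) mat_tuple list"
  assumes "\<forall>E\<in>set Es. block_superdiagonal E"
  shows "\<exists>m lev. (\<forall>s. diag_block_mat (map (\<lambda>E. E s) Es) \<in> carrier_mat m m) \<and> (Es \<noteq> [] \<longrightarrow> 1 \<le> m) \<and>
    (\<forall>s i k. i < m \<longrightarrow> k < m \<longrightarrow> diag_block_mat (map (\<lambda>E. E s) Es) $$ (i, k) \<noteq> 0 \<longrightarrow> lev k = Suc (lev i))"
  using assms
proof (induction Es)
  case (Cons E Es)
  obtain m1 lev1 where E: "1 \<le> m1" "\<And>s. E s \<in> carrier_mat m1 m1"
    "\<And>s i k. i < m1 \<Longrightarrow> k < m1 \<Longrightarrow> E s $$ (i, k) \<noteq> 0 \<Longrightarrow> lev1 k = Suc (lev1 i)"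
  proof (rule block_superdiagonal_graded[of E])
    show "block_superdiagonal E" using Cons.prems by simp
  next
    fix m lev assume "1 \<le> m" "\<And>s. E s \<in> carrier_mat m m"
      "\<And>s i k. i < m \<Longrightarrow> k < m \<Longrightarrow> E s $$ (i, k) \<noteq> 0 \<Longrightarrow> lev k = Suc (lev i)"
    then show thesis by (rule that)
  qed
  define D where "D s = diag_block_mat (map (\<lambda>E. E s) Es)" for s
  obtain m2 lev2 where D: "\<And>s. D s \<in> carrier_mat m2 m2"
    "\<And>s i k. i < m2 \<Longrightarrow> k < m2 \<Longrightarrow> D s $$ (i, k) \<noteq> 0 \<Longrightarrow> lev2 k = Suc (lev2 i)"
  proof -
    have "\<exists>m lev. (\<forall>s. D s \<in> carrier_mat m m) \<and> (Es \<noteq> [] \<longrightarrow> 1 \<le> m) \<and>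
      (\<forall>s i k. i < m \<longrightarrow> k < m \<longrightarrow> D s $$ (i, k) \<noteq> 0 \<longrightarrow> lev k = Suc (lev i))"
      unfolding D_def using Cons.prems by (intro Cons.IH) simp
    then obtain m lev where D: "\<forall>s. D s \<in> carrier_mat m m"
      "\<forall>s i k. i < m \<longrightarrow> k < m \<longrightarrow> D s $$ (i, k) \<noteq> 0 \<longrightarrow> lev k = Suc (lev i)"
      by (elim exE conjE)
    show thesis by (rule that[of m lev]) (use D in blast)+
  qed
  have eq: "diag_block_mat (map (\<lambda>E. E s) (E # Es)) = four_block_mat (E s) (0\<^sub>m m1 m2) (0\<^sub>m m2 m1) (D s)" for s
    using E(2)[of s] D(1)[of s] by (simp add: Let_def D_def)
  \<comment> \<open>No nonzero entry joins different summands, so the gradings can be juxtaposed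
    without any shift.\<close>
  define lev where "lev i = (if i < m1 then lev1 i else lev2 (i - m1))" for i
  have "lev k = Suc (lev i)" if "i < m1 + m2" "k < m1 + m2"
    "four_block_mat (E s) (0\<^sub>m m1 m2) (0\<^sub>m m2 m1) (D s) $$ (i, k) \<noteq> 0" for s i k
    using that E(2)[of s] D(1)[of s] E(3)[of i k s] D(2)[of "i - m1" "k - m1" s]
    by (auto simp: lev_def split: if_splits)
  then show ?case unfolding eq using E(1,2) D(1)
    by (intro exI[of _ "m1 + m2"] exI[of _ lev]) auto
qed (intro exI[of _ 0], auto)

text \<open>The diagonal unitary with entries w ^ lev i conjugates B into w B, because every nonzero
  entry raises the level by one. Conjugation by a unitary preserves the domain.\<close>

lemma graded_circular:
  fixes A :: "('g::finite) mat_tuple"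
  assumes A: "A \<in> tuples d" and eq: "unitarily_equivalent d A B"
    and graded: "\<And>s i k. i < d \<Longrightarrow> k < d \<Longrightarrow> B s $$ (i, k) \<noteq> 0 \<Longrightarrow> lev k = Suc (lev i)"
  shows "circular (free_spectrahedron d A)"
  unfolding circular_iff[OF A]
proof (intro allI impI)
  fix w Y assume w: "cmod w = 1" and Y: "Y \<in> dset (fmt A)"
  obtain Q where Q: "unitary d Q" "\<And>s. fmt B s = adj Q * fmt A s * Q" "B \<in> tuples d"
    by (rule unitarily_equivalentD[OF A eq]) (rule that; assumption)
  have "fmt B = (\<lambda>s. adj Q * fmt A s * Q)" using Q(2) by (rule ext)
  then have dsetB: "dset (fmt B) = dset (fmt A)" using dset_unitary_conj[OF Q(1) sz_fmt[OF A]] by simp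
  define \<Lambda> where "\<Lambda> = dg d (\<lambda>i. w ^ lev i)"
  have ww: "cnj (w ^ n) * w ^ n = 1" for n
    using w complex_norm_square[of "w ^ n"] by (simp add: norm_power mult.commute)
  have "unitary d \<Lambda>"
    unfolding unitary_def \<Lambda>_def adj_dg dg_mult
    by (intro conjI fmat_eqI) (use ww in \<open>auto simp: mult.commute\<close>)
  then have "dset (\<lambda>s. adj \<Lambda> * fmt B s * \<Lambda>) = dset (fmt B)"
    by (rule dset_unitary_conj) (rule sz_fmt[OF Q(3)])
  moreover have "adj \<Lambda> * fmt B s * \<Lambda> = smul w (fmt B s)" for s
  proof (rule fmat_eqI)
    fix i k
    have Bc: "B s \<in> carrier_mat d d" using Q(3) by (simp add: tuples_def)
    show "ent (adj \<Lambda> * fmt B s * \<Lambda>) i k = ent (smul w (fmt B s)) i k"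
    proof (cases "i < d \<and> k < d \<and> B s $$ (i, k) \<noteq> 0")
      case True
      then have "lev k = Suc (lev i)" using graded by blast
      then show ?thesis using True Bc ww[of "lev i"]
        by (simp add: \<Lambda>_def ent_dg_mult ent_mult_dg fmt_def mult_ac)
    next
      case False
      then show ?thesis using Bc by (auto simp: \<Lambda>_def ent_dg_mult ent_mult_dg fmt_def)
    qed
  qed
  ultimately have "dset (\<lambda>s. smul w (fmt B s)) = dset (fmt B)" by simp
  then have "Y \<in> dset (\<lambda>s. smul w (fmt B s))" using Y dsetB by simp
  then show "(\<lambda>s. smul w (Y s)) \<in> dset (fmt A)" unfolding dset_smul dsetB .
qed

lemma circular_block_form:
  fixes A :: "('g::finite) mat_tuple"
  assumes A: "A \<in> tuples d" and tight: "tight (un d) (fmt A)" and c: "circular (free_spectrahedron d A)"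
  shows "\<exists>Es. (\<forall>E\<in>set Es. block_superdiagonal E) \<and>
    unitarily_equivalent d A (\<lambda>s. diag_block_mat (map (\<lambda>E. E s) Es))"
proof -
  obtain Q lev where Q: "unitary d Q" "\<And>i k. i \<le> k \<Longrightarrow> k < d \<Longrightarrow> lev i \<le> (lev k :: nat)"
    "\<And>s i k. i < d \<Longrightarrow> k < d \<Longrightarrow> ent (adj Q * fmt A s * Q) i k \<noteq> 0 \<Longrightarrow> lev k = Suc (lev i)"
    by (rule circular_grading[OF A tight c]) (rule that; assumption)
  note QD = unitaryD[OF Q(1)]
  obtain ms where ms: "sum_list ms = d" "\<And>i. i < d \<Longrightarrow> fst (block_pos ms i) = lev i"
    using block_sizes_exist[of d lev] Q(2) by blast
  define B where "B s = adj Q * fmt A s * Q" for s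
  define M where "M s = mt d (B s)" for s
  have szB: "sz (B s) d" for s using QD(1) sz_fmt[OF A] by (simp add: B_def sz_mult sz_adj)
  have M_ent: "M s $$ (i, k) = ent (B s) i k" if "i < d" "k < d" for s i k
    using that by (simp add: M_def mt_def)
  have "\<exists>Es. (\<forall>E\<in>set Es. block_superdiagonal E) \<and> (\<forall>s. M s = diag_block_mat (map (\<lambda>E. E s) Es))"
  proof (rule graded_blocks[of _ ms])
    show "M s \<in> carrier_mat (sum_list ms) (sum_list ms)" for s by (simp add: M_def ms)
    show "fst (block_pos ms k) = Suc (fst (block_pos ms i))"
      if "i < sum_list ms" "k < sum_list ms" "M s $$ (i, k) \<noteq> 0" for s i k
      using that Q(3) by (simp add: ms M_ent B_def)
    fix i assume "i < sum_list ms"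
    then have i: "i < d" by (simp add: ms)
    \<comment> \<open>The i-th vector of the adapted basis. By \<open>tight_nonzero_column\<close>
      some A s or adjoint does not annihilate it, so index i has a nonzero entry in its column or
      row, as \<open>graded_blocks\<close> requires.\<close>
    define v where "v = Q * E i 0"
    have v: "un d * v = v" "v * un 1 = v"
    proof -
      show "un d * v = v" by (simp add: v_def mult.assoc[symmetric] QD)
      have "E i 0 * un 1 = E i 0" by (rule fmat_eqI) (auto simp: ent_mult_un)
      then show "v * un 1 = v" by (simp add: v_def mult.assoc)
    qed
    have "v \<noteq> 0"
    proof
      assume "v = 0"
      then have "adj Q * v = 0" by simp
      then have "un d * E i 0 = 0" by (simp add: v_def QD)
      then have "ent (un d * E i 0) i 0 = 0" by simp
      then show False using i by (simp add: ent_un_mult)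
    qed
    then obtain s where s: "fmt A s * v \<noteq> 0 \<or> adj (fmt A s) * v \<noteq> 0"
      using tight_nonzero_column[OF sz_fmt[OF A] tight v] by blast
    have unA: "un d * (fmt A s * X) = fmt A s * X" "un d * (adj (fmt A s) * X) = adj (fmt A s) * X" for X
      using un_mult_sz[OF sz_fmt[OF A]] un_mult_sz[OF sz_adj[OF sz_fmt[OF A]]]
      by (simp_all add: mult.assoc[symmetric])
    have QB: "Q * (B s * E i 0) = fmt A s * v" "Q * (adj (B s) * E i 0) = adj (fmt A s) * v"
      by (simp_all add: B_def v_def mult.assoc QD unA)
    have "B s * E i 0 \<noteq> 0 \<or> adj (B s) * E i 0 \<noteq> 0"
      using s unfolding QB[symmetric] by auto
    then obtain a b where "ent (B s * E i 0) a b \<noteq> 0 \<or> ent (adj (B s) * E i 0) a b \<noteq> 0"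
      by (metis ent_zero fmat_eqI)
    then have nz: "ent (B s) a i \<noteq> 0 \<or> ent (B s) i a \<noteq> 0"
      by (auto simp: ent_mult_E split: if_splits)
    then have "a < d" using szB[of s] by (auto simp: sz_def not_less[symmetric])
    then show "\<exists>s k. k < sum_list ms \<and> (M s $$ (i, k) \<noteq> 0 \<or> M s $$ (k, i) \<noteq> 0)"
      using nz i by (intro exI[of _ s] exI[of _ a]) (auto simp: ms M_ent)
  qed
  then obtain Es where Es: "\<forall>E\<in>set Es. block_superdiagonal E" "\<And>s. M s = diag_block_mat (map (\<lambda>E. E s) Es)"
    by blast
  have "unitarily_equivalent d A (\<lambda>s. diag_block_mat (map (\<lambda>E. E s) Es))"
    by (rule unitarily_equivalentI[OF A Q(1)]) (simp add: Es(2)[symmetric] M_def B_def)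
  then show ?thesis using Es(1) by blast
qed

lemma tuples_dim:
  assumes "B \<in> tuples d" "\<And>s. B s \<in> carrier_mat m m" shows "m = d"
proof -
  have "B undefined \<in> carrier_mat d d" using assms(1) by (simp add: tuples_def)
  from carrier_matD(1)[OF this] carrier_matD(1)[OF assms(2)[of undefined]] show ?thesis by simp
qed

section \<open>Reducing subspaces and the irreducible case\<close>

lemma commuting_projection_reducing:
  fixes A :: "('g::finite) mat_tuple"
  assumes A: "A \<in> tuples d" and p: "proj p" "sz p d" "p \<noteq> 0" "p \<noteq> un d"
    and comm: "\<And>s. p * fmt A s = fmt A s * p"
  shows "\<exists>M. reducing_subspace d A M"
proof -
  define P where "P = mt d p"
  have P: "P \<in> carrier_mat d d" "fm P = p" using p(2) by (simp_all add: P_def fm_mt)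
  have pp: "adj p = p" "p * p = p" using p(1) by (auto simp: proj_def)
  have PP: "P * P = P"
    using P pp by (intro fm_inj[of _ _ d]) (auto simp: fm_mult)
  \<comment> \<open>The range of the projection, written as its set of fixed vectors; invariance
    then follows from commutation with P.\<close>
  define M where "M = {v \<in> carrier_vec d. P *\<^sub>v v = v}"
  have inv: "B *\<^sub>v v \<in> M" if "B \<in> carrier_mat d d" "p * fm B = fm B * p" "v \<in> M" for B v
  proof -
    have dims: "dim_row P = d" "dim_col P = d" "dim_row B = d" "dim_col B = d"
      using P(1) that(1) by auto
    have "fm (P * B) = p * fm B" using fm_mult[of P B] dims P(2) by simp
    also have "\<dots> = fm (B * P)" using fm_mult[of B P] dims P(2) that(2) by simp
    finally have PB: "P * B = B * P"
      by (rule fm_inj[OF _ mult_carrier_mat[OF P(1) that(1)] mult_carrier_mat[OF that(1) P(1)]])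
    have v: "v \<in> carrier_vec d" "P *\<^sub>v v = v" using that(3) by (simp_all add: M_def)
    have "P *\<^sub>v (B *\<^sub>v v) = P * B *\<^sub>v v" by (rule assoc_mult_mat_vec[OF P(1) that(1) v(1), symmetric])
    also have "\<dots> = B *\<^sub>v (P *\<^sub>v v)" unfolding PB by (rule assoc_mult_mat_vec[OF that(1) P(1) v(1)])
    finally have "P *\<^sub>v (B *\<^sub>v v) = B *\<^sub>v v" unfolding v(2) .
    moreover have "B *\<^sub>v v \<in> carrier_vec d" using that(1) v(1) by (rule mult_mat_vec_carrier)
    ultimately show ?thesis unfolding M_def by blast
  qed
  have Ac: "A s \<in> carrier_mat d d" for s using A by (simp add: tuples_def)
  have "reducing_subspace d A M" unfolding reducing_subspace_def
  proof (intro conjI allI ballI)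
    show "VectorSpace.subspace class_ring M (module_vec TYPE(complex) d)"
    proof -
      have sub: "M \<subseteq> carrier_vec d" by (auto simp: M_def)
      have zero: "0\<^sub>v d \<in> M" using P(1) by (auto simp: M_def intro!: eq_vecI)
      have add: "v + w \<in> M" if "v \<in> M" "w \<in> M" for v w
        using that mult_add_distrib_mat_vec[OF P(1), of v w] by (simp add: M_def)
      have smult: "c \<cdot>\<^sub>v v \<in> M" if "v \<in> M" for c v
        using that mult_mat_vec[OF P(1), of v c] by (simp add: M_def)
      show ?thesis
        unfolding VectorSpace.subspace_def LinearCombinations.submodule_def
        by (intro conjI allI impI)
          (simp_all add: vec_vs vec_module module_vec_simps class_ring_simps sub zero add smult)
    qed
    show "M \<noteq> {0\<^sub>v d}"
    proof
      assume M0: "M = {0\<^sub>v d}"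
      have "P = 0\<^sub>m d d"
      proof (rule eq_matI)
        fix i j assume ij: "i < dim_row (0\<^sub>m d d :: complex mat)" "j < dim_col (0\<^sub>m d d :: complex mat)"
        have "P *\<^sub>v col P j = col (P * P) j"
          by (rule col_mult2[OF P(1) P(1), symmetric]) (use ij in simp)
        then have "col P j \<in> M" using PP ij P(1) by (simp add: M_def)
        then have "col P j = 0\<^sub>v d" using M0 by simp
        then have "col P j $ i = 0" using ij by simp
        then show "P $$ (i, j) = 0\<^sub>m d d $$ (i, j)" using ij P(1) by simp
      qed (use P(1) in auto)
      then have "p = 0" unfolding P(2)[symmetric] by (intro fmat_eqI) simp
      then show False using p(3) by simp
    qed
    show "M \<noteq> carrier_vec d"
    proof
      assume M1: "M = carrier_vec d"
      have "P = 1\<^sub>m d"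
      proof (rule eq_matI)
        fix i j assume ij: "i < dim_row (1\<^sub>m d :: complex mat)" "j < dim_col (1\<^sub>m d :: complex mat)"
        have "unit_vec d j \<in> M" unfolding M1 by simp
        then have "P *\<^sub>v unit_vec d j = unit_vec d j" by (simp add: M_def)
        then have "(P *\<^sub>v unit_vec d j) $ i = (unit_vec d j :: complex vec) $ i" by simp
        then show "P $$ (i, j) = 1\<^sub>m d $$ (i, j)" using ij P(1) by simp
      qed (use P(1) in auto)
      then have "p = un d" unfolding P(2)[symmetric] by (simp add: fm_one)
      then show False using p(4) by simp
    qed
    fix s v assume v: "v \<in> M"
    show "A s *\<^sub>v v \<in> M" using comm[of s] by (intro inv[OF Ac _ v]) (simp add: fmt_def)
    have "p * adj (fmt A s) = adj (fmt A s) * p" using arg_cong[OF comm[of s], of adj] pp by simp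
    then show "mat_adjoint (A s) *\<^sub>v v \<in> M"
      by (intro inv[OF mat_adjoint_carrier[OF Ac] _ v]) (simp add: fmt_def fm_adjoint)
  qed
  then show ?thesis ..
qed

text \<open>With two or more summands, the projection onto the first one commutes with A and is
  nontrivial because summands have positive size; its range would be reducing. An empty list of
  summands would mean d = 0.\<close>

lemma irreducible_single_block:
  fixes A :: "('g::finite) mat_tuple"
  assumes d: "1 \<le> d" and A: "A \<in> tuples d" and irr: "\<nexists>M. reducing_subspace d A M"
    and Es: "\<forall>E\<in>set Es. block_superdiagonal E"
    and eq: "unitarily_equivalent d A (\<lambda>s. diag_block_mat (map (\<lambda>E. E s) Es))"
  shows "\<exists>E. unitarily_equivalent d A E \<and> block_superdiagonal E"
proof -
  obtain Q where Q: "unitary d Q" "\<And>s. fmt (\<lambda>s. diag_block_mat (map (\<lambda>E. E s) Es)) s = adj Q * fmt A s * Q"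
    "(\<lambda>s. diag_block_mat (map (\<lambda>E. E s) Es)) \<in> tuples d"
    by (rule unitarily_equivalentD[OF A eq]) (rule that; assumption)
  have D: "diag_block_mat (map (\<lambda>E. E s) Es) \<in> carrier_mat d d" for s using Q(3) by (simp add: tuples_def)
  show ?thesis
  proof (cases Es)
    case Nil
    then show ?thesis using D d by auto
  next
    case (Cons E Fs)
    obtain m1 where E: "1 \<le> m1" "\<And>s. E s \<in> carrier_mat m1 m1"
    proof (rule block_superdiagonal_graded[of E])
      show "block_superdiagonal E" using Es Cons by simp
    next
      fix m assume "1 \<le> m" "\<And>s. E s \<in> carrier_mat m m"
      then show thesis by (rule that)
    qed
    define G where "G s = diag_block_mat (map (\<lambda>E. E s) Fs)" for s
    obtain m2 where G: "\<And>s. G s \<in> carrier_mat m2 m2" "Fs \<noteq> [] \<longrightarrow> 1 \<le> m2"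
      using diag_block_graded[of Fs] Es Cons by (auto simp: G_def)
    have DE: "diag_block_mat (map (\<lambda>E. E s) Es) = four_block_mat (E s) (0\<^sub>m m1 m2) (0\<^sub>m m2 m1) (G s)" for s
      using E(2)[of s] G(1)[of s] by (simp add: Let_def G_def Cons)
    have dm: "d = m1 + m2" using D E(2) G(1) unfolding DE by (metis carrier_matD(1) index_mat_four_block(2))
    show ?thesis
    proof (cases Fs)
      case Nil
      then have "m2 = 0" using G(1) by (simp add: G_def) (metis carrier_matD(1) index_zero_mat(2))
      then have "diag_block_mat (map (\<lambda>E. E s) Es) = E s" for s
        unfolding DE using E(2)[of s] G(1)[of s] by (intro eq_matI) auto
      then show ?thesis using eq Es Cons by auto
    next
      case (Cons F Hs)
      then have m: "1 \<le> m2" using G(2) by simp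
      define p where "p = Q * un m1 * adj Q"
      note QD = unitaryD[OF Q(1)]
      have um: "un d * un m1 = un m1" "un m1 * un d = un m1" using dm by (simp_all add: un_mult_un min_absorb1 min_absorb2)
      have umX: "un d * (un m1 * X) = un m1 * X" for X using um by (simp add: mult.assoc[symmetric])
      have "proj p" by (simp add: proj_def p_def mult.assoc QD umX)
      moreover have "sz p d" using QD(1) dm by (simp add: p_def sz_mult sz_adj sz_un_mono)
      moreover have compr: "adj Q * p * Q = un m1" by (simp add: p_def mult.assoc QD um umX)
      moreover have "p \<noteq> 0"
      proof
        assume "p = 0"
        then have "un m1 = 0" using compr by simp
        then have "ent (un m1) 0 0 = 0" by simp
        then show False using E(1) by simp
      qed
      moreover have "p \<noteq> un d"
      proof
        assume "p = un d"
        then have "un m1 = un d" using compr by (simp add: QD)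
        then have "ent (un m1) m1 m1 = ent (un d) m1 m1" by simp
        then show False using m dm by simp
      qed
      moreover have "p * fmt A s = fmt A s * p" for s
      proof -
        define D' where "D' = fmt (\<lambda>s. diag_block_mat (map (\<lambda>E. E s) Es)) s"
        have "un m1 * D' = D' * un m1"
          by (rule fmat_eqI) (use E(2)[of s] G(1)[of s] in \<open>auto simp: D'_def fmt_def DE ent_un_mult ent_mult_un\<close>)
        moreover have AD: "fmt A s = Q * D' * adj Q"
          by (rule unitary_conj_inverse[OF Q(1) sz_fmt[OF A]]) (simp add: D'_def Q(2))
        moreover have "sz D' d" unfolding D'_def by (rule sz_fmt[OF Q(3)])
        ultimately show ?thesis
          using un_mult_sz[of D' d] by (simp add: p_def mult.assoc QD umX) (metis mult.assoc)
      qed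
      ultimately show ?thesis using commuting_projection_reducing[OF A] irr by blast
    qed
  qed
qed

theorem theorem1p1:
  fixes A :: "('g :: finite) mat_tuple" and d :: nat
  assumes "d \<ge> 1" and "A \<in> tuples d"
    and "minimal_defining_pencil d A"
  shows
    "((\<nexists>M. reducing_subspace d A M) \<longrightarrow>
        (circular (free_spectrahedron d A) \<longleftrightarrow>
          (\<exists>E. unitarily_equivalent d A E \<and> block_superdiagonal E))) \<and>
     (circular (free_spectrahedron d A) \<longleftrightarrow>
        (\<exists>Es. (\<forall>E\<in>set Es. block_superdiagonal E) \<and>
           unitarily_equivalent d A (\<lambda>s. diag_block_mat (map (\<lambda>E. E s) Es)))) \<and>
     (free_circular (free_spectrahedron d A) \<longleftrightarrow>
        (\<exists>s t F. s \<ge> 1 \<and> t \<ge> 1 \<and> s + t = d \<and> (\<forall>j. F j \<in> carrier_mat s t) \<and>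
           unitarily_equivalent d A
             (\<lambda>j. four_block_mat (0\<^sub>m s s) (F j) (0\<^sub>m t s) (0\<^sub>m t t))))"
proof (intro conjI impI)
  note A = assms(2)
  have tight: "tight (un d) (fmt A)" by (rule minimal_imp_tight[OF assms(2,3)])
  have direct_sum: "circular (free_spectrahedron d A)"
    if Es: "\<forall>E\<in>set Es. block_superdiagonal E"
      and eq: "unitarily_equivalent d A (\<lambda>s. diag_block_mat (map (\<lambda>E. E s) Es))" for Es
  proof -
    obtain m lev where D: "\<And>s. diag_block_mat (map (\<lambda>E. E s) Es) \<in> carrier_mat m m"
      "\<And>s i k. i < m \<Longrightarrow> k < m \<Longrightarrow> diag_block_mat (map (\<lambda>E. E s) Es) $$ (i, k) \<noteq> 0 \<Longrightarrow> lev k = Suc (lev i)"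
      using diag_block_graded[OF Es] by blast
    have "(\<lambda>s. diag_block_mat (map (\<lambda>E. E s) Es)) \<in> tuples d"
      by (rule unitarily_equivalentD[OF A eq])
    then have "m = d" by (rule tuples_dim) (rule D(1))
    then show ?thesis using D(2) by (intro graded_circular[OF A eq]) simp
  qed
  show iff2: "circular (free_spectrahedron d A) \<longleftrightarrow>
      (\<exists>Es. (\<forall>E\<in>set Es. block_superdiagonal E) \<and>
         unitarily_equivalent d A (\<lambda>s. diag_block_mat (map (\<lambda>E. E s) Es)))"
    using circular_block_form[OF A tight] direct_sum by blast
  show "circular (free_spectrahedron d A) \<longleftrightarrow> (\<exists>E. unitarily_equivalent d A E \<and> block_superdiagonal E)"
    if irr: "\<nexists>M. reducing_subspace d A M"
  proof
    assume "circular (free_spectrahedron d A)"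
    then show "\<exists>E. unitarily_equivalent d A E \<and> block_superdiagonal E"
      unfolding iff2 using irreducible_single_block[OF assms(1) A irr] by blast
  next
    assume "\<exists>E. unitarily_equivalent d A E \<and> block_superdiagonal E"
    then obtain E where E: "unitarily_equivalent d A E" "block_superdiagonal E" by blast
    obtain m lev where m: "\<And>s. E s \<in> carrier_mat m m"
      "\<And>s i k. i < m \<Longrightarrow> k < m \<Longrightarrow> E s $$ (i, k) \<noteq> 0 \<Longrightarrow> lev k = Suc (lev i)"
      by (rule block_superdiagonal_graded[OF E(2)]) (rule that; assumption)
    have "E \<in> tuples d" by (rule unitarily_equivalentD[OF A E(1)])
    then have "m = d" by (rule tuples_dim) (rule m(1))
    then show "circular (free_spectrahedron d A)" using m(2) by (intro graded_circular[OF A E(1)]) simp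
  qed
  show "free_circular (free_spectrahedron d A) \<longleftrightarrow>
      (\<exists>s t F. s \<ge> 1 \<and> t \<ge> 1 \<and> s + t = d \<and> (\<forall>j. F j \<in> carrier_mat s t) \<and>
         unitarily_equivalent d A (\<lambda>j. four_block_mat (0\<^sub>m s s) (F j) (0\<^sub>m t s) (0\<^sub>m t t)))"
    using free_circular_block_form[OF assms(1) A tight] block_form_free_circular[OF A] by blast
qed

end
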